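(* With the data described in the context, assume: (a) there exist nonnegative measurable functions $\kappa_1,\kappa_2,\kappa_3,\kappa_4$ on $\Xi$ with $\mathbb{E}[\kappa_i(\xi)]<\infty$ ($i=1,2,3,4$) such that for all $z_1,z_2\in\mathbb{R}^n$, $|F(z_1,\xi)-F(z_2,\xi)|\le\kappa_1(\xi)\|z_1-z_2\|$ and $\|g(z_1,\xi)\|\le\kappa_2(\xi)\|z_1\|$ for a.e. $\xi\in\Xi$, and $\|M(\xi)\|\le\kappa_3(\xi)$, $\|q(\xi)\|\le\kappa_4(\xi)$ for all $\xi\in\Xi$; (b) $D\in\mathbb{R}^{l\times m}$ has full row rank with $l<m$, and the matrix $\mathcal{R}=[BY\;\;(A-BD^\dag C)BY\;\;(A-BD^\dag C)^2BY\;\cdots\;(A-BD^\dag C)^{n-1}BY]\in\mathbb{R}^{n\times n(m-l)}$ has full row rank, where $Y\in\mathbb{R}^{m\times(m-l)}$ is a matrix of full column rank $m-l$ with $DY=0$; (c) $\mathcal{B}(0,\beta\,\mathbb{E}[\kappa_2(\xi)]\,\|\mathbb{E}[q(\xi)]\|_1)\subseteq K$; (d) the set $\mathcal{V}=\{v\in\mathbb{R}^n:\ \mathbb{E}[M(\xi)v+q(\xi)]\ge 0,\ v\ge 0\}$ is nonempty; (e) $\mathbb{E}[M(\xi)]$ is an adequate matrix or a Z-matrix; (f) $\mathbb{E}[F(\cdot,\xi)]$ is bounded from below. Then for any $\epsilon>0$, the relaxed sample average approximation problem (P$^{\epsilon,\nu}$) has an optimal solution $(x^{\epsilon,\nu},u^{\epsilon,\nu})\in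 H^1(0,T)^n\times L^2(0,T)^m$ for sufficiently large $\nu$, with probability 1.
   Context: $\|\cdot\|$ is the Euclidean norm of a vector and a matrix; $\|\cdot\|_1$ is the 1-norm. $L^2(0,T)^n$ carries the norm $\|x\|_{L^2}=(\int_0^T\|x(t)\|^2dt)^{1/2}$; $H^1(0,T)^n$ is the space of $x\in L^2(0,T)^n$ with weak derivative $\dot x\in L^2(0,T)^n$, with $\|x\|_{H^1}=(\|x\|_{L^2}^2+\|\dot x\|_{L^2}^2)^{1/2}$. $\mathcal{B}(v,\varepsilon)=\{w:\|w-v\|\le\varepsilon\}$; $\mathrm{dist}(z,K)=\inf_{z'\in K}\|z-z'\|$. $D^\dag$ is the pseudoinverse of $D$ ($D^\dag=D^\top(DD^\top)^{-1}$ when $D$ has full row rank). Vector inequalities and $\min$ of vectors are componentwise. Data: $\xi$ is a random variable on a probability space $(\Omega,\mathcal{F},\mathcal{P})$ with support $\Xi=\xi(\Omega)\subseteq\mathbb{R}^d$, and $\xi_1,\dots,\xi_\nu$ is an i.i.d. sample of $\xi$. $A\in\mathbb{R}^{n\times n}$, $B\in\mathbb{R}^{n\times m}$, $C\in\mathbb{R}^{l\times n}$, $D\in\mathbb{R}^{l\times m}$, $x_0\in\mathbb{R}^n$, $f\in L^2(0,T)^l$, $\delta>0$, $x_d\in L^2(0,T)^n$, $u_d\in L^2(0,T)^m$; $K\subseteq\mathbb{R}^{\ell}$ is nonempty, closed, convex. $F:\mathbb{R}^n\times\Xi\to\mathbb{R}$ and $g:\mathbb{R}^n\times\Xi\to\mathbb{R}^{\ell}$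 are continuously differentiable in the first variable for a.e. $\xi\in\Xi$ and measurable in $\xi$ for each first argument; $M:\Xi\to\mathbb{R}^{n\times n}$ and $q:\Xi\to\mathbb{R}^n$ are measurable. Problem (P$^{\epsilon,\nu}$): minimize over $(x,u)\in H^1(0,T)^n\times L^2(0,T)^m$ $$\Phi^\nu(x,u)=\frac1\nu\sum_{j=1}^\nu F(x(T),\xi_j)+\tfrac12\|x-x_d\|_{L^2}^2+\tfrac{\delta}{2}\|u-u_d\|_{L^2}^2$$ subject to $\dot x(t)=Ax(t)+Bu(t)$ and $Cx(t)+Du(t)-f(t)\le 0$ for a.e. $t\in(0,T)$; $\left\|\min\{x(T),\frac1\nu\sum_{j=1}^\nu[M(\xi_j)x(T)+q(\xi_j)]\}\right\|\le\epsilon$; $x(0)=x_0$; $\frac1\nu\sum_{j=1}^\nu g(x(T),\xi_j)\in K^\epsilon:=\{z:\mathrm{dist}(z,K)\le\epsilon\}$. For $J\subseteq\{1,\dots,n\}$ nonempty, $\mathbb{E}[M_{J,J}(\xi)]$ is the principal submatrix of $\mathbb{E}[M(\xi)]$ with rows and columns in $J$. Let $\mathcal{J}=\{J:\mathbb{E}[M_{J,J}(\xi)]\text{ is nonsingular}\}$; $\beta=1$ if $\mathcal{J}=\emptyset$, and $\beta=\max\{\|(\mathbb{E}[M_{J,J}(\xi)])^{-1}\|_1: J\in\mathcal{J}\}$ otherwise. A square matrix is a Z-matrix if its off-diagonal entries are non-positive. A matrix $N\in\mathbb{R}^{n\times n}$ is column adequate if for each $z\in\mathbb{R}^n$, $z_i(Nz)_i\le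 0$ for all $i$ implies $Nz=0$; row adequate if $N^\top$ is column adequate; adequate if both. *)

theory Defs
  imports "HOL-Probability.Probability"
begin

section \<open>Matrices\<close>

text \<open>Moore--Penrose pseudoinverse, specified by the four Penrose equations.\<close>

definition is_pseudoinverse :: "real^'m^'l \<Rightarrow> real^'l^'m \<Rightarrow> bool" where
  "is_pseudoinverse D X \<longleftrightarrow>
     D ** X ** D = D \<and> X ** D ** X = X \<and>
     transpose (D ** X) = D ** X \<and> transpose (X ** D) = X ** D"

definition pseudoinverse :: "real^'m^'l \<Rightarrow> real^'l^'m" where
  "pseudoinverse D = (THE X. is_pseudoinverse D X)"

lemma is_pseudoinverse_unique:
  assumes "is_pseudoinverse D X" "is_pseudoinverse D Z"
  shows "X = Z"
proof -
  have X: "D ** X ** D = D" "X ** D ** X = X" "transpose (D ** X) = D ** X" "transpose (X ** D) = X ** D"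
    and Z: "D ** Z ** D = D" "Z ** D ** Z = Z" "transpose (D ** Z) = D ** Z" "transpose (Z ** D) = Z ** D"
    using assms by (auto simp: is_pseudoinverse_def)
  have "D ** X = transpose (D ** Z ** (D ** X))"
    using X(3) Z(1) by (simp add: matrix_mul_assoc)
  also have "\<dots> = (D ** X) ** (D ** Z)"
    using X(3) Z(3) by (simp add: matrix_transpose_mul)
  also have "\<dots> = D ** Z"
    using X(1) by (simp add: matrix_mul_assoc)
  finally have DX: "D ** X = D ** Z" .
  have "X ** D = transpose ((X ** D) ** (Z ** D))"
    by (metis X(4) Z(1) matrix_mul_assoc)
  also have "\<dots> = (Z ** D) ** (X ** D)"
    using X(4) Z(4) by (simp add: matrix_transpose_mul)
  also have "\<dots> = Z ** D"
    by (metis X(1) matrix_mul_assoc)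
  finally have XD: "X ** D = Z ** D" .
  have "X = X ** (D ** X)"
    using X(2) by (simp add: matrix_mul_assoc)
  also have "\<dots> = (X ** D) ** Z"
    by (simp add: DX matrix_mul_assoc)
  also have "\<dots> = Z"
    using Z(2) by (simp add: XD)
  finally show ?thesis .
qed

lemma pseudoinverse_full_row_rank:
  fixes D :: "real^'m^'l"
  assumes "rank D = CARD('l)"
  shows "is_pseudoinverse D (transpose D ** matrix_inv (D ** transpose D))"
    and "pseudoinverse D = transpose D ** matrix_inv (D ** transpose D)"
proof -
  have "inj ((*v) (transpose D))"
    using assms by (simp add: full_rank_injective [symmetric] rank_transpose)
  have ker: "y = 0" if "(D ** transpose D) *v y = 0" for y
  proof -
    have "(transpose D *v y) \<bullet> (transpose D *v y) = y \<bullet> ((D ** transpose D) *v y)"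
      by (metis dot_lmul_matrix inner_commute matrix_vector_mul_assoc
          transpose_matrix_vector)
    then have "transpose D *v y = 0"
      using that by simp
    then show "y = 0"
      using \<open>inj ((*v) (transpose D))\<close> by (metis injD matrix_vector_mult_0_right)
  qed
  have inv: "invertible (D ** transpose D)"
    using ker by (metis invertible_left_inverse matrix_left_invertible_ker)
  let ?G = "D ** transpose D"
  have G: "?G ** matrix_inv ?G = mat 1"
    using inv unfolding invertible_def matrix_inv_def by (rule someI2_ex) simp
  have sym: "transpose (matrix_inv ?G) = matrix_inv ?G"
  proof -
    have "transpose (matrix_inv ?G) ** ?G = mat 1"
      using arg_cong [OF G, of transpose]
      by (simp add: matrix_transpose_mul)
    then show ?thesis
      by (metis G matrix_mul_assoc matrix_mul_lid matrix_mul_rid)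
  qed
  show *: "is_pseudoinverse D (transpose D ** matrix_inv ?G)"
    unfolding is_pseudoinverse_def
    using G sym by (simp add: matrix_mul_assoc matrix_transpose_mul)
       (metis matrix_mul_assoc matrix_mul_rid)
  show "pseudoinverse D = transpose D ** matrix_inv ?G"
    unfolding pseudoinverse_def
    using * is_pseudoinverse_unique by (intro the_equality) auto
qed

definition matrix_power :: "real^'n^'n \<Rightarrow> nat \<Rightarrow> real^'n^'n" where
  "matrix_power X k = (((**) X) ^^ k) (mat 1)"

text \<open>
  The block matrix \<open>[G, X G, X\<^sup>2 G, \<dots>, X\<^sup>n\<^sup>-\<^sup>1 G]\<close> with
  \<open>n = CARD('n)\<close>. Its columns are indexed by pairs \<open>(p, c)\<close>, where \<open>p\<close> selects
  the block and \<open>c\<close> the column inside it; \<open>to_nat_on UNIV\<close> is a bijection from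
  the finite type \<open>'n\<close> onto \<open>{0, \<dots>, n - 1}\<close>, so every exponent occurs exactly once.
\<close>

definition controllability_matrix :: "real^'n^'n \<Rightarrow> real^'k^'n \<Rightarrow> real^('n \<times> 'k)^'n" where
  "controllability_matrix X G =
     (\<chi> i pc. (matrix_power X (to_nat_on (UNIV :: 'n set) (fst pc)) ** G) $ i $ snd pc)"

definition Z_matrix :: "real^'n^'n \<Rightarrow> bool" where
  "Z_matrix N \<longleftrightarrow> (\<forall>i j. i \<noteq> j \<longrightarrow> N $ i $ j \<le> 0)"

definition column_adequate :: "real^'n^'n \<Rightarrow> bool" where
  "column_adequate N \<longleftrightarrow> (\<forall>z. (\<forall>i. z $ i * (N *v z) $ i \<le> 0) \<longrightarrow> N *v z = 0)"

definition row_adequate :: "real^'n^'n \<Rightarrow> bool" where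
  "row_adequate N \<longleftrightarrow> column_adequate (transpose N)"

definition adequate :: "real^'n^'n \<Rightarrow> bool" where
  "adequate N \<longleftrightarrow> column_adequate N \<and> row_adequate N"

text \<open>
  The order of a principal submatrix \<open>N\<^sub>J\<^sub>,\<^sub>J\<close> varies with \<open>J\<close>, so matrices with rows and
  columns in \<open>J\<close> are represented by full-size matrices of which only the entries in
  \<open>J \<times> J\<close> are ever inspected.
\<close>

definition inverse_on :: "'n set \<Rightarrow> real^'n^'n \<Rightarrow> real^'n^'n \<Rightarrow> bool" where
  "inverse_on J N R \<longleftrightarrow>
     (\<forall>i\<in>J. \<forall>j\<in>J. (\<Sum>k\<in>J. N $ i $ k * R $ k $ j) = (if i = j then 1 else 0) \<and>
                    (\<Sum>k\<in>J. R $ i $ k * N $ k $ j) = (if i = j then 1 else 0))"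

definition nonsingular_on :: "'n set \<Rightarrow> real^'n^'n \<Rightarrow> bool" where
  "nonsingular_on J N \<longleftrightarrow> (\<exists>R. inverse_on J N R)"

text \<open>The entries in \<open>J \<times> J\<close> of an inverse are unique; the others are irrelevant.\<close>

definition inv_on :: "'n set \<Rightarrow> real^'n^'n \<Rightarrow> real^'n^'n" where
  "inv_on J N = (SOME R. inverse_on J N R)"

definition vec_norm1 :: "real^'n \<Rightarrow> real" where
  "vec_norm1 v = (\<Sum>i\<in>UNIV. \<bar>v $ i\<bar>)"

text \<open>The matrix 1-norm is the one induced by the vector 1-norm: the maximal column sum.\<close>

definition matrix_norm1_on :: "'n set \<Rightarrow> real^'n^'n \<Rightarrow> real" where
  "matrix_norm1_on J R = Max ((\<lambda>j. \<Sum>i\<in>J. \<bar>R $ i $ j\<bar>) ` J)"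

definition nonsingular_index_sets :: "real^'n^'n \<Rightarrow> 'n set set" where
  "nonsingular_index_sets N = {J. J \<noteq> {} \<and> nonsingular_on J N}"

definition lcp_beta :: "real^'n^'n \<Rightarrow> real" where
  "lcp_beta N =
     (if nonsingular_index_sets N = {} then 1
      else Max ((\<lambda>J. matrix_norm1_on J (inv_on J N)) ` nonsingular_index_sets N))"


section \<open>Function spaces\<close>

definition C1_map :: "('a::real_normed_vector \<Rightarrow> 'b::real_normed_vector) \<Rightarrow> bool" where
  "C1_map h \<longleftrightarrow>
     (\<exists>h'. (\<forall>z. (h has_derivative blinfun_apply (h' z)) (at z)) \<and> continuous_on UNIV h')"

definition L2 :: "real \<Rightarrow> (real \<Rightarrow> real^'n) set" where
  "L2 T = {x. x \<in> borel_measurable (lebesgue_on {0<..<T}) \<and>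
              integrable (lebesgue_on {0<..<T}) (\<lambda>t. (norm (x t))\<^sup>2)}"

definition L2_norm :: "real \<Rightarrow> (real \<Rightarrow> real^'n) \<Rightarrow> real" where
  "L2_norm T x = sqrt (\<integral>t. (norm (x t))\<^sup>2 \<partial>lebesgue_on {0<..<T})"

definition test_functions :: "real \<Rightarrow> (real \<Rightarrow> real) set" where
  "test_functions T = {\<phi>. \<phi> C1_differentiable_on UNIV \<and>
     (\<exists>S. compact S \<and> S \<subseteq> {0<..<T} \<and> (\<forall>t. t \<notin> S \<longrightarrow> \<phi> t = 0))}"

text \<open>Square-integrable weak derivatives on \<open>(0, T)\<close>; test functions are of class
  \<open>C\<^sup>1\<close> with compact support in \<open>(0, T)\<close>.\<close>

definition has_weak_derivative :: "real \<Rightarrow> (real \<Rightarrow> real^'n) \<Rightarrow> (real \<Rightarrow> real^'n) \<Rightarrow> bool" where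
  "has_weak_derivative T x v \<longleftrightarrow> v \<in> L2 T \<and>
     (\<forall>\<phi>\<in>test_functions T.
        (\<integral>t. deriv \<phi> t *\<^sub>R x t \<partial>lebesgue_on {0<..<T}) =
        - (\<integral>t. \<phi> t *\<^sub>R v t \<partial>lebesgue_on {0<..<T}))"

text \<open>
  Elements of \<open>H\<^sup>1(0,T)\<close> are represented by their representative that is continuous on
  \<open>[0,T]\<close>, which is what the point values \<open>x(0)\<close> and \<open>x(T)\<close> refer to.
\<close>

definition H1 :: "real \<Rightarrow> (real \<Rightarrow> real^'n) set" where
  "H1 T = {x. x \<in> L2 T \<and> continuous_on {0..T} x \<and> (\<exists>v. has_weak_derivative T x v)}"


section \<open>The relaxed sample average approximation problem\<close>

text \<open>
  The set \<open>\<Xi> = \<xi>(\<Omega>)\<close> carries the trace of the Borel sets; functions of the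
  random parameter are only constrained on \<open>\<Xi>\<close>.
\<close>

definition support_space :: "'w measure \<Rightarrow> ('w \<Rightarrow> 'a::topological_space) \<Rightarrow> 'a measure" where
  "support_space P \<xi> = restrict_space borel (\<xi> ` space P)"

text \<open>The distribution of \<open>\<xi>\<close> on \<open>\<Xi>\<close>; ``for a.e. \<open>\<xi> \<in> \<Xi>\<close>'' refers to it.\<close>

definition law :: "'w measure \<Rightarrow> ('w \<Rightarrow> 'a::topological_space) \<Rightarrow> 'a measure" where
  "law P \<xi> = distr P (support_space P \<xi>) \<xi>"

text \<open>
  Independent copies of \<open>\<xi>\<close>. They take values in \<open>\<Xi>\<close>, and may live on a probability
  space \<open>Q\<close> other than \<open>P\<close>, which need not carry an infinite independent sequence.
\<close>

definition iid_sample ::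
  "'v measure \<Rightarrow> (nat \<Rightarrow> 'v \<Rightarrow> 'a::topological_space) \<Rightarrow> 'w measure \<Rightarrow> ('w \<Rightarrow> 'a) \<Rightarrow> bool" where
  "iid_sample Q \<xi>s P \<xi> \<longleftrightarrow>
     prob_space.indep_vars Q (\<lambda>_. support_space P \<xi>) \<xi>s UNIV \<and>
     (\<forall>j. distr Q (support_space P \<xi>) (\<xi>s j) = law P \<xi>)"

text \<open>
  Here \<open>s 0, \<dots>, s (\<nu> - 1)\<close> is one realization of the sample
  \<open>\<xi>\<^sub>1, \<dots>, \<xi>\<^sub>\<nu>\<close>.
\<close>

definition sample_average :: "nat \<Rightarrow> (nat \<Rightarrow> 's) \<Rightarrow> ('s \<Rightarrow> 'b::real_vector) \<Rightarrow> 'b" where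
  "sample_average \<nu> s h = (1 / real \<nu>) *\<^sub>R (\<Sum>j<\<nu>. h (s j))"

definition saa_objective ::
  "real \<Rightarrow> real \<Rightarrow> (real \<Rightarrow> real^'n) \<Rightarrow> (real \<Rightarrow> real^'m) \<Rightarrow> (real^'n \<Rightarrow> 's \<Rightarrow> real) \<Rightarrow>
   nat \<Rightarrow> (nat \<Rightarrow> 's) \<Rightarrow> (real \<Rightarrow> real^'n) \<Rightarrow> (real \<Rightarrow> real^'m) \<Rightarrow> real" where
  "saa_objective T \<delta> xd ud F \<nu> s x u =
     sample_average \<nu> s (F (x T))
     + 1 / 2 * (L2_norm T (\<lambda>t. x t - xd t))\<^sup>2
     + \<delta> / 2 * (L2_norm T (\<lambda>t. u t - ud t))\<^sup>2"

text \<open>On \<open>real^'n\<close> the order is componentwise and \<open>inf\<close> is the componentwise minimum.\<close>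

definition saa_feasible ::
  "real \<Rightarrow> real^'n^'n \<Rightarrow> real^'m^'n \<Rightarrow> real^'n^'l \<Rightarrow> real^'m^'l \<Rightarrow> (real \<Rightarrow> real^'l) \<Rightarrow> real^'n \<Rightarrow>
   ('s \<Rightarrow> real^'n^'n) \<Rightarrow> ('s \<Rightarrow> real^'n) \<Rightarrow> (real^'n \<Rightarrow> 's \<Rightarrow> real^'e) \<Rightarrow> (real^'e) set \<Rightarrow>
   real \<Rightarrow> nat \<Rightarrow> (nat \<Rightarrow> 's) \<Rightarrow> (real \<Rightarrow> real^'n) \<Rightarrow> (real \<Rightarrow> real^'m) \<Rightarrow> bool" where
  "saa_feasible T A B C D f x0 M q g K \<epsilon> \<nu> s x u \<longleftrightarrow>
     x \<in> H1 T \<and> u \<in> L2 T \<and>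
     (\<exists>x'. has_weak_derivative T x x' \<and>
        (AE t in lebesgue_on {0<..<T}. x' t = A *v x t + B *v u t)) \<and>
     (AE t in lebesgue_on {0<..<T}. C *v x t + D *v u t - f t \<le> 0) \<and>
     norm (inf (x T) (sample_average \<nu> s (\<lambda>y. M y *v x T + q y))) \<le> \<epsilon> \<and>
     x 0 = x0 \<and>
     sample_average \<nu> s (g (x T)) \<in> {z. infdist z K \<le> \<epsilon>}"

end

(*
The limiting complementarity problem has a solution v for which the principal submatrix of E[M] on
the support of v is nonsingular: minimize the sum of the entries over the feasible set if E[M] is a
Z-matrix, and the size of the support over all solutions if E[M] is adequate. Hence norm v is at most
beta times the 1-norm of E[q], and E[g(v, .)] lies in K by (c). By the strong law of large numbers v satisfies the relaxed
terminal constraints for all large sample sizes, and it is reached from x0 by a control for which the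
path constraint is an equality: u = D^+ (f - C x) + Y w turns the dynamics into the controllable
system with matrices A - B D^+ C and B Y. So the sampled problem is feasible.

For a fixed sample the first term of the objective is continuous and bounded below by an affine
function of norm (x(T)), whereas the rest is a strongly convex quadratic in u. Minimizing sequences
are thus bounded, and their terminal states have a limit point z. Strong convexity supplies the
missing compactness: near-minimizers of the quadratic part with terminal state near z form a Cauchy
sequence in L^2.
*)

theory Submission
  imports Defs
begin

text \<open>Everything nonconvex, namely the cost \<open>F\<close>, the complementarity residual and
  the constraint on \<open>g\<close>, depends on the state only through \<open>x T\<close>, a point
  of a finite-dimensional space, where continuity and compactness suffice. As functions of the
  control, the remaining cost and the path constraint are convex, so midpoints are available. This
  is why the state is eliminated in favour of the control and why the minimization lemmas pair a
  functional \<open>J\<close> with a map \<open>e\<close> into a Euclidean space.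

  Probability enters in two places only. The law of large numbers is applied at the single state
  \<open>v\<close>, so no uniformity in the state is involved, and the relaxation \<epsilon> > 0
  absorbs the sampling error. Besides, almost every sample must consist of parameters at which
  \<open>F\<close> and \<open>g\<close> are continuous in the state and \<open>F\<close> has linear
  growth. The existence of a minimizer is then a deterministic statement about one sample with a
  feasible pair.

  The minimality imposed on \<open>v\<close> makes the block of E[M] on its support injective;
  otherwise a kernel vector of the block would allow an improvement.\<close>

section \<open>The strong law of large numbers\<close>

context sequence_space
begin

text \<open>The maximum of 0 and the partial sums over \<open>j < k\<close> with
  \<open>k \<le> n\<close>. The recursion splits off the first coordinate, so that the tail is again
  an independent copy of the sequence.\<close>

primrec max_sum :: "('a \<Rightarrow> real) \<Rightarrow> nat \<Rightarrow> (nat \<Rightarrow> 'a) \<Rightarrow> real" where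
  "max_sum h 0 s = 0"
| "max_sum h (Suc n) s = max 0 (h (s 0) + max_sum h n (\<lambda>i. s (Suc i)))"

lemma max_sum_nonneg: "0 \<le> max_sum h n s"
  by (cases n) auto

lemma max_sum_mono: "max_sum h n s \<le> max_sum h (Suc n) s"
proof (induction n arbitrary: s)
  case (Suc n)
  have "max_sum h n (\<lambda>i. s (Suc i)) \<le> max_sum h (Suc n) (\<lambda>i. s (Suc i))" by (rule Suc)
  then show ?case by (simp only: max_sum.simps(2)[of h "Suc n" s] max_sum.simps(2)[of h n s])
qed (simp add: max_sum_nonneg)

lemma max_sum_mono': "n \<le> k \<Longrightarrow> max_sum h n s \<le> max_sum h k s"
  by (rule lift_Suc_mono_le[of "\<lambda>n. max_sum h n s"]) (auto intro: max_sum_mono simp del: max_sum.simps)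

lemma sum_le_max_sum: "(\<Sum>j<n. h (s j)) \<le> max_sum h n s"
proof (induction n arbitrary: s)
  case (Suc n)
  have "(\<Sum>j<Suc n. h (s j)) = h (s 0) + (\<Sum>j<n. h (s (Suc j)))"
    by (rule sum.lessThan_Suc_shift)
  then show ?case using Suc[of "\<lambda>i. s (Suc i)"] by (auto simp: max_def)
qed auto

lemma measurable_shift[measurable]: "(\<lambda>s i. s (Suc i)) \<in> S \<rightarrow>\<^sub>M S"
  by (rule measurable_PiM_single') (auto simp: space_PiM)

lemma measurable_max_sum[measurable]:
  assumes [measurable]: "h \<in> borel_measurable M"
  shows "max_sum h n \<in> borel_measurable S"
proof (induction n)
  case (Suc n)
  have [measurable]: "max_sum h n \<in> borel_measurable S" by fact
  show ?case by simp
qed simp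

text \<open>An i.i.d. sequence is a first coordinate followed by an independent copy of itself; this
  invariance of \<open>S\<close> takes the place of a measure-preserving shift.\<close>

lemma integral_iter:
  fixes f :: "(nat \<Rightarrow> 'a) \<Rightarrow> real"
  assumes "f \<in> borel_measurable S"
  shows "(\<integral>s. f s \<partial>S) = (\<integral>p. f (case_nat (fst p) (snd p)) \<partial>(M \<Otimes>\<^sub>M S))"
    and "integrable S f \<longleftrightarrow> integrable (M \<Otimes>\<^sub>M S) (\<lambda>p. f (case_nat (fst p) (snd p)))"
proof -
  have m: "(\<lambda>(x, s). case_nat x s) \<in> (M \<Otimes>\<^sub>M S) \<rightarrow>\<^sub>M S" by measurable
  show "(\<integral>s. f s \<partial>S) = (\<integral>p. f (case_nat (fst p) (snd p)) \<partial>(M \<Otimes>\<^sub>M S))"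
    using integral_distr[OF m assms] by (simp add: PiM_iter[unfolded split_beta'] split_beta')
  show "integrable S f \<longleftrightarrow> integrable (M \<Otimes>\<^sub>M S) (\<lambda>p. f (case_nat (fst p) (snd p)))"
    using integrable_distr_eq[OF m assms] by (simp add: PiM_iter[unfolded split_beta'] split_beta')
qed

lemma integrable_fst_comp:
  fixes h :: "'a \<Rightarrow> real" assumes "integrable M h"
  shows "integrable (M \<Otimes>\<^sub>M S) (\<lambda>p. h (fst p))"
  using assms integrable_distr_eq[of fst "M \<Otimes>\<^sub>M S" M h]
  by (simp add: P.distr_pair_fst)

lemma integrable_snd_comp:
  fixes f :: "(nat \<Rightarrow> 'a) \<Rightarrow> real" assumes "integrable S f"
  shows "integrable (M \<Otimes>\<^sub>M S) (\<lambda>p. f (snd p))" "(\<integral>p. f (snd p) \<partial>(M \<Otimes>\<^sub>M S)) = (\<integral>s. f s \<partial>S)"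
proof -
  have "distr (M \<Otimes>\<^sub>M S) S snd = distr (distr (S \<Otimes>\<^sub>M M) (M \<Otimes>\<^sub>M S) (\<lambda>(x, y). (y, x))) S snd"
    by (subst pair_sigma_finite.distr_pair_swap) (auto intro!: pair_sigma_finite.intro M.sigma_finite_measure_axioms P.sigma_finite_measure_axioms)
  also have "\<dots> = distr (S \<Otimes>\<^sub>M M) S fst"
    by (subst distr_distr) (auto simp: comp_def split_beta' measurable_split_conv intro!: arg_cong[where f="distr _ _"])
  also have "\<dots> = S" by (rule M.distr_pair_fst)
  finally have d: "distr (M \<Otimes>\<^sub>M S) S snd = S" .
  show "integrable (M \<Otimes>\<^sub>M S) (\<lambda>p. f (snd p))"
    using assms integrable_distr_eq[of snd "M \<Otimes>\<^sub>M S" S f] by (simp add: d)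
  show "(\<integral>p. f (snd p) \<partial>(M \<Otimes>\<^sub>M S)) = (\<integral>s. f s \<partial>S)"
    using assms integral_distr[of snd "M \<Otimes>\<^sub>M S" S f] by (simp add: d)
qed

lemma integrable_max_sum:
  assumes h: "integrable M h" shows "integrable S (max_sum h n)"
proof (induction n)
  case (Suc n)
  have [measurable]: "h \<in> borel_measurable M" using h by auto
  have "integrable (M \<Otimes>\<^sub>M S) (\<lambda>p. max 0 (h (fst p) + max_sum h n (snd p)))"
    by (intro integrable_max Bochner_Integration.integrable_add integrable_fst_comp integrable_snd_comp h Suc) auto
  then show ?case by (subst integral_iter) auto
qed simp

text \<open>Garsia's maximal inequality. The event \<open>U\<close> that the partial sums are unbounded does not depend
  on the first coordinate. Integrating \<open>max_sum h (Suc n) - max_sum h n \<ge> 0\<close> over \<open>U\<close> and letting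
  \<open>n\<close> tend to infinity gives \<open>0 \<le> measure S U * (\<integral>x. h x \<partial>M)\<close>.\<close>

lemma AE_sum_bounded_above:
  fixes h :: "'a \<Rightarrow> real"
  assumes h: "integrable M h" and neg: "(\<integral>x. h x \<partial>M) < 0"
  shows "AE s in S. \<exists>b. \<forall>n. (\<Sum>j<n. h (s j)) \<le> b"
proof -
  have [measurable]: "h \<in> borel_measurable M" using h by auto
  define U where "U = {s \<in> space S. \<forall>k::nat. \<exists>n. real k \<le> max_sum h n s}"
  have U_sets[measurable]: "U \<in> sets S" unfolding U_def by measurable
  \<comment> \<open>Prepending \<open>x\<close> adds the fixed amount \<open>h x\<close> to the
    partial sums, which cannot decide whether they are unbounded.\<close>
  have shift: "case_nat x s \<in> U \<longleftrightarrow> s \<in> U" if "x \<in> space M" "s \<in> space S" for x s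
  proof -
    have sp: "case_nat x s \<in> space S" using that by (auto simp: space_PiM PiE_iff split: nat.splits)
    have "(\<forall>k::nat. \<exists>n. real k \<le> max_sum h n (case_nat x s)) \<longleftrightarrow> (\<forall>k::nat. \<exists>n. real k \<le> max_sum h n s)"
    proof safe
      fix k :: nat assume A: "\<forall>k::nat. \<exists>n. real k \<le> max_sum h n (case_nat x s)"
      obtain k' :: nat where "k' > max 0 (k + h x)" using reals_Archimedean2 by blast
      then have k': "k' > k + h x" "k' > 0" by auto
      obtain n where n: "real k' \<le> max_sum h n (case_nat x s)" using A by blast
      then obtain n' where "n = Suc n'" using k' by (cases n) auto
      then have "real k' \<le> max 0 (h x + max_sum h n' s)" using n by simp
      then have "real k \<le> max_sum h n' s" using k' by (auto simp: max_def split: if_splits)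
      then show "\<exists>n. real k \<le> max_sum h n s" by blast
    next
      fix k :: nat assume A: "\<forall>k::nat. \<exists>n. real k \<le> max_sum h n s"
      obtain k' :: nat where k': "real k' > real k - h x" using reals_Archimedean2 by blast
      obtain n where n: "real k' \<le> max_sum h n s" using A by blast
      have "real k \<le> max_sum h (Suc n) (case_nat x s)" using n k' by (auto simp: max_def)
      then show "\<exists>n. real k \<le> max_sum h n (case_nat x s)" by blast
    qed
    then show ?thesis using that sp unfolding U_def by blast
  qed
  let ?d = "\<lambda>n p. indicator U (snd p) * (max 0 (h (fst p) + max_sum h n (snd p)) - max_sum h n (snd p)) :: real"
  have int1: "integrable (M \<Otimes>\<^sub>M S) (\<lambda>p. indicator U (snd p) * max_sum h n (snd p))" for n
    by (rule Bochner_Integration.integrable_bound[OF integrable_snd_comp(1)[OF integrable_max_sum[OF h, of n]]]) (auto simp: indicator_def)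
  have int2: "integrable (M \<Otimes>\<^sub>M S) (\<lambda>p. indicator U (snd p) * max 0 (h (fst p) + max_sum h n (snd p)))" for n
    by (rule Bochner_Integration.integrable_bound[of _ "\<lambda>p. h (fst p) + max_sum h n (snd p)"])
       (auto intro!: Bochner_Integration.integrable_add integrable_fst_comp integrable_snd_comp h integrable_max_sum simp: indicator_def)
  have nonneg: "0 \<le> (\<integral>p. ?d n p \<partial>(M \<Otimes>\<^sub>M S))" for n
  proof -
    have i: "integrable S (\<lambda>s. indicator U s * max_sum h n s)" for n
      by (rule Bochner_Integration.integrable_bound[OF integrable_max_sum[OF h, of n]]) (auto simp: indicator_def)
    have "(\<integral>s. indicator U s * max_sum h n s \<partial>S) \<le> (\<integral>s. indicator U s * max_sum h (Suc n) s \<partial>S)"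
      by (intro integral_mono i mult_left_mono max_sum_mono) auto
    also have "\<dots> = (\<integral>p. indicator U (case_nat (fst p) (snd p)) * max_sum h (Suc n) (case_nat (fst p) (snd p)) \<partial>(M \<Otimes>\<^sub>M S))"
      by (rule integral_iter) simp
    also have "\<dots> = (\<integral>p. indicator U (snd p) * max 0 (h (fst p) + max_sum h n (snd p)) \<partial>(M \<Otimes>\<^sub>M S))"
      by (intro Bochner_Integration.integral_cong) (auto simp: space_pair_measure shift indicator_def)
    finally show ?thesis
      using Bochner_Integration.integral_diff[OF int2 int1, of n n] integrable_snd_comp(2)[OF i, of n]
      by (simp add: right_diff_distrib)
  qed
  \<comment> \<open>Write \<open>m\<close> for \<open>max_sum h n s\<close>. Since
    \<open>m \<ge> 0\<close>, the difference \<open>max 0 (h x + m) - m\<close> is at most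
    \<open>\<bar>h x\<bar>\<close> in absolute value, and it equals \<open>h x\<close> as soon as
    \<open>m \<ge> - h x\<close>, which on \<open>U\<close> holds for all large
    \<open>n\<close>.\<close>
  have lim: "(\<lambda>n. \<integral>p. ?d n p \<partial>(M \<Otimes>\<^sub>M S)) \<longlonglongrightarrow> (\<integral>p. indicator U (snd p) * h (fst p) \<partial>(M \<Otimes>\<^sub>M S))"
  proof (rule integral_dominated_convergence[where w="\<lambda>p. \<bar>h (fst p)\<bar>"])
    show "integrable (M \<Otimes>\<^sub>M S) (\<lambda>p. \<bar>h (fst p)\<bar>)" by (intro integrable_abs integrable_fst_comp h)
    show "AE p in M \<Otimes>\<^sub>M S. norm (?d n p) \<le> \<bar>h (fst p)\<bar>" for n
      using max_sum_nonneg[of h n] by (intro AE_I2) (auto simp: indicator_def max_def)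
    show "AE p in M \<Otimes>\<^sub>M S. (\<lambda>n. ?d n p) \<longlonglongrightarrow> indicator U (snd p) * h (fst p)"
    proof (intro AE_I2)
      fix p assume "p \<in> space (M \<Otimes>\<^sub>M S)"
      show "(\<lambda>n. ?d n p) \<longlonglongrightarrow> indicator U (snd p) * h (fst p)"
      proof (cases "snd p \<in> U")
        case True
        obtain k :: nat where k: "real k > - h (fst p)" using reals_Archimedean2 by blast
        obtain N where N: "real k \<le> max_sum h N (snd p)" using True unfolding U_def by blast
        have "\<forall>\<^sub>F n in sequentially. ?d n p = indicator U (snd p) * h (fst p)"
        proof (rule eventually_sequentiallyI[of N])
          fix n assume "N \<le> n"
          then have "max_sum h N (snd p) \<le> max_sum h n (snd p)" by (rule max_sum_mono')
          then show "?d n p = indicator U (snd p) * h (fst p)" using N k True by (auto simp: max_def)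
        qed
        then show ?thesis by (rule tendsto_eventually)
      qed simp
    qed
  qed simp_all
  have "0 \<le> (\<integral>p. indicator U (snd p) * h (fst p) \<partial>(M \<Otimes>\<^sub>M S))"
    by (rule LIMSEQ_le_const[OF lim]) (use nonneg in auto)
  also have "\<dots> = (\<integral>x. (\<integral>s. indicator U s * h x \<partial>S) \<partial>M)"
  proof -
    have "integrable (M \<Otimes>\<^sub>M S) (\<lambda>(x, s). indicator U s * h x)"
      by (rule Bochner_Integration.integrable_bound[OF integrable_fst_comp[OF h]]) (auto simp: indicator_def)
    moreover have "pair_sigma_finite M S" by unfold_locales
    ultimately show ?thesis using pair_sigma_finite.integral_fst[of M S "\<lambda>x s. indicator U s * h x"]
      by (simp add: split_beta')
  qed
  also have "\<dots> = measure S U * (\<integral>x. h x \<partial>M)" by simp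
  finally have "measure S U = 0" using neg measure_nonneg[of S U]
    by (simp add: zero_le_mult_iff)
  then have "AE s in S. s \<notin> U" using U_sets by (simp add: P.prob_eq_0)
  then show ?thesis using AE_space
  proof eventually_elim
    case (elim s)
    then obtain k :: nat where k: "\<not> (\<exists>n. real k \<le> max_sum h n s)" unfolding U_def by blast
    have "(\<Sum>j<n. h (s j)) \<le> real k" for n using k sum_le_max_sum[of h s n] by (meson linear order_trans)
    then show ?case by blast
  qed
qed

text \<open>For \<open>c'\<close> strictly between the mean and \<open>c\<close>, the partial sums
  of \<open>h - c'\<close> are almost surely bounded by some \<open>b\<close>, hence the averages by
  \<open>c' + b / n\<close>.\<close>

lemma AE_limsup_average:
  fixes h :: "'a \<Rightarrow> real"
  assumes h: "integrable M h" and c: "(\<integral>x. h x \<partial>M) < c"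
  shows "AE s in S. \<forall>\<^sub>F n in sequentially. (\<Sum>j<n. h (s j)) / real n < c"
proof -
  define m where "m = (\<integral>x. h x \<partial>M)"
  define c' where "c' = (m + c) / 2"
  have c': "m < c'" "c' < c" using c[folded m_def] by (simp_all add: c'_def)
  have "AE s in S. \<exists>b. \<forall>n. (\<Sum>j<n. h (s j) - c') \<le> b"
  proof (rule AE_sum_bounded_above)
    show "integrable M (\<lambda>x. h x - c')" using h by simp
    have "(\<integral>x. h x - c' \<partial>M) = m - c'" using h by (simp add: m_def M.prob_space)
    then show "(\<integral>x. h x - c' \<partial>M) < 0" using c' by simp
  qed
  then show ?thesis
  proof eventually_elim
    case (elim s)
    then obtain b where b: "\<And>n. (\<Sum>j<n. h (s j)) - real n * c' \<le> b" by (auto simp: sum_subtractf)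
    obtain N :: nat where "real N > max 0 (b / (c - c'))" using reals_Archimedean2 by blast
    then have N: "real N > b / (c - c')" "N > 0" by auto
    show ?case
    proof (rule eventually_sequentiallyI[of N])
      fix n assume n: "N \<le> n"
      have "b < real N * (c - c')" using N c' by (simp add: pos_divide_less_eq)
      also have "\<dots> \<le> real n * (c - c')" using n c' by (simp add: mult_right_mono)
      finally have "(\<Sum>j<n. h (s j)) < real n * c" using b[of n] by (simp add: algebra_simps)
      then show "(\<Sum>j<n. h (s j)) / real n < c" using n N by (simp add: divide_less_eq mult.commute)
    qed
  qed
qed

theorem strong_law_sequence_space:
  fixes h :: "'a \<Rightarrow> real"
  assumes h: "integrable M h"
  shows "AE s in S. (\<lambda>n. (\<Sum>j<n. h (s j)) / real n) \<longlonglongrightarrow> (\<integral>x. h x \<partial>M)"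
proof -
  define m where "m = (\<integral>x. h x \<partial>M)"
  have "AE s in S. \<forall>k. \<forall>\<^sub>F n in sequentially. (\<Sum>j<n. h (s j)) / real n < m + 1 / real (Suc k)"
    unfolding AE_all_countable by (intro allI AE_limsup_average h) (auto simp: m_def)
  moreover have "AE s in S. \<forall>k. \<forall>\<^sub>F n in sequentially. (\<Sum>j<n. - h (s j)) / real n < - m + 1 / real (Suc k)"
    unfolding AE_all_countable by (intro allI AE_limsup_average) (use h in \<open>auto simp: m_def\<close>)
  ultimately show ?thesis
  proof eventually_elim
    case (elim s)
    show ?case unfolding m_def[symmetric]
    proof (rule tendstoI)
      fix e :: real assume "e > 0"
      then obtain k where k: "1 / real (Suc k) < e" using nat_approx_posE by blast
      from elim(1)[rule_format, of k] elim(2)[rule_format, of k]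
      show "\<forall>\<^sub>F n in sequentially. dist ((\<Sum>j<n. h (s j)) / real n) m < e"
        by eventually_elim (use k in \<open>auto simp: dist_real_def sum_negf\<close>)
    qed
  qed
qed

end

text \<open>Independence makes the joint distribution of \<open>X\<close> the product measure, so
  the almost sure statement on the sequence space pulls back to \<open>Q\<close>; vectors are
  treated coordinate by coordinate.\<close>

theorem strong_law_of_large_numbers:
  fixes X :: "nat \<Rightarrow> 'v \<Rightarrow> 'a" and h :: "'a \<Rightarrow> 'b::euclidean_space"
  assumes Q: "prob_space Q" and ind: "prob_space.indep_vars Q (\<lambda>_. N) X UNIV"
    and law: "\<And>j. distr Q N (X j) = \<mu>" and h: "integrable \<mu> h"
  shows "AE \<omega> in Q. (\<lambda>n. (1 / real n) *\<^sub>R (\<Sum>j<n. h (X j \<omega>))) \<longlonglongrightarrow> (\<integral>x. h x \<partial>\<mu>)"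
proof -
  interpret Q: prob_space Q by fact
  have X[measurable]: "X j \<in> Q \<rightarrow>\<^sub>M N" for j using ind by (auto simp: Q.indep_vars_def)
  interpret \<mu>: prob_space \<mu> unfolding law[of 0, symmetric] by (intro Q.prob_space_distr X)
  interpret sequence_space \<mu> ..
  have sets: "sets \<mu> = sets N" using law[of 0] sets_distr[of Q N "X 0"] by simp
  have eq: "distr Q S (\<lambda>\<omega> i. X i \<omega>) = S"
  proof -
    have "distr Q (\<Pi>\<^sub>M i\<in>UNIV. N) (\<lambda>\<omega>. \<lambda>i\<in>UNIV. X i \<omega>) = (\<Pi>\<^sub>M i\<in>UNIV. distr Q N (X i))"
      using ind by (subst (asm) Q.indep_vars_iff_distr_eq_PiM) auto
    moreover have "sets S = sets (\<Pi>\<^sub>M i\<in>(UNIV::nat set). N)" by (intro sets_PiM_cong sets) auto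
    moreover from this have "distr Q S (\<lambda>\<omega> i. X i \<omega>) = distr Q (\<Pi>\<^sub>M i\<in>UNIV. N) (\<lambda>\<omega>. \<lambda>i\<in>UNIV. X i \<omega>)"
      by (intro distr_cong) auto
    ultimately show ?thesis by (simp add: law)
  qed
  have mX: "(\<lambda>\<omega> i. X i \<omega>) \<in> Q \<rightarrow>\<^sub>M S"
  proof -
    have "X i \<in> Q \<rightarrow>\<^sub>M \<mu>" for i using X[of i] measurable_cong_sets[OF refl sets] by blast
    then show ?thesis by (rule measurable_abs_UNIV)
  qed
  have "AE s in S. \<forall>b\<in>Basis. (\<lambda>n. (\<Sum>j<n. h (s j) \<bullet> b) / real n) \<longlonglongrightarrow> (\<integral>x. h x \<bullet> b \<partial>\<mu>)"
    by (intro AE_finite_allI strong_law_sequence_space) (use h in auto)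
  then have "AE s in distr Q S (\<lambda>\<omega> i. X i \<omega>). \<forall>b\<in>Basis. (\<lambda>n. (\<Sum>j<n. h (s j) \<bullet> b) / real n) \<longlonglongrightarrow> (\<integral>x. h x \<bullet> b \<partial>\<mu>)"
    unfolding eq .
  from AE_distrD[OF mX this] show ?thesis
  proof eventually_elim
    case (elim \<omega>)
    show ?case
    proof (subst tendsto_componentwise_iff, intro ballI)
      fix b :: 'b assume "b \<in> Basis"
      with elim show "(\<lambda>n. ((1 / real n) *\<^sub>R (\<Sum>j<n. h (X j \<omega>))) \<bullet> b) \<longlonglongrightarrow> (\<integral>x. h x \<partial>\<mu>) \<bullet> b"
        using h by (simp add: inner_sum_left)
    qed
  qed
qed

section \<open>Linear complementarity problems\<close>

lemma matrix_vector_mult_nth: "(N *v x) $ i = (\<Sum>j\<in>UNIV. N $ i $ j * x $ j)"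
  for N :: "real^'n^'m"
  by (simp add: matrix_vector_mult_def)

text \<open>Padding the block of \<open>N\<close> on \<open>J\<close> with an identity block turns
  the hypothesis into injectivity of a full-size matrix, whose inverse restricts to an inverse of
  the block.\<close>

lemma nonsingular_onI:
  fixes N :: "real^'n^'n"
  assumes inj: "\<And>z. (\<And>i. i \<notin> J \<Longrightarrow> z $ i = 0) \<Longrightarrow> (\<And>i. i \<in> J \<Longrightarrow> (N *v z) $ i = 0) \<Longrightarrow> z = 0"
  shows "nonsingular_on J N"
proof -
  define N' :: "real^'n^'n" where
    "N' = (\<chi> i j. if i \<in> J \<and> j \<in> J then N $ i $ j else if i = j then 1 else 0)"
  have row_in: "(\<Sum>k\<in>UNIV. N' $ i $ k * f k) = (\<Sum>k\<in>J. N $ i $ k * f k)" if "i \<in> J" for i and f :: "'n \<Rightarrow> real"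
    using that by (intro sum.mono_neutral_cong_right) (auto simp: N'_def)
  have row_out: "(\<Sum>k\<in>UNIV. N' $ i $ k * f k) = f i" if "i \<notin> J" for i and f :: "'n \<Rightarrow> real"
    using that by (subst sum.mono_neutral_cong_right[where S="{i}" and h="\<lambda>k. f i"]) (auto simp: N'_def)
  have "z = 0" if "N' *v z = 0" for z
  proof (rule inj)
    show z: "z $ i = 0" if "i \<notin> J" for i
      using \<open>N' *v z = 0\<close> row_out[OF that, of "($) z"] by (metis matrix_vector_mult_nth zero_index)
    show "(N *v z) $ i = 0" if "i \<in> J" for i
    proof -
      have "(N *v z) $ i = (\<Sum>k\<in>J. N $ i $ k * z $ k)"
        unfolding matrix_vector_mult_nth using z by (intro sum.mono_neutral_right) auto
      also have "\<dots> = (N' *v z) $ i"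
        using row_in[OF that, of "($) z"] by (simp add: matrix_vector_mult_nth)
      finally show ?thesis using \<open>N' *v z = 0\<close> by simp
    qed
  qed
  then obtain R where R: "R ** N' = mat 1"
    by (metis matrix_left_invertible_ker)
  then have R': "N' ** R = mat 1"
    by (simp add: matrix_left_right_inverse)
  have "inverse_on J N R"
    unfolding inverse_on_def
  proof (intro ballI conjI)
    fix i j assume ij: "i \<in> J" "j \<in> J"
    show "(\<Sum>k\<in>J. N $ i $ k * R $ k $ j) = (if i = j then 1 else 0)"
      using arg_cong[OF R', of "\<lambda>X. X $ i $ j"] row_in[OF ij(1), of "\<lambda>k. R $ k $ j"]
      by (simp add: matrix_matrix_mult_def mat_def)
    have "(\<Sum>k\<in>J. R $ i $ k * N $ k $ j) = (\<Sum>k\<in>UNIV. R $ i $ k * N' $ k $ j)"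
      using ij by (intro sum.mono_neutral_cong_left) (auto simp: N'_def)
    then show "(\<Sum>k\<in>J. R $ i $ k * N $ k $ j) = (if i = j then 1 else 0)"
      using arg_cong[OF R, of "\<lambda>X. X $ i $ j"]
      by (simp add: matrix_matrix_mult_def mat_def)
  qed
  then show ?thesis by (auto simp: nonsingular_on_def)
qed

lemma matrix_norm1_on_nonneg: "J \<noteq> {} \<Longrightarrow> 0 \<le> matrix_norm1_on J R"
  unfolding matrix_norm1_on_def
  by (subst Max_ge_iff) (auto simp: sum_nonneg)

lemma matrix_norm1_on_le_lcp_beta:
  "J \<noteq> {} \<Longrightarrow> nonsingular_on J N \<Longrightarrow> matrix_norm1_on J (inv_on J N) \<le> lcp_beta N"
  by (auto simp: lcp_beta_def nonsingular_index_sets_def intro!: Max_ge)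

lemma lcp_beta_nonneg: "0 \<le> lcp_beta N"
proof (cases "nonsingular_index_sets N = {}")
  case False
  then obtain J where J: "J \<noteq> {}" "nonsingular_on J N" by (auto simp: nonsingular_index_sets_def)
  show ?thesis
    by (rule order_trans[OF matrix_norm1_on_nonneg[OF J(1)] matrix_norm1_on_le_lcp_beta[OF J]])
qed (simp add: lcp_beta_def)

lemma vec_norm1_nonneg: "0 \<le> vec_norm1 v"
  by (simp add: vec_norm1_def sum_nonneg)

text \<open>On \<open>J\<close> the equations read \<open>v = - R p\<close> with \<open>R\<close>
  the inverse of the block, and the maximal column sum is the operator norm for the 1-norm. For
  empty \<open>J\<close> there is no block; then \<open>v = 0\<close> and nonnegativity of \<beta>
  is enough.\<close>

lemma vec_norm1_le_lcp_beta:
  fixes N :: "real^'n^'n"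
  assumes ns: "nonsingular_on J N" and v: "\<And>i. i \<notin> J \<Longrightarrow> v $ i = 0"
    and eq: "\<And>i. i \<in> J \<Longrightarrow> (N *v v + p) $ i = 0"
  shows "vec_norm1 v \<le> lcp_beta N * vec_norm1 p"
proof (cases "J = {}")
  case True
  then have "vec_norm1 v = 0" using v by (simp add: vec_norm1_def)
  then show ?thesis by (simp add: lcp_beta_nonneg vec_norm1_nonneg)
next
  case False
  define R where "R = inv_on J N"
  have R: "inverse_on J N R"
    using ns unfolding R_def inv_on_def nonsingular_on_def by (rule someI_ex)
  have vi: "v $ i = - (\<Sum>k\<in>J. R $ i $ k * p $ k)" if "i \<in> J" for i
  proof -
    have p: "p $ k = - (\<Sum>j\<in>J. N $ k $ j * v $ j)" if "k \<in> J" for k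
    proof -
      have "(N *v v) $ k = (\<Sum>j\<in>J. N $ k $ j * v $ j)"
        unfolding matrix_vector_mult_nth using v by (intro sum.mono_neutral_right) auto
      then show ?thesis using eq[OF that] by simp
    qed
    have "(\<Sum>k\<in>J. R $ i $ k * p $ k) = - (\<Sum>k\<in>J. \<Sum>j\<in>J. R $ i $ k * N $ k $ j * v $ j)"
      by (simp add: p sum_distrib_left sum_negf mult.assoc)
    also have "\<dots> = - (\<Sum>j\<in>J. (\<Sum>k\<in>J. R $ i $ k * N $ k $ j) * v $ j)"
      by (subst sum.swap) (simp add: sum_distrib_right)
    also have "\<dots> = - (\<Sum>j\<in>J. (if i = j then 1 else 0) * v $ j)"
      using R that by (simp add: inverse_on_def)
    also have "\<dots> = - v $ i"
      using that by (simp add: if_distrib[where f="\<lambda>x. x * _"] cong: if_cong)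
    finally show ?thesis by simp
  qed
  have "vec_norm1 v = (\<Sum>i\<in>J. \<bar>v $ i\<bar>)"
    unfolding vec_norm1_def using v by (intro sum.mono_neutral_right) auto
  also have "\<dots> \<le> (\<Sum>i\<in>J. \<Sum>k\<in>J. \<bar>R $ i $ k\<bar> * \<bar>p $ k\<bar>)"
    by (intro sum_mono) (simp only: vi abs_minus_cancel abs_mult[symmetric] sum_abs)
  also have "\<dots> = (\<Sum>k\<in>J. (\<Sum>i\<in>J. \<bar>R $ i $ k\<bar>) * \<bar>p $ k\<bar>)"
    by (subst sum.swap) (simp add: sum_distrib_right)
  also have "\<dots> \<le> (\<Sum>k\<in>J. matrix_norm1_on J R * \<bar>p $ k\<bar>)"
    unfolding matrix_norm1_on_def by (intro sum_mono mult_right_mono Max_ge) auto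
  also have "\<dots> = matrix_norm1_on J R * (\<Sum>k\<in>J. \<bar>p $ k\<bar>)"
    by (simp add: sum_distrib_left)
  also have "\<dots> \<le> lcp_beta N * vec_norm1 p"
    unfolding R_def vec_norm1_def
    by (intro mult_mono matrix_norm1_on_le_lcp_beta False ns lcp_beta_nonneg sum_mono2) (auto intro: sum_nonneg)
  finally show ?thesis .
qed

section \<open>Complementarity problems with a Z-matrix\<close>

definition lcp_feasible :: "real^'n^'n \<Rightarrow> real^'n \<Rightarrow> real^'n \<Rightarrow> bool" where
  "lcp_feasible N p v \<longleftrightarrow> (\<forall>i. 0 \<le> v $ i \<and> 0 \<le> (N *v v + p) $ i)"

definition lcp_solution :: "real^'n^'n \<Rightarrow> real^'n \<Rightarrow> real^'n \<Rightarrow> bool" where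
  "lcp_solution N p v \<longleftrightarrow> lcp_feasible N p v \<and> (\<forall>i. v $ i = 0 \<or> (N *v v + p) $ i = 0)"

text \<open>Lowering the other coordinates can only raise component \<open>i\<close>, because their
  coefficients in row \<open>i\<close> are nonpositive, while the diagonal coefficient meets equal
  coordinates.\<close>

lemma Z_matrix_mult_mono:
  fixes N :: "real^'n^'n"
  assumes Z: "Z_matrix N" and le: "\<And>j. y $ j \<le> a $ j" and eq: "y $ i = a $ i"
  shows "(N *v a) $ i \<le> (N *v y) $ i"
  unfolding matrix_vector_mult_nth
proof (rule sum_mono)
  fix j show "N $ i $ j * a $ j \<le> N $ i $ j * y $ j"
    using Z le[of j] eq by (cases "i = j") (auto simp: Z_matrix_def mult_left_mono_neg)
qed

text \<open>The ratio test of the simplex method: \<open>t\<close> is the largest step that keeps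
  \<open>v + t *\<^sub>R z\<close> nonnegative, and it is determined by a positive component that
  drops to 0.\<close>

lemma small_step:
  fixes v z :: "real^'n"
  assumes v: "\<And>i. 0 \<le> v $ i" and z: "\<And>i. v $ i = 0 \<Longrightarrow> 0 \<le> z $ i" and neg: "z $ m < 0"
  shows "\<exists>t>0. (\<forall>i. 0 \<le> (v + t *\<^sub>R z) $ i) \<and> (\<exists>i. 0 < v $ i \<and> (v + t *\<^sub>R z) $ i = 0)"
proof -
  let ?I = "{i. z $ i < 0}"
  define t where "t = Min ((\<lambda>i. v $ i / - z $ i) ` ?I)"
  have I: "m \<in> ?I" using neg by simp
  have vpos: "v $ i > 0" if "i \<in> ?I" for i using v[of i] z[of i] that by (cases "v $ i = 0") auto
  have "t \<in> (\<lambda>i. v $ i / - z $ i) ` ?I"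
    unfolding t_def using I by (intro Min_in) auto
  then obtain i where i: "i \<in> ?I" "t = v $ i / - z $ i" by blast
  have t: "t > 0" unfolding i(2) using i(1) vpos[OF i(1)] by (intro divide_pos_pos) auto
  have nn: "0 \<le> (v + t *\<^sub>R z) $ j" for j
  proof (cases "j \<in> ?I")
    case True
    then have "t \<le> v $ j / - z $ j" unfolding t_def by (intro Min_le) auto
    then have "t * - z $ j \<le> v $ j" using True by (subst (asm) pos_le_divide_eq) auto
    then show ?thesis by simp
  next
    case False then show ?thesis using v[of j] t by simp
  qed
  have "t * z $ i = - v $ i" using i by simp
  then have "(v + t *\<^sub>R z) $ i = 0" by simp
  then show ?thesis using t nn vpos[OF i(1)] by blast
qed

text \<open>Minimality of the entry sum could be violated in two ways: if some \<open>v $ i\<close>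
  and its residual are both positive, \<open>v $ i\<close> can be lowered; if the block on the
  support has a kernel vector \<open>z\<close>, a move along \<open>z\<close> or \<open>- z\<close>,
  followed by a minimum with \<open>v\<close>, lowers the sum.\<close>

lemma lcp_solution_Z_matrix:
  fixes N :: "real^'n^'n"
  assumes Z: "Z_matrix N" and feas: "lcp_feasible N p u"
  obtains v where "lcp_solution N p v" "nonsingular_on {i. v $ i \<noteq> 0} N"
proof -
  let ?s = "\<lambda>v::real^'n. \<Sum>i\<in>UNIV. v $ i"
  \<comment> \<open>The cut at the sum of \<open>u\<close> makes the feasible set compact, since the
    sum bounds the norm of a nonnegative vector.\<close>
  define X where "X = {v. lcp_feasible N p v \<and> ?s v \<le> ?s u}"
  have "closed X" unfolding X_def lcp_feasible_def
    by (intro closed_Collect_conj closed_Collect_all closed_Collect_le continuous_intros)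
  moreover have "bounded X"
  proof (rule boundedI)
    fix v assume "v \<in> X"
    then have "norm v \<le> ?s v" using norm_le_l1_cart[of v] by (simp add: X_def lcp_feasible_def)
    then show "norm v \<le> ?s u" using \<open>v \<in> X\<close> by (simp add: X_def)
  qed
  ultimately have "compact X" by (simp add: compact_eq_bounded_closed)
  moreover have "u \<in> X" using feas by (simp add: X_def)
  moreover have "continuous_on X ?s" by (intro continuous_intros)
  ultimately obtain v where v: "v \<in> X" "\<And>y. y \<in> X \<Longrightarrow> ?s v \<le> ?s y"
    using continuous_attains_inf[of X ?s] by blast
  have min: "?s v \<le> ?s y" if "lcp_feasible N p y" for y
    using v that by (cases "?s y \<le> ?s u") (auto simp: X_def)
  have vf: "0 \<le> v $ i" "0 \<le> (N *v v + p) $ i" for i using v(1) by (auto simp: X_def lcp_feasible_def)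
  have compl: "v $ i = 0 \<or> (N *v v + p) $ i = 0" for i
  proof (rule ccontr)
    assume "\<not> ?thesis"
    then have pos: "v $ i > 0" "(N *v v + p) $ i > 0" using vf[of i] by linarith+
    \<comment> \<open>Small enough to keep both \<open>v $ i\<close> and its residual nonnegative;
      the added 1 keeps the denominator positive when the diagonal entry is 0. The other residuals
      can only grow.\<close>
    define t where "t = min (v $ i) ((N *v v + p) $ i / (\<bar>N $ i $ i\<bar> + 1))"
    have t: "0 < t" "t \<le> v $ i" "t * (\<bar>N $ i $ i\<bar> + 1) \<le> (N *v v + p) $ i"
      using pos by (auto simp: t_def pos_le_divide_eq[symmetric])
    define y where "y = v - t *\<^sub>R axis i 1"
    have Ny: "(N *v y) $ j = (N *v v) $ j - t * N $ j $ i" for j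
      by (simp add: y_def matrix_vector_mult_diff_distrib matrix_vector_mult_scaleR matrix_vector_mult_basis column_def)
    have "lcp_feasible N p y" unfolding lcp_feasible_def
    proof (intro allI conjI)
      fix j
      show "0 \<le> y $ j" using vf(1)[of j] t by (auto simp: y_def axis_def)
      show "0 \<le> (N *v y + p) $ j"
      proof (cases "j = i")
        case True
        have "t * N $ i $ i \<le> t * (\<bar>N $ i $ i\<bar> + 1)" using t by (intro mult_left_mono) auto
        then have "t * N $ i $ i \<le> (N *v v + p) $ i" using t(3) by linarith
        then show ?thesis using True by (simp add: Ny)
      next
        case False
        then have "t * N $ j $ i \<le> 0" using Z t by (simp add: Z_matrix_def mult_nonneg_nonpos)
        then show ?thesis using vf(2)[of j] by (simp add: Ny)
      qed
    qed
    from min[OF this] have "?s v \<le> ?s v - t"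
      by (simp add: y_def sum_subtractf axis_def if_distrib[where f="\<lambda>x. _ * x"] cong: if_cong)
    then show False using t by simp
  qed
  have zero: "z = 0" if z: "\<And>i. i \<notin> {i. v $ i \<noteq> 0} \<Longrightarrow> z $ i = 0" "\<And>i. i \<in> {i. v $ i \<noteq> 0} \<Longrightarrow> (N *v z) $ i = 0" for z
  proof -
    have *: "\<not> z $ m < 0" if z: "\<And>i. v $ i = 0 \<Longrightarrow> z $ i = 0" "\<And>i. v $ i \<noteq> 0 \<Longrightarrow> (N *v z) $ i = 0" for z m
    proof
      assume neg: "z $ m < 0"
      have "\<exists>t>0. (\<forall>i. 0 \<le> (v + t *\<^sub>R z) $ i) \<and> (\<exists>i. 0 < v $ i \<and> (v + t *\<^sub>R z) $ i = 0)"
        by (rule small_step) (use vf z neg in auto)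
      then obtain t where t: "0 < t" "\<And>i. 0 \<le> (v + t *\<^sub>R z) $ i" by blast
      \<comment> \<open>The vector \<open>v + t *\<^sub>R z\<close> need not be feasible, as its
        residuals are controlled only on the support of \<open>v\<close>. Outside the support the
        minimum agrees with \<open>v\<close>, and there the residuals of \<open>v\<close> take
        over.\<close>
      define y where "y = (\<chi> i. min (v $ i) ((v + t *\<^sub>R z) $ i))"
      have "lcp_feasible N p y" unfolding lcp_feasible_def
      proof (intro allI conjI)
        fix i
        show "0 \<le> y $ i" using vf t(2)[of i] by (simp add: y_def)
        show "0 \<le> (N *v y + p) $ i"
        proof (cases "y $ i = v $ i")
          case True
          have "(N *v v) $ i \<le> (N *v y) $ i" by (rule Z_matrix_mult_mono[OF Z _ True]) (simp add: y_def)
          then show ?thesis using vf(2)[of i] by simp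
        next
          case False
          then have eq: "y $ i = (v + t *\<^sub>R z) $ i" by (auto simp: y_def min_def)
          then have "v $ i \<noteq> 0" using False z(1)[of i] by auto
          then have "(N *v (v + t *\<^sub>R z)) $ i = (N *v v) $ i"
            using z(2) by (simp add: matrix_vector_right_distrib matrix_vector_mult_scaleR)
          moreover have "(N *v (v + t *\<^sub>R z)) $ i \<le> (N *v y) $ i"
            by (rule Z_matrix_mult_mono[OF Z _ eq]) (simp add: y_def)
          ultimately show ?thesis using vf(2)[of i] by simp
        qed
      qed
      from min[OF this] have "?s v \<le> ?s y" .
      moreover have "?s y < ?s v"
      proof (rule sum_strict_mono_ex1)
        have "t * z $ m < 0" using t neg by (simp add: mult_pos_neg)
        then show "\<exists>i\<in>UNIV. y $ i < v $ i" by (intro bexI[of _ m]) (auto simp: y_def)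
      qed (auto simp: y_def)
      ultimately show False by simp
    qed
    have "\<not> z $ m < 0" "\<not> (- z) $ m < 0" for m
      using *[of z m] *[of "- z" m] z by (auto simp: linear_neg[OF matrix_vector_mul_linear])
    then show ?thesis by (metis linorder_neqE_linordered_idom neg_less_0_iff_less uminus_vec_def vec_eq_iff vector_uminus_component zero_index)
  qed
  have "nonsingular_on {i. v $ i \<noteq> 0} N" by (rule nonsingular_onI) (use zero in blast)
  moreover have "lcp_solution N p v" using vf compl by (auto simp: lcp_solution_def lcp_feasible_def)
  ultimately show ?thesis using that by blast
qed


section \<open>Complementarity problems with an adequate matrix\<close>

lemma box_variational_inequality:
  fixes G :: "real^'n \<Rightarrow> real^'n"
  assumes G: "continuous_on UNIV G" and r: "0 \<le> r"
  shows "\<exists>v. \<forall>i. (0 \<le> v $ i \<and> v $ i \<le> r) \<and> (0 < v $ i \<longrightarrow> G v $ i \<le> 0) \<and> (v $ i < r \<longrightarrow> 0 \<le> G v $ i)"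
proof -
  define B :: "(real^'n) set" where "B = cbox 0 (\<chi> i. r)"
  \<comment> \<open>The point \<open>v - G v\<close> clamped to the box: a fixed point of this map
    solves the variational inequality, and Brouwer's theorem provides one.\<close>
  define \<phi> where "\<phi> = (\<lambda>v. (\<chi> i. max 0 (min r (v $ i - G v $ i))) :: real^'n)"
  have "continuous_on B G"
    by (rule continuous_on_subset[OF G]) auto
  then have cont: "continuous_on B \<phi>"
    unfolding \<phi>_def by (intro continuous_intros)
  have "compact B" "convex B" "B \<noteq> {}" "\<phi> ` B \<subseteq> B"
    using r by (auto simp: B_def \<phi>_def mem_box_cart interval_ne_empty_cart)
  then obtain v where v: "v \<in> B" "\<phi> v = v"
    using brouwer[OF _ _ _ cont] by (auto simp: Pi_iff image_subset_iff_funcset)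
  have fix_eq: "v $ i = max 0 (min r (v $ i - G v $ i))" for i
    using arg_cong[OF v(2), of "\<lambda>x. x $ i"] by (simp add: \<phi>_def)
  have "(0 \<le> v $ i \<and> v $ i \<le> r) \<and> (0 < v $ i \<longrightarrow> G v $ i \<le> 0) \<and> (v $ i < r \<longrightarrow> 0 \<le> G v $ i)" for i
    using fix_eq[of i] r by (auto simp: max_def min_def split: if_splits)
  then show ?thesis by blast
qed

text \<open>Gordan's alternative on the support of \<open>d\<close>: otherwise some \<open>a\<close> with \<open>N a > 0\<close> there could be
  shifted along the kernel vector \<open>d\<close> until its sign is reversed by \<open>N\<close>.\<close>

lemma adequate_left_kernel:
  fixes N :: "real^'n^'n"
  assumes N: "adequate N" and d: "\<And>i. 0 \<le> d $ i" "d \<noteq> 0" "N *v d = 0"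
  obtains y where "\<And>i. 0 \<le> y $ i" "y \<noteq> 0" "\<And>i. d $ i = 0 \<Longrightarrow> y $ i = 0" "transpose N *v y = 0"
proof -
  define J where "J = {i. d $ i \<noteq> 0}"
  have J: "J \<noteq> {}" using d(2) by (auto simp: J_def vec_eq_iff)
  have dpos: "0 < d $ i" if "i \<in> J" for i using d(1)[of i] that by (auto simp: J_def)
  define L where "L = (\<lambda>y::real^'n. (\<chi> j. if j \<in> J then (transpose N *v y) $ j else 0) :: real^'n)"
  define E :: "(real^'n) set" where "E = convex hull ((\<lambda>i. axis i 1) ` J)"
  have L: "linear L"
    by (rule linearI) (auto simp: L_def vec_eq_iff matrix_vector_right_distrib matrix_vector_mult_scaleR)
  have "compact E" "convex E" unfolding E_def by (auto intro: finite_imp_compact_convex_hull)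
  then have S: "closed (L ` E)" "convex (L ` E)"
    using L by (auto intro!: compact_imp_closed compact_continuous_image linear_continuous_on convex_linear_image
      simp: linear_conv_bounded_linear)
  have "0 \<in> L ` E"
  proof (rule ccontr)
    assume "0 \<notin> L ` E"
    from separating_hyperplane_closed_0[OF S(2,1) this]
    obtain a b where ab: "0 < b" "\<And>x. x \<in> L ` E \<Longrightarrow> b < a \<bullet> x" by blast
    define a' where "a' = (\<chi> j. if j \<in> J then a $ j else 0)"
    have Na: "0 < (N *v a') $ i" if "i \<in> J" for i
    proof -
      have "axis i 1 \<in> E" using that by (auto simp: E_def intro!: hull_inc)
      then have "0 < a \<bullet> L (axis i 1)" using ab by force
      also have "\<dots> = (N *v a') $ i"
        unfolding inner_vec_def matrix_vector_mult_nth
        by (rule sum.cong) (auto simp: L_def a'_def matrix_vector_mult_basis column_def transpose_def)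
      finally show ?thesis .
    qed
    \<comment> \<open>The least \<open>t\<close> with
      \<open>\<bar>a $ i\<bar> \<le> t * d $ i\<close> on \<open>J\<close>, which makes
      \<open>z\<close> nonpositive. As \<open>N *v z\<close> is still positive on \<open>J\<close>,
      column adequacy gives the contradiction \<open>N *v z = 0\<close>.\<close>
    define t where "t = Max ((\<lambda>i. \<bar>a $ i\<bar> / d $ i) ` J)"
    define z where "z = a' - t *\<^sub>R d"
    have z: "z $ i \<le> 0" for i
    proof (cases "i \<in> J")
      case True
      then have "\<bar>a $ i\<bar> / d $ i \<le> t" unfolding t_def by (intro Max_ge) auto
      then have "\<bar>a $ i\<bar> \<le> t * d $ i" using dpos[OF True] by (simp add: pos_divide_le_eq)
      then show ?thesis using True by (simp add: z_def a'_def)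
    next
      case False then show ?thesis by (simp add: z_def a'_def J_def)
    qed
    have Nz: "N *v z = N *v a'"
      by (simp add: z_def matrix_vector_mult_diff_distrib matrix_vector_mult_scaleR d)
    have "z $ i * (N *v z) $ i \<le> 0" for i
    proof (cases "i \<in> J")
      case True
      then show ?thesis using z[of i] Na[of i] by (simp add: Nz mult_nonpos_nonneg)
    next
      case False then show ?thesis by (simp add: z_def a'_def J_def)
    qed
    then have "N *v z = 0" using N by (simp add: adequate_def column_adequate_def)
    then show False using J Na Nz by force
  qed
  then obtain y where y: "y \<in> E" "L y = 0" by force
  define W where "W = {y::real^'n. (\<forall>i. 0 \<le> y $ i) \<and> (\<forall>i. i \<notin> J \<longrightarrow> y $ i = 0) \<and> (\<Sum>i\<in>UNIV. y $ i) = 1}"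
  have "E \<subseteq> W" unfolding E_def
  proof (rule hull_minimal)
    show "(\<lambda>i. axis i 1) ` J \<subseteq> W" by (auto simp: W_def axis_def)
    show "convex W"
      by (rule convexI) (auto simp: W_def sum.distrib sum_distrib_left[symmetric])
  qed
  then have yW: "y \<in> W" using y by auto
  \<comment> \<open>\<open>L y = 0\<close> only says that \<open>transpose N *v y\<close> vanishes
    on \<open>J\<close>. Outside \<open>J\<close> the entries of \<open>y\<close> vanish instead, so
    all products are 0 and row adequacy settles the remaining components.\<close>
  have "y $ i * (transpose N *v y) $ i \<le> 0" for i
  proof (cases "i \<in> J")
    case True
    then show ?thesis using arg_cong[OF y(2), of "\<lambda>x. x $ i"] by (simp add: L_def)
  next
    case False
    then show ?thesis using yW by (simp add: W_def)
  qed
  then have "transpose N *v y = 0" using N by (simp add: adequate_def row_adequate_def column_adequate_def)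
  moreover have "y \<noteq> 0" using yW by (auto simp: W_def)
  ultimately show ?thesis using that[of y] yW by (auto simp: W_def J_def)
qed


text \<open>Before the limit the residuals may be negative at the upper faces of the box, so the
  products are only nonpositive. In the limit both factors are nonnegative, which forces the
  products to vanish.\<close>

lemma vi_limit_bounded:
  fixes N :: "real^'n^'n"
  assumes v: "v \<longlonglongrightarrow> l" and \<epsilon>: "\<epsilon> \<longlonglongrightarrow> 0"
    and w: "\<And>k. w k = N *v v k + \<epsilon> k *\<^sub>R v k + p"
    and nn: "\<And>k i. 0 \<le> v k $ i" and ev: "\<And>i. \<forall>\<^sub>F k in sequentially. 0 \<le> w k $ i"
    and compl: "\<And>k i. v k $ i * w k $ i \<le> 0"
  shows "lcp_solution N p l"
proof -
  have "bounded_linear ((*v) N)" by (rule matrix_vector_mul_bounded_linear)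
  from bounded_linear.tendsto[OF this v]
  have "(\<lambda>k. N *v v k + \<epsilon> k *\<^sub>R v k + p) \<longlonglongrightarrow> N *v l + 0 *\<^sub>R l + p"
    by (intro tendsto_intros v \<epsilon>)
  then have wl: "(\<lambda>k. w k $ i) \<longlonglongrightarrow> (N *v l + p) $ i" for i
    unfolding w[symmetric] by (intro tendsto_vec_nth) simp
  have vl: "(\<lambda>k. v k $ i) \<longlonglongrightarrow> l $ i" for i by (intro tendsto_vec_nth v)
  have l: "0 \<le> l $ i" for i by (rule LIMSEQ_le_const[OF vl]) (use nn in auto)
  have wn: "0 \<le> (N *v l + p) $ i" for i
    by (rule tendsto_lowerbound[OF wl ev]) simp
  have "l $ i * (N *v l + p) $ i \<le> 0" for i
    by (rule LIMSEQ_le_const2[OF tendsto_mult[OF vl wl]]) (use compl in auto)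
  then have "l $ i * (N *v l + p) $ i = 0" for i using l[of i] wn[of i] by (intro antisym mult_nonneg_nonneg)
  then show ?thesis using l wn by (simp add: lcp_solution_def lcp_feasible_def)
qed

text \<open>Variational inequalities for \<open>N + I / (k + 1)\<close> on the boxes \<open>[0, k + 1]\<^sup>n\<close>: a bounded subsequence of
  solutions leads to a solution of the complementarity problem, and if the norms tend to infinity the
  limiting direction \<open>d\<close> lies in the kernel of \<open>N\<close>, which contradicts feasibility.\<close>

lemma lcp_solution_adequate_exists:
  fixes N :: "real^'n^'n"
  assumes N: "adequate N" and feas: "lcp_feasible N p u"
  shows "\<exists>v. lcp_solution N p v"
proof -
  define G where "G = (\<lambda>k v. N *v v + (1 / real (Suc k)) *\<^sub>R v + p)"
  have "\<forall>k. \<exists>v. \<forall>i. (0 \<le> v $ i \<and> v $ i \<le> real (Suc k)) \<and> (0 < v $ i \<longrightarrow> G k v $ i \<le> 0)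
      \<and> (v $ i < real (Suc k) \<longrightarrow> 0 \<le> G k v $ i)"
  proof
    fix k
    have "continuous_on UNIV (G k)"
      unfolding G_def
      by (intro continuous_intros linear_continuous_on matrix_vector_mul_bounded_linear)
    then show "\<exists>v. \<forall>i. (0 \<le> v $ i \<and> v $ i \<le> real (Suc k)) \<and> (0 < v $ i \<longrightarrow> G k v $ i \<le> 0)
      \<and> (v $ i < real (Suc k) \<longrightarrow> 0 \<le> G k v $ i)"
      by (rule box_variational_inequality) simp
  qed
  from choice[OF this] obtain v where v: "\<And>k i. 0 \<le> v k $ i" "\<And>k i. 0 < v k $ i \<Longrightarrow> G k (v k) $ i \<le> 0"
      "\<And>k i. v k $ i < real (Suc k) \<Longrightarrow> 0 \<le> G k (v k) $ i"
    by blast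
  have compl: "v k $ i * G k (v k) $ i \<le> 0" for k i
    using v(1)[of k i] v(2)[of k i] by (cases "v k $ i = 0") (auto intro: mult_nonneg_nonpos)
  have inv0: "(\<lambda>k. 1 / real (Suc k)) \<longlonglongrightarrow> 0" by (rule LIMSEQ_Suc[OF lim_1_over_n])
  show ?thesis
  proof (cases "filterlim (\<lambda>k. norm (v k)) at_top sequentially")
    case False
    then obtain b where b: "\<not> (\<forall>\<^sub>F k in sequentially. b \<le> norm (v k))"
      by (auto simp: filterlim_at_top)
    have "infinite {k. norm (v k) \<le> b}"
      unfolding infinite_nat_iff_unbounded_le
      using b unfolding eventually_sequentially by (auto simp: not_le intro: less_imp_le)
    from infinite_enumerate[OF this]
    obtain r :: "nat \<Rightarrow> nat" where r: "strict_mono r" and "\<forall>k. r k \<in> {k. norm (v k) \<le> b}" by blast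
    then have rb: "norm (v (r k)) \<le> b" for k by simp
    have "compact (cball (0::real^'n) b)" by simp
    moreover have "\<forall>k. (v \<circ> r) k \<in> cball 0 b" using rb by simp
    ultimately obtain l s where s: "strict_mono s" "((v \<circ> r) \<circ> s) \<longlonglongrightarrow> l"
      unfolding compact_eq_seq_compact_metric seq_compact_def by blast
    let ?q = "\<lambda>k. r (s k)"
    have q: "strict_mono ?q" using r s(1) by (simp add: strict_mono_def)
    have "lcp_solution N p l"
    proof (rule vi_limit_bounded)
      show "(\<lambda>k. v (?q k)) \<longlonglongrightarrow> l" using s(2) by (simp add: comp_def)
      show "(\<lambda>k. 1 / real (Suc (?q k))) \<longlonglongrightarrow> 0"
        using LIMSEQ_subseq_LIMSEQ[OF inv0 q] by (simp add: comp_def)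
      show "G (?q k) (v (?q k)) = N *v v (?q k) + (1 / real (Suc (?q k))) *\<^sub>R v (?q k) + p" for k
        by (simp add: G_def)
      show "\<forall>\<^sub>F k in sequentially. 0 \<le> G (?q k) (v (?q k)) $ i" for i
      proof -
        \<comment> \<open>Once the side of the box exceeds the bound \<open>b\<close>, its upper
          faces are inactive and the residuals are nonnegative.\<close>
        obtain m :: nat where m: "b < real m" using reals_Archimedean2 by blast
        show ?thesis
        proof (rule eventually_sequentiallyI[of m])
          fix k assume "m \<le> k"
          also have "k \<le> ?q k" using q by (rule strict_mono_imp_increasing)
          finally have "real m \<le> real (Suc (?q k))" by simp
          moreover have "v (?q k) $ i \<le> b" using component_le_norm_cart[of "v (?q k)" i] rb[of "s k"] by simp
          ultimately show "0 \<le> G (?q k) (v (?q k)) $ i" using m by (intro v(3)) simp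
        qed
      qed
    qed (rule v(1) compl)+
    then show ?thesis by blast
  next
    case True
    define e where "e = (\<lambda>k. (1 / norm (v k)) *\<^sub>R v k)"
    have "compact (cball (0::real^'n) 1)" by simp
    moreover have "\<forall>k. e k \<in> cball 0 1" by (auto simp: e_def)
    ultimately obtain d r where r: "strict_mono r" "(e \<circ> r) \<longlonglongrightarrow> d"
      unfolding compact_eq_seq_compact_metric seq_compact_def by blast
    have el: "(\<lambda>k. e (r k)) \<longlonglongrightarrow> d" using r by (simp add: comp_def)
    have inf: "filterlim (\<lambda>k. norm (v (r k))) at_top sequentially"
      using filterlim_compose[OF True filterlim_subseq[OF r(1)]] .
    have nz: "\<forall>\<^sub>F k in sequentially. 0 < norm (v (r k))"
      using inf unfolding filterlim_at_top_dense by (rule spec)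
    have eil: "(\<lambda>k. e (r k) $ i) \<longlonglongrightarrow> d $ i" for i by (intro tendsto_vec_nth el)
    have d: "0 \<le> d $ i" for i
      by (rule LIMSEQ_le_const[OF eil]) (use v(1) in \<open>auto simp: e_def\<close>)
    have "(\<lambda>k. norm (e (r k))) \<longlonglongrightarrow> norm d" by (intro tendsto_norm el)
    moreover have "\<forall>\<^sub>F k in sequentially. norm (e (r k)) = 1"
      using nz by eventually_elim (simp add: e_def)
    ultimately have "norm d = 1" by (rule LIMSEQ_unique[OF _ tendsto_eventually])
    then have d0: "d \<noteq> 0" by auto
    \<comment> \<open>After division by the norm, \<open>p\<close> and the regularization disappear
      in the limit. The sign of the products survives for \<open>d\<close> and
      \<open>N *v d\<close>, and column adequacy yields \<open>N *v d = 0\<close>.\<close>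
    have Ge: "(1 / norm (v (r k))) *\<^sub>R G (r k) (v (r k))
        = N *v e (r k) + (1 / real (Suc (r k))) *\<^sub>R e (r k) + (1 / norm (v (r k))) *\<^sub>R p" for k
      by (simp add: G_def e_def scaleR_add_right matrix_vector_mult_scaleR)
    have "(\<lambda>k. 1 / real (Suc (r k))) \<longlonglongrightarrow> 0"
      using LIMSEQ_subseq_LIMSEQ[OF inv0 r(1)] by (simp add: comp_def)
    moreover have "(\<lambda>k. 1 / norm (v (r k))) \<longlonglongrightarrow> 0"
      using tendsto_inverse_0_at_top[OF inf] by (simp add: divide_inverse)
    moreover have "(\<lambda>k. N *v e (r k)) \<longlonglongrightarrow> N *v d"
      by (rule bounded_linear.tendsto[OF matrix_vector_mul_bounded_linear el])
    ultimately have "(\<lambda>k. (1 / norm (v (r k))) *\<^sub>R G (r k) (v (r k))) \<longlonglongrightarrow> N *v d + 0 *\<^sub>R d + 0 *\<^sub>R p"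
      unfolding Ge by (intro tendsto_intros el)
    then have Gl: "(\<lambda>k. ((1 / norm (v (r k))) *\<^sub>R G (r k) (v (r k))) $ i) \<longlonglongrightarrow> (N *v d) $ i" for i
      by (intro tendsto_vec_nth) simp
    have "d $ i * (N *v d) $ i \<le> 0" for i
    proof (rule LIMSEQ_le_const2[OF tendsto_mult[OF eil Gl]], intro exI allI impI)
      fix k
      have "e (r k) $ i * ((1 / norm (v (r k))) *\<^sub>R G (r k) (v (r k))) $ i
          = (1 / norm (v (r k)))\<^sup>2 * (v (r k) $ i * G (r k) (v (r k)) $ i)"
        by (simp add: e_def power2_eq_square)
      also have "\<dots> \<le> 0" by (intro mult_nonneg_nonpos compl) auto
      finally show "e (r k) $ i * ((1 / norm (v (r k))) *\<^sub>R G (r k) (v (r k))) $ i \<le> 0" .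
    qed
    then have "N *v d = 0" using N by (simp add: adequate_def column_adequate_def)
    from adequate_left_kernel[OF N d d0 this] obtain y
      where y: "\<And>i. 0 \<le> y $ i" "y \<noteq> 0" "\<And>i. d $ i = 0 \<Longrightarrow> y $ i = 0" "transpose N *v y = 0" by blast
    have yN: "y \<bullet> (N *v x) = 0" for x
      using y(4) by (simp add: dot_lmul_matrix[symmetric])
    have "0 \<le> y \<bullet> (N *v u + p)"
      unfolding inner_vec_def using feas y(1) by (auto simp: lcp_feasible_def intro!: sum_nonneg)
    then have yp: "0 \<le> y \<bullet> p" by (simp add: inner_add_right yN)
    have "\<forall>\<^sub>F k in sequentially. \<forall>i. d $ i \<noteq> 0 \<longrightarrow> 0 < v (r k) $ i"
    proof (rule eventually_all_finite)
      fix i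
      show "\<forall>\<^sub>F k in sequentially. d $ i \<noteq> 0 \<longrightarrow> 0 < v (r k) $ i"
      proof (cases "d $ i = 0")
        case False
        then have "0 < d $ i" using d[of i] by simp
        from order_tendstoD(1)[OF eil this] show ?thesis
        proof eventually_elim
          case (elim k)
          then have "v (r k) $ i \<noteq> 0" by (auto simp: e_def)
          then show ?case using v(1)[of "r k" i] by simp
        qed
      qed simp
    qed
    from eventually_happens'[OF sequentially_bot this]
    obtain k where k: "\<And>i. d $ i \<noteq> 0 \<Longrightarrow> 0 < v (r k) $ i" by blast
    \<comment> \<open>The support of \<open>y\<close> lies in that of \<open>d\<close>, where
      \<open>v (r k)\<close> is positive and hence \<open>G\<close> nonpositive. But
      \<open>y\<close> annihilates the range of \<open>N\<close>, so \<open>y \<bullet> G\<close> is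
      the sum of \<open>y \<bullet> p \<ge> 0\<close> and of the contribution of the regularizing
      term, which is strictly positive.\<close>
    have "y \<bullet> G (r k) (v (r k)) \<le> 0"
      unfolding inner_vec_def
    proof (rule sum_nonpos)
      fix i show "y $ i \<bullet> G (r k) (v (r k)) $ i \<le> 0"
        using y(1)[of i] y(3)[of i] k[of i] v(2)[of "r k" i]
        by (cases "d $ i = 0") (auto intro: mult_nonneg_nonpos)
    qed
    moreover have "y \<bullet> G (r k) (v (r k)) = 1 / real (Suc (r k)) * (y \<bullet> v (r k)) + y \<bullet> p"
      by (simp add: G_def inner_add_right yN)
    moreover have "0 < y \<bullet> v (r k)"
    proof -
      obtain i where i: "y $ i \<noteq> 0" using y(2) by (auto simp: vec_eq_iff)
      show ?thesis unfolding inner_vec_def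
      proof (rule sum_pos2[of _ i])
        have "0 < y $ i" using y(1)[of i] i by simp
        moreover have "0 < v (r k) $ i" using k y(3) i by blast
        ultimately show "0 < y $ i \<bullet> v (r k) $ i" by simp
      qed (use y(1) v(1) in auto)
    qed
    then have "0 < 1 / real (Suc (r k)) * (y \<bullet> v (r k))" by simp
    ultimately have False using yp by linarith
    then show ?thesis ..
  qed
qed

text \<open>If \<open>z\<close> lives on the support of \<open>v\<close> and the block maps it to 0,
  all products \<open>z $ i * (N *v z) $ i\<close> are 0, so column adequacy gives
  \<open>N *v z = 0\<close>. Moving along \<open>z\<close> then leaves all residuals unchanged, and
  the ratio test leads to a solution with smaller support.\<close>

lemma lcp_solution_adequate:
  fixes N :: "real^'n^'n"
  assumes N: "adequate N" and feas: "lcp_feasible N p u"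
  obtains v where "lcp_solution N p v" "nonsingular_on {i. v $ i \<noteq> 0} N"
proof -
  let ?c = "\<lambda>v::real^'n. card {i. v $ i \<noteq> 0}"
  obtain v where v: "lcp_solution N p v" and min: "\<And>y. lcp_solution N p y \<Longrightarrow> ?c v \<le> ?c y"
    using ex_has_least_nat[of "lcp_solution N p" _ ?c] lcp_solution_adequate_exists[OF N feas] by blast
  have vf: "0 \<le> v $ i" "0 \<le> (N *v v + p) $ i" "v $ i = 0 \<or> (N *v v + p) $ i = 0" for i
    using v by (auto simp: lcp_solution_def lcp_feasible_def)
  have *: "\<not> z $ m < 0" if z: "\<And>i. v $ i = 0 \<Longrightarrow> z $ i = 0" "\<And>i. v $ i \<noteq> 0 \<Longrightarrow> (N *v z) $ i = 0" for z m
  proof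
    assume neg: "z $ m < 0"
    have "z $ i * (N *v z) $ i \<le> 0" for i using z[of i] by (cases "v $ i = 0") auto
    then have Nz: "N *v z = 0" using N by (simp add: adequate_def column_adequate_def)
    have "\<exists>t>0. (\<forall>i. 0 \<le> (v + t *\<^sub>R z) $ i) \<and> (\<exists>i. 0 < v $ i \<and> (v + t *\<^sub>R z) $ i = 0)"
      by (rule small_step) (use vf(1) z(1) neg in auto)
    then obtain t i where t: "0 < t" "\<And>i. 0 \<le> (v + t *\<^sub>R z) $ i"
      "v $ i > 0" "(v + t *\<^sub>R z) $ i = 0" by blast
    define y where "y = v + t *\<^sub>R z"
    have supp: "v $ j = 0 \<Longrightarrow> y $ j = 0" for j using z(1)[of j] by (simp add: y_def)
    have "N *v y = N *v v" by (simp add: y_def matrix_vector_right_distrib matrix_vector_mult_scaleR Nz)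
    moreover have "y $ i = 0 \<or> (N *v v + p) $ i = 0" for i using vf(3)[of i] supp[of i] by blast
    moreover have "0 \<le> y $ i" for i using t(2) by (simp add: y_def)
    ultimately have "lcp_solution N p y"
      using vf(2) unfolding lcp_solution_def lcp_feasible_def by simp
    from min[OF this] have "?c v \<le> ?c y" .
    moreover have "{i. y $ i \<noteq> 0} \<subset> {i. v $ i \<noteq> 0}"
    proof (rule psubsetI)
      show "{i. y $ i \<noteq> 0} \<subseteq> {i. v $ i \<noteq> 0}" using supp by blast
      show "{i. y $ i \<noteq> 0} \<noteq> {i. v $ i \<noteq> 0}" using t(3,4) unfolding y_def by force
    qed
    from psubset_card_mono[OF finite this] have "?c y < ?c v" .
    ultimately show False by linarith
  qed
  have "nonsingular_on {i. v $ i \<noteq> 0} N"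
  proof (rule nonsingular_onI)
    fix z assume z: "\<And>i. i \<notin> {i. v $ i \<noteq> 0} \<Longrightarrow> z $ i = 0" "\<And>i. i \<in> {i. v $ i \<noteq> 0} \<Longrightarrow> (N *v z) $ i = 0"
    have "\<not> z $ m < 0" "\<not> (- z) $ m < 0" for m
      using *[of z m] *[of "- z" m] z by (auto simp: linear_neg[OF matrix_vector_mul_linear])
    then show "z = 0" by (simp add: vec_eq_iff not_less antisym)
  qed
  then show ?thesis using that v by blast
qed

theorem lcp_solution_bound:
  fixes N :: "real^'n^'n"
  assumes N: "adequate N \<or> Z_matrix N" and feas: "lcp_feasible N p u"
  obtains v where "lcp_solution N p v" "norm v \<le> lcp_beta N * vec_norm1 p"
proof -
  obtain v where v: "lcp_solution N p v" "nonsingular_on {i. v $ i \<noteq> 0} N"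
    using N
  proof
    assume "adequate N"
    from lcp_solution_adequate[OF this feas] that show ?thesis by blast
  next
    assume "Z_matrix N"
    from lcp_solution_Z_matrix[OF this feas] that show ?thesis by blast
  qed
  have "vec_norm1 v \<le> lcp_beta N * vec_norm1 p"
  proof (rule vec_norm1_le_lcp_beta[OF v(2)])
    show "v $ i = 0" if "i \<notin> {i. v $ i \<noteq> 0}" for i using that by blast
    show "(N *v v + p) $ i = 0" if "i \<in> {i. v $ i \<noteq> 0}" for i
      using v(1) that unfolding lcp_solution_def by blast
  qed
  moreover have "norm v \<le> vec_norm1 v" unfolding vec_norm1_def by (rule norm_le_l1_cart)
  ultimately have "norm v \<le> lcp_beta N * vec_norm1 p" by linarith
  then show ?thesis by (rule that[OF v(1)])
qed

section \<open>Weak derivatives\<close>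

abbreviation interval_measure :: "real \<Rightarrow> real measure" where
  "interval_measure T \<equiv> lebesgue_on {0<..<T}"

lemma finite_measure_interval: "finite_measure (interval_measure T)"
  by (rule finite_measure_lebesgue_on) simp

lemma test_functionsD:
  assumes "\<phi> \<in> test_functions T"
  shows "(\<phi> has_real_derivative deriv \<phi> t) (at t)" "continuous_on UNIV (deriv \<phi>)" "continuous_on UNIV \<phi>"
    "t \<notin> {0<..<T} \<Longrightarrow> \<phi> t = 0"
proof -
  obtain D where D: "\<And>x. (\<phi> has_vector_derivative D x) (at x)" "continuous_on UNIV D"
    using assms by (auto simp: test_functions_def C1_differentiable_on_def)
  have d: "(\<phi> has_real_derivative D x) (at x)" for x
    using D(1)[of x] by (simp add: has_real_derivative_iff_has_vector_derivative)
  have eq: "deriv \<phi> = D" using DERIV_imp_deriv[OF d] by (rule ext)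
  show "(\<phi> has_real_derivative deriv \<phi> t) (at t)" using d eq by simp
  show "continuous_on UNIV (deriv \<phi>)" using D(2) eq by simp
  show "continuous_on UNIV \<phi>" using d by (intro DERIV_continuous_on) blast
  show "\<phi> t = 0" if "t \<notin> {0<..<T}" using assms that by (auto simp: test_functions_def)
qed

lemma test_functionsI:
  assumes d: "\<And>t. (\<phi> has_real_derivative d t) (at t)" and c: "continuous_on UNIV d"
    and S: "compact S" "S \<subseteq> {0<..<T}" "\<And>t. t \<notin> S \<Longrightarrow> \<phi> t = 0"
  shows "\<phi> \<in> test_functions T" "deriv \<phi> = d"
proof -
  show "\<phi> \<in> test_functions T"
    using assms unfolding test_functions_def C1_differentiable_on_def
    by (auto simp: has_real_derivative_iff_has_vector_derivative)
  show "deriv \<phi> = d" using DERIV_imp_deriv[OF d] by (rule ext)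
qed

lemma borel_measurable_interval:
  "h \<in> borel_measurable borel \<Longrightarrow> h \<in> borel_measurable (interval_measure T)"
  by (intro measurable_restrict_space1 measurable_completion) simp

lemma continuous_borel_measurable_interval:
  fixes h :: "real \<Rightarrow> 'a::topological_space"
  shows "continuous_on UNIV h \<Longrightarrow> h \<in> borel_measurable (interval_measure T)"
  by (intro borel_measurable_interval borel_measurable_continuous_onI)

lemma continuous_bounded_interval:
  fixes h :: "real \<Rightarrow> real"
  assumes "continuous_on {0..T} h"
  shows "\<exists>b\<ge>0. \<forall>t\<in>{0..T}. \<bar>h t\<bar> \<le> b"
proof -
  have "compact (h ` {0..T})" by (intro compact_continuous_image assms) auto
  then have "bounded (h ` {0..T})" by (rule compact_imp_bounded)
  then obtain b where "\<forall>x\<in>h ` {0..T}. \<bar>x\<bar> \<le> b" unfolding bounded_real ..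
  then have b: "\<forall>t\<in>{0..T}. \<bar>h t\<bar> \<le> b" by simp
  have "\<forall>t\<in>{0..T}. \<bar>h t\<bar> \<le> \<bar>b\<bar>"
  proof
    fix t assume "t \<in> {0..T}"
    then have "\<bar>h t\<bar> \<le> b" using b by blast
    then show "\<bar>h t\<bar> \<le> \<bar>b\<bar>" by linarith
  qed
  then show ?thesis by (intro exI[of _ "\<bar>b\<bar>"]) simp
qed

lemma integrable_continuous_scaleR:
  fixes x :: "real \<Rightarrow> 'a::{banach,second_countable_topology}"
  assumes h: "continuous_on UNIV h" and x: "integrable (interval_measure T) x"
  shows "integrable (interval_measure T) (\<lambda>t. h t *\<^sub>R x t)"
proof -
  obtain b where b: "0 \<le> b" "\<forall>t\<in>{0..T}. \<bar>h t\<bar> \<le> b"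
    using continuous_bounded_interval[OF continuous_on_subset[OF h subset_UNIV], of T] by blast
  show ?thesis
  proof (rule Bochner_Integration.integrable_bound[of _ "\<lambda>t. b *\<^sub>R x t"])
    show "(\<lambda>t. h t *\<^sub>R x t) \<in> borel_measurable (interval_measure T)"
      by (rule borel_measurable_scaleR[OF continuous_borel_measurable_interval[OF h] borel_measurable_integrable[OF x]])
    have "norm (h t *\<^sub>R x t) \<le> norm (b *\<^sub>R x t)" if "t \<in> {0<..<T}" for t
    proof -
      have "\<bar>h t\<bar> \<le> \<bar>b\<bar>" using b(1) bspec[OF b(2), of t] that by simp
      then show ?thesis by (simp add: mult_right_mono)
    qed
    then show "AE t in interval_measure T. norm (h t *\<^sub>R x t) \<le> norm (b *\<^sub>R x t)" by (intro AE_I2) simp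
  qed (use x in simp)
qed

lemmas integrable_continuous_mult = integrable_continuous_scaleR[where 'a=real, unfolded real_scaleR_def]

text \<open>A scalar notion with integrable functions, to which
  \<open>has_weak_derivative_iff\<close> reduces the vector-valued one; integrability is all that
  the calculus below uses.\<close>

definition weak_deriv :: "real \<Rightarrow> (real \<Rightarrow> real) \<Rightarrow> (real \<Rightarrow> real) \<Rightarrow> bool" where
  "weak_deriv T x v \<longleftrightarrow> integrable (interval_measure T) x \<and> integrable (interval_measure T) v \<and>
     (\<forall>\<phi>\<in>test_functions T. (\<integral>t. deriv \<phi> t * x t \<partial>interval_measure T) = - (\<integral>t. \<phi> t * v t \<partial>interval_measure T))"

lemma weak_deriv_sum:
  assumes "finite I" "\<And>i. i \<in> I \<Longrightarrow> weak_deriv T (x i) (v i)"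
  shows "weak_deriv T (\<lambda>t. \<Sum>i\<in>I. x i t) (\<lambda>t. \<Sum>i\<in>I. v i t)"
  unfolding weak_deriv_def
proof (intro conjI ballI)
  have x: "integrable (interval_measure T) (x i)" "integrable (interval_measure T) (v i)" if "i \<in> I" for i
    using assms(2)[OF that] by (auto simp: weak_deriv_def)
  then show "integrable (interval_measure T) (\<lambda>t. \<Sum>i\<in>I. x i t)" "integrable (interval_measure T) (\<lambda>t. \<Sum>i\<in>I. v i t)"
    by (auto intro: Bochner_Integration.integrable_sum)
  fix \<phi> assume \<phi>: "\<phi> \<in> test_functions T"
  have "(\<integral>t. deriv \<phi> t * (\<Sum>i\<in>I. x i t) \<partial>interval_measure T) = (\<Sum>i\<in>I. \<integral>t. deriv \<phi> t * x i t \<partial>interval_measure T)"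
    unfolding sum_distrib_left
    by (intro Bochner_Integration.integral_sum integrable_continuous_mult test_functionsD(2)[OF \<phi>] x)
  also have "\<dots> = (\<Sum>i\<in>I. - (\<integral>t. \<phi> t * v i t \<partial>interval_measure T))"
    using assms(2) \<phi> by (intro sum.cong) (auto simp: weak_deriv_def)
  also have "\<dots> = - (\<integral>t. \<phi> t * (\<Sum>i\<in>I. v i t) \<partial>interval_measure T)"
    unfolding sum_distrib_left sum_negf
    by (intro arg_cong[of _ _ uminus] Bochner_Integration.integral_sum[symmetric] integrable_continuous_mult test_functionsD(3)[OF \<phi>] x)
  finally show "(\<integral>t. deriv \<phi> t * (\<Sum>i\<in>I. x i t) \<partial>interval_measure T) = - (\<integral>t. \<phi> t * (\<Sum>i\<in>I. v i t) \<partial>interval_measure T)" .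
qed

text \<open>The product of a test function with \<open>a\<close> is again a test function; inserting
  it into the definition for \<open>x\<close> gives the product rule.\<close>

lemma weak_deriv_mult:
  assumes a: "\<And>t. (a has_real_derivative a' t) (at t)" "continuous_on UNIV a'"
    and xv: "weak_deriv T x v"
  shows "weak_deriv T (\<lambda>t. a t * x t) (\<lambda>t. a' t * x t + a t * v t)"
  unfolding weak_deriv_def
proof (intro conjI ballI)
  have ca: "continuous_on UNIV a" using a(1) by (intro DERIV_continuous_on) blast
  have x: "integrable (interval_measure T) x" and v: "integrable (interval_measure T) v"
    using xv by (auto simp: weak_deriv_def)
  show "integrable (interval_measure T) (\<lambda>t. a t * x t)" by (rule integrable_continuous_mult[OF ca x])
  show "integrable (interval_measure T) (\<lambda>t. a' t * x t + a t * v t)"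
    by (intro Bochner_Integration.integrable_add integrable_continuous_mult ca x v a)
  fix \<phi> assume \<phi>: "\<phi> \<in> test_functions T"
  note p = test_functionsD[OF \<phi>]
  obtain S where S: "compact S" "S \<subseteq> {0<..<T}" "\<And>t. t \<notin> S \<Longrightarrow> \<phi> t = 0"
    using \<phi> by (auto simp: test_functions_def)
  have d: "((\<lambda>t. \<phi> t * a t) has_real_derivative deriv \<phi> t * a t + \<phi> t * a' t) (at t)" for t
    using DERIV_mult[OF p(1)[of t] a(1)[of t]] by (simp add: algebra_simps)
  have c: "continuous_on UNIV (\<lambda>t. deriv \<phi> t * a t + \<phi> t * a' t)"
    by (intro continuous_intros p ca a)
  have t: "(\<lambda>t. \<phi> t * a t) \<in> test_functions T" "deriv (\<lambda>t. \<phi> t * a t) = (\<lambda>t. deriv \<phi> t * a t + \<phi> t * a' t)"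
    using test_functionsI[OF d c S(1,2)] S(3) by simp_all
  have i1: "integrable (interval_measure T) (\<lambda>t. deriv \<phi> t * (a t * x t))"
    by (intro integrable_continuous_mult p ca x)
  have i2: "integrable (interval_measure T) (\<lambda>t. \<phi> t * (a' t * x t))"
    by (intro integrable_continuous_mult p a x)
  have i3: "integrable (interval_measure T) (\<lambda>t. \<phi> t * (a t * v t))"
    by (intro integrable_continuous_mult p ca v)
  have "(\<integral>t. deriv \<phi> t * (a t * x t) + \<phi> t * (a' t * x t) \<partial>interval_measure T) = - (\<integral>t. \<phi> t * (a t * v t) \<partial>interval_measure T)"
    using xv t unfolding weak_deriv_def by (force simp: algebra_simps)
  then show "(\<integral>t. deriv \<phi> t * (a t * x t) \<partial>interval_measure T) = - (\<integral>t. \<phi> t * (a' t * x t + a t * v t) \<partial>interval_measure T)"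
    using i1 i2 i3 by (simp add: distrib_left)
qed

section \<open>Primitives and their weak derivatives\<close>

lemma integral_interval_FTC:
  assumes d: "\<And>t. (F has_real_derivative d t) (at t)" "continuous_on UNIV d" and a: "0 \<le> a" "a \<le> T"
  shows "(\<integral>t. (if a \<le> t then d t else 0) \<partial>interval_measure T) = F T - F a"
proof -
  have [measurable]: "d \<in> borel_measurable borel" using d(2) by (rule borel_measurable_continuous_onI)
  have "(\<integral>t. (if a \<le> t then d t else 0) \<partial>interval_measure T)
      = (\<integral>t. indicator {0<..<T} t *\<^sub>R (if a \<le> t then d t else 0) \<partial>lebesgue)"
    by (rule integral_restrict_space) simp
  also have "\<dots> = (\<integral>t. indicator {0<..<T} t *\<^sub>R (if a \<le> t then d t else 0) \<partial>lborel)"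
    by (rule integral_completion) measurable
  also have "\<dots> = (\<integral>t. d t * indicator {a..T} t \<partial>lborel)"
  proof (rule integral_cong_AE)
    show "AE t in lborel. indicator {0<..<T} t *\<^sub>R (if a \<le> t then d t else 0) = d t * indicator {a..T} t"
      using AE_lborel_singleton[of 0] AE_lborel_singleton[of T]
      by eventually_elim (use a in \<open>auto simp: indicator_def\<close>)
  qed measurable
  also have "\<dots> = F T - F a"
    using d by (intro integral_FTC_Icc_real a) (auto simp: continuous_on_eq_continuous_at)
  finally show ?thesis .
qed

text \<open>Cutting off the integrand instead of the domain keeps one measure for all
  \<open>t\<close>, so that dominated convergence and Fubini's theorem apply directly.\<close>

definition primitive :: "real \<Rightarrow> (real \<Rightarrow> 'a::{banach,second_countable_topology}) \<Rightarrow> real \<Rightarrow> 'a" where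
  "primitive T v t = (\<integral>s. (if s \<le> t then v s else 0) \<partial>interval_measure T)"

lemma integrable_cut:
  fixes v :: "real \<Rightarrow> 'a::{banach,second_countable_topology}"
  assumes v: "integrable (interval_measure T) v"
  shows "integrable (interval_measure T) (\<lambda>s. if s \<le> t then v s else 0)"
proof (rule Bochner_Integration.integrable_bound[OF v])
  have "{s \<in> space (interval_measure T). s \<le> t} \<in> sets (interval_measure T)"
    using borel_measurable_interval[of "\<lambda>s. s" T] by (rule borel_measurable_le) auto
  then show "(\<lambda>s. if s \<le> t then v s else 0) \<in> borel_measurable (interval_measure T)"
    using v by (intro measurable_If) auto
qed auto

lemma primitive_0 [simp]: "primitive T v 0 = 0"
  unfolding primitive_def by (rule integral_eq_zero_AE) (auto intro!: AE_I2)

lemma primitive_T [simp]: "primitive T v T = (\<integral>s. v s \<partial>interval_measure T)"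
  unfolding primitive_def by (rule Bochner_Integration.integral_cong) auto

text \<open>If the upper limits converge to \<open>t\<close>, the cut-off integrands converge at
  every point except \<open>s = t\<close>, a null set.\<close>

lemma continuous_on_primitive:
  fixes v :: "real \<Rightarrow> 'a::{banach,second_countable_topology}"
  assumes v: "integrable (interval_measure T) v"
  shows "continuous_on UNIV (primitive T v)"
  unfolding continuous_on_eq_continuous_at[OF open_UNIV] continuous_at_sequentially
proof (intro ballI allI impI)
  fix t :: real and r assume r: "r \<longlonglongrightarrow> t"
  have "(\<lambda>n. \<integral>s. (if s \<le> r n then v s else 0) \<partial>interval_measure T) \<longlonglongrightarrow> (\<integral>s. (if s \<le> t then v s else 0) \<partial>interval_measure T)"
  proof (rule integral_dominated_convergence[where w="\<lambda>s. norm (v s)"])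
    have "AE s in lebesgue. s \<noteq> t" by (rule AE_completion) (rule AE_lborel_singleton)
    then have "AE s in interval_measure T. s \<noteq> t" by (subst AE_restrict_space_iff) auto
    then show "AE s in interval_measure T. (\<lambda>n. if s \<le> r n then v s else 0) \<longlonglongrightarrow> (if s \<le> t then v s else 0)"
    proof eventually_elim
      case (elim s)
      show ?case
      proof (cases "s < t")
        case True
        from order_tendstoD(1)[OF r this]
        have "\<forall>\<^sub>F n in sequentially. (if s \<le> r n then v s else 0) = (if s \<le> t then v s else 0)"
          by eventually_elim (use True in auto)
        then show ?thesis by (rule tendsto_eventually)
      next
        case False
        then have "t < s" using elim by simp
        from order_tendstoD(2)[OF r this]
        have "\<forall>\<^sub>F n in sequentially. (if s \<le> r n then v s else 0) = (if s \<le> t then v s else 0)"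
          by eventually_elim (use \<open>t < s\<close> in auto)
        then show ?thesis by (rule tendsto_eventually)
      qed
    qed
    show "AE s in interval_measure T. norm (if s \<le> r n then v s else 0) \<le> norm (v s)" for n
      by (rule AE_I2) simp
  qed (use v integrable_cut[OF v] in \<open>auto intro: borel_measurable_integrable\<close>)
  then show "(primitive T v \<circ> r) \<longlonglongrightarrow> primitive T v t" by (simp add: primitive_def comp_def)
qed

lemma integrable_bounded_continuous:
  fixes h :: "real \<Rightarrow> real"
  assumes h: "continuous_on UNIV h"
  shows "integrable (interval_measure T) h"
  using integrable_continuous_mult[OF h, of T "\<lambda>_. 1"] finite_measure.integrable_const[OF finite_measure_interval, of T 1]
  by simp

text \<open>Fubini's theorem on the triangle \<open>s \<le> t\<close>: the inner integral of
  \<open>deriv \<phi>\<close> from \<open>s\<close> to \<open>T\<close> is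
  \<open>- \<phi> s\<close>. The constant \<open>c\<close> is multiplied by the integral of
  \<open>deriv \<phi>\<close>, which is 0.\<close>

lemma weak_deriv_primitive:
  assumes v: "integrable (interval_measure T) v" and T: "0 < T"
  shows "weak_deriv T (\<lambda>t. c + primitive T v t) v"
  unfolding weak_deriv_def
proof (intro conjI ballI v)
  show "integrable (interval_measure T) (\<lambda>t. c + primitive T v t)"
    by (intro integrable_bounded_continuous continuous_intros continuous_on_primitive v)
  fix \<phi> assume \<phi>: "\<phi> \<in> test_functions T"
  note p = test_functionsD[OF \<phi>]
  let ?L = "interval_measure T"
  interpret L: finite_measure ?L by (rule finite_measure_interval)
  interpret LL: pair_sigma_finite ?L ?L ..
  have "(\<integral>t. deriv \<phi> t \<partial>?L) = (\<integral>t. (if 0 \<le> t then deriv \<phi> t else 0) \<partial>?L)"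
    by (rule Bochner_Integration.integral_cong) auto
  also have "\<dots> = 0"
    using integral_interval_FTC[OF p(1,2), of 0 T] T p(4)[of 0] p(4)[of T] by simp
  finally have z: "(\<integral>t. deriv \<phi> t \<partial>?L) = 0" .
  have id[measurable]: "(\<lambda>s. s) \<in> borel_measurable ?L" by (rule borel_measurable_interval) simp
  have m[measurable]: "deriv \<phi> \<in> borel_measurable ?L" "v \<in> borel_measurable ?L"
    using continuous_borel_measurable_interval[OF p(2)] v by auto
  let ?f = "\<lambda>t s. deriv \<phi> t * (if s \<le> t then v s else 0)"
  have meas: "(\<lambda>(t, s). ?f t s) \<in> borel_measurable (?L \<Otimes>\<^sub>M ?L)"
    by measurable
  have int: "integrable (?L \<Otimes>\<^sub>M ?L) (\<lambda>(t, s). ?f t s)"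
  proof (rule Bochner_Integration.integrable_bound[OF _ meas])
    show "integrable (?L \<Otimes>\<^sub>M ?L) (\<lambda>(t, s). deriv \<phi> t * v s)"
    proof (rule LL.Fubini_integrable)
      show "integrable ?L (\<lambda>t. \<integral>s. norm (case (t, s) of (t, s) \<Rightarrow> deriv \<phi> t * v s) \<partial>?L)"
        using integrable_bounded_continuous[OF p(2)] by (simp add: abs_mult)
    qed (use v in \<open>auto intro!: AE_I2\<close>)
  qed (auto intro!: AE_I2 simp: abs_mult)
  have "(\<integral>t. deriv \<phi> t * primitive T v t \<partial>?L) = (\<integral>t. (\<integral>s. ?f t s \<partial>?L) \<partial>?L)"
    by (simp add: primitive_def)
  also have "\<dots> = (\<integral>s. (\<integral>t. ?f t s \<partial>?L) \<partial>?L)"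
    by (rule LL.Fubini_integral[OF int, symmetric])
  also have "\<dots> = (\<integral>s. - (\<phi> s * v s) \<partial>?L)"
  proof (rule Bochner_Integration.integral_cong)
    fix s assume "s \<in> space ?L"
    then have s: "0 \<le> s" "s \<le> T" by auto
    have "(\<integral>t. ?f t s \<partial>?L) = (\<integral>t. (if s \<le> t then deriv \<phi> t else 0) * v s \<partial>?L)"
      by (rule Bochner_Integration.integral_cong) auto
    also have "\<dots> = (\<phi> T - \<phi> s) * v s" using integral_interval_FTC[OF p(1,2) s] by simp
    finally show "(\<integral>t. ?f t s \<partial>?L) = - (\<phi> s * v s)" using p(4)[of T] by simp
  qed simp
  finally have "(\<integral>t. deriv \<phi> t * primitive T v t \<partial>?L) = - (\<integral>s. \<phi> s * v s \<partial>?L)" by simp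
  moreover have "(\<integral>t. deriv \<phi> t * (c + primitive T v t) \<partial>?L) = (\<integral>t. deriv \<phi> t * c \<partial>?L) + (\<integral>t. deriv \<phi> t * primitive T v t \<partial>?L)"
    unfolding distrib_left
    by (intro Bochner_Integration.integral_add integrable_continuous_mult integrable_bounded_continuous continuous_on_primitive continuous_intros p v)
  ultimately show "(\<integral>t. deriv \<phi> t * (c + primitive T v t) \<partial>?L) = - (\<integral>t. \<phi> t * v t \<partial>?L)"
    using z by simp
qed

lemma weak_deriv_diff:
  assumes "weak_deriv T x v" "weak_deriv T y w"
  shows "weak_deriv T (\<lambda>t. x t - y t) (\<lambda>t. v t - w t)"
  unfolding weak_deriv_def
proof (intro conjI ballI)
  have i: "integrable (interval_measure T) x" "integrable (interval_measure T) v"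
     "integrable (interval_measure T) y" "integrable (interval_measure T) w"
    using assms by (auto simp: weak_deriv_def)
  then show "integrable (interval_measure T) (\<lambda>t. x t - y t)" "integrable (interval_measure T) (\<lambda>t. v t - w t)"
    by auto
  fix \<phi> assume \<phi>: "\<phi> \<in> test_functions T"
  note p = test_functionsD[OF \<phi>]
  have "integrable (interval_measure T) (\<lambda>t. deriv \<phi> t * x t)" "integrable (interval_measure T) (\<lambda>t. deriv \<phi> t * y t)"
    "integrable (interval_measure T) (\<lambda>t. \<phi> t * v t)" "integrable (interval_measure T) (\<lambda>t. \<phi> t * w t)"
    by (intro integrable_continuous_mult p i)+
  then show "(\<integral>t. deriv \<phi> t * (x t - y t) \<partial>interval_measure T) = - (\<integral>t. \<phi> t * (v t - w t) \<partial>interval_measure T)"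
    using assms \<phi> by (simp add: right_diff_distrib weak_deriv_def)
qed

section \<open>Functions with vanishing weak derivative are constant\<close>

lemma continuous_nonneg_integral_0:
  fixes h :: "real \<Rightarrow> real"
  assumes h: "continuous_on UNIV h" "\<And>t. 0 \<le> h t" and z: "(\<integral>t. h t \<partial>interval_measure T) = 0" and t: "t \<in> {0<..<T}"
  shows "h t = 0"
proof (rule ccontr)
  assume nz: "h t \<noteq> 0"
  let ?U = "{0<..<T} \<inter> {t. h t \<noteq> 0}"
  have "open {t. h t \<noteq> 0}" using h(1) by (intro open_Collect_neq continuous_intros) auto
  then have U: "open ?U" by auto
  have "AE t in interval_measure T. h t = 0"
    using integral_nonneg_eq_0_iff_AE[OF integrable_bounded_continuous[OF h(1)], of T] h(2) z by simp
  then have "AE t in lebesgue. t \<in> {0<..<T} \<longrightarrow> h t = 0" by (subst (asm) AE_restrict_space_iff) auto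
  then have "AE t in lebesgue. t \<notin> ?U" by eventually_elim auto
  then have "?U \<in> null_sets lebesgue"
    using U by (subst (asm) AE_iff_null_sets[symmetric]) auto
  then have "negligible ?U" by (simp add: negligible_iff_null_sets)
  then show False using open_not_negligible[OF U] t nz by blast
qed

text \<open>The test function with derivative \<open>\<rho> (y - c)\<close>, where \<open>c\<close> is the \<open>\<rho>\<close>-weighted mean of \<open>y\<close>,
  yields \<open>\<integral> \<rho> (y - c)\<^sup>2 = 0\<close>.\<close>

lemma weak_deriv_0_const_on:
  assumes y: "continuous_on UNIV y" and w: "weak_deriv T y (\<lambda>_. 0)"
    and ab: "0 < \<alpha>" "\<alpha> < \<beta>" "\<beta> < T"
  shows "\<exists>c. \<forall>t\<in>{\<alpha><..<\<beta>}. y t = c"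
proof -
  let ?L = "interval_measure T"
  \<comment> \<open>A continuous weight that is positive exactly between \<alpha> and \<beta>; it
    keeps the support of the test function away from 0 and \<open>T\<close>.\<close>
  define \<rho> where "\<rho> = (\<lambda>t. max 0 ((t - \<alpha>) * (\<beta> - t)))"
  have \<rho>: "continuous_on UNIV \<rho>" "\<And>t. 0 \<le> \<rho> t" unfolding \<rho>_def by (auto intro!: continuous_intros)
  have \<rho>pos: "0 < \<rho> t" if "t \<in> {\<alpha><..<\<beta>}" for t using that by (simp add: \<rho>_def)
  have \<rho>0: "\<rho> t = 0" if "t \<notin> {\<alpha><..<\<beta>}" for t
  proof -
    have "(t - \<alpha>) * (\<beta> - t) \<le> 0" using that ab by (cases "t \<le> \<alpha>") (auto simp: mult_le_0_iff)
    then show ?thesis by (simp add: \<rho>_def)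
  qed
  have I\<rho>: "(\<integral>t. \<rho> t \<partial>?L) \<noteq> 0"
    using continuous_nonneg_integral_0[OF \<rho>, of T "(\<alpha> + \<beta>) / 2"] \<rho>pos[of "(\<alpha> + \<beta>) / 2"] ab by auto
  define c where "c = (\<integral>t. \<rho> t * y t \<partial>?L) / (\<integral>t. \<rho> t \<partial>?L)"
  define \<psi> where "\<psi> = (\<lambda>t. \<rho> t * (y t - c))"
  have \<psi>: "continuous_on UNIV \<psi>" unfolding \<psi>_def by (intro continuous_intros \<rho> y)
  have int: "integrable ?L \<rho>" "integrable ?L (\<lambda>t. \<rho> t * y t)" "integrable ?L \<psi>" "integrable ?L (\<lambda>t. \<psi> t * y t)"
    by (intro integrable_bounded_continuous continuous_intros \<rho> y \<psi>)+
  have I\<psi>: "(\<integral>t. \<psi> t \<partial>?L) = 0"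
    using int I\<rho> by (simp add: \<psi>_def right_diff_distrib c_def)
  \<comment> \<open>\<phi> is constant on either side of the interval: it is 0 at 0, and at
    \<open>T\<close> it equals the integral of \<psi>, which is 0 by the choice of
    \<open>c\<close>.\<close>
  define \<phi> where "\<phi> = (\<lambda>t. LBINT s=0..ereal t. \<psi> s)"
  have d: "(\<phi> has_real_derivative \<psi> t) (at t)" for t
  proof -
    \<comment> \<open>Widening the interval by 1 makes \<open>t\<close> an interior point, so that
      the derivative within the interval becomes one at \<open>t\<close>.\<close>
    have "(\<phi> has_vector_derivative \<psi> t) (at t within {min 0 t - 1..max 0 t + 1})"
      unfolding \<phi>_def zero_ereal_def
      by (rule interval_integral_FTC2) (auto intro: continuous_on_subset[OF \<psi>])
    then have "(\<phi> has_vector_derivative \<psi> t) (at t within {min 0 t - 1<..<max 0 t + 1})"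
      by (rule has_vector_derivative_within_subset) auto
    then have "(\<phi> has_vector_derivative \<psi> t) (at t)"
      by (subst (asm) has_vector_derivative_within_open) auto
    then show ?thesis by (simp add: has_real_derivative_iff_has_vector_derivative)
  qed
  have \<phi>00: "\<phi> 0 = 0" by (simp add: \<phi>_def zero_ereal_def)
  have "\<exists>k. \<forall>t\<in>{..\<alpha>}. \<phi> t = k"
    by (rule has_field_derivative_zero_constant) (auto intro!: has_field_derivative_at_within[OF d, THEN DERIV_cong] simp: \<psi>_def \<rho>0)
  then have left: "\<phi> t = 0" if "t \<le> \<alpha>" for t
  proof -
    from \<open>\<exists>k. \<forall>t\<in>{..\<alpha>}. \<phi> t = k\<close> obtain k where "\<forall>t\<in>{..\<alpha>}. \<phi> t = k" ..
    then have "\<phi> t = k" "\<phi> 0 = k" using that ab by simp_all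
    then show ?thesis using \<phi>00 by simp
  qed
  have "(\<integral>t. \<psi> t \<partial>?L) = (\<integral>t. (if 0 \<le> t then \<psi> t else 0) \<partial>?L)"
    by (rule Bochner_Integration.integral_cong) auto
  also have "\<dots> = \<phi> T - \<phi> 0" using ab by (intro integral_interval_FTC d \<psi>) auto
  finally have \<phi>T: "\<phi> T = 0" using I\<psi> \<phi>00 by simp
  have "\<exists>k. \<forall>t\<in>{\<beta>..}. \<phi> t = k"
    by (rule has_field_derivative_zero_constant) (auto intro!: has_field_derivative_at_within[OF d, THEN DERIV_cong] simp: \<psi>_def \<rho>0)
  then have right: "\<phi> t = 0" if "\<beta> \<le> t" for t
  proof -
    from \<open>\<exists>k. \<forall>t\<in>{\<beta>..}. \<phi> t = k\<close> obtain k where "\<forall>t\<in>{\<beta>..}. \<phi> t = k" ..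
    then have "\<phi> t = k" "\<phi> T = k" using that ab by simp_all
    then show ?thesis using \<phi>T by simp
  qed
  have "\<phi> t = 0" if "t \<notin> {\<alpha>..\<beta>}" for t
    using that left[of t] right[of t] by (cases "t \<le> \<alpha>") auto
  then have \<phi>: "\<phi> \<in> test_functions T" "deriv \<phi> = \<psi>"
    using ab by (auto intro!: test_functionsI[OF d \<psi>, of "{\<alpha>..\<beta>}" T])
  then have "(\<integral>t. \<psi> t * y t \<partial>?L) = 0" using w by (auto simp: weak_deriv_def)
  \<comment> \<open>Subtracting \<open>c\<close> times the vanishing integral of \<psi> completes
    the square.\<close>
  then have "(\<integral>t. \<psi> t * y t - c * \<psi> t \<partial>?L) = 0" using int I\<psi> by simp
  then have z: "(\<integral>t. \<rho> t * (y t - c)\<^sup>2 \<partial>?L) = 0" by (simp add: \<psi>_def algebra_simps power2_eq_square)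
  have "y t = c" if t: "t \<in> {\<alpha><..<\<beta>}" for t
  proof -
    have "\<rho> t * (y t - c)\<^sup>2 = 0"
    proof (rule continuous_nonneg_integral_0[OF _ _ z])
      show "continuous_on UNIV (\<lambda>t. \<rho> t * (y t - c)\<^sup>2)" by (intro continuous_intros \<rho> y)
    qed (use \<rho>(2) t ab in auto)
    then show ?thesis using \<rho>pos[OF t] by simp
  qed
  then show ?thesis by blast
qed

lemma weak_deriv_0_const:
  assumes y: "continuous_on {0..T} y" and w: "weak_deriv T y (\<lambda>_. 0)" and t: "t \<in> {0..T}" and T: "0 < T"
  shows "y t = y 0"
proof -
  \<comment> \<open>The constant extension beyond both endpoints is continuous on the whole
    line.\<close>
  define Y where "Y = (\<lambda>t. y (max 0 (min T t)))"
  have Y: "continuous_on UNIV Y"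
    unfolding Y_def by (rule continuous_on_compose2[OF y]) (use T in \<open>auto intro!: continuous_intros\<close>)
  have eq: "Y t = y t" if "t \<in> {0..T}" for t using that by (simp add: Y_def)
  have "weak_deriv T Y (\<lambda>_. 0)"
  proof -
    have "integrable (interval_measure T) Y" by (rule integrable_bounded_continuous[OF Y])
    moreover have "(\<integral>t. deriv \<phi> t * Y t \<partial>interval_measure T) = (\<integral>t. deriv \<phi> t * y t \<partial>interval_measure T)" for \<phi>
      by (rule Bochner_Integration.integral_cong) (auto simp: eq)
    ultimately show ?thesis using w by (simp add: weak_deriv_def)
  qed
  note const = weak_deriv_0_const_on[OF Y this]
  have c: "y s = y (T / 2)" if "s \<in> {0<..<T}" for s
  proof -
    \<comment> \<open>An interval whose closure lies inside (0,T) and which contains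
      \<open>s\<close> and the midpoint; constancy is so far known only on such intervals.\<close>
    define \<alpha> where "\<alpha> = min s (T / 2) / 2"
    define \<beta> where "\<beta> = (max s (T / 2) + T) / 2"
    have "0 < \<alpha>" "\<alpha> < \<beta>" "\<beta> < T" "s \<in> {\<alpha><..<\<beta>}" "T / 2 \<in> {\<alpha><..<\<beta>}"
      using that T by (auto simp: \<alpha>_def \<beta>_def min_def max_def)
    then have "Y s = Y (T / 2)" using const[of \<alpha> \<beta>] by force
    then show ?thesis using eq[of s] eq[of "T / 2"] that T by simp
  qed
  have "y s = y (T / 2)" if "s \<in> {0..T}" for s
  proof (rule continuous_constant_on_closure[of "{0<..<T}" y])
    show "continuous_on (closure {0<..<T}) y" using y T by (simp add: closure_greaterThanLessThan)
    show "s \<in> closure {0<..<T}" using that T by (simp add: closure_greaterThanLessThan)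
  qed (rule c)
  from this[of t] this[of 0] t T show ?thesis by simp
qed

lemma weak_deriv_eq_primitive:
  assumes z: "continuous_on {0..T} z" and w: "weak_deriv T z v" and t: "t \<in> {0..T}" and T: "0 < T"
  shows "z t = z 0 + primitive T v t"
proof -
  have v: "integrable (interval_measure T) v" using w by (simp add: weak_deriv_def)
  have "weak_deriv T (\<lambda>t. z t - (0 + primitive T v t)) (\<lambda>t. v t - v t)"
    by (intro weak_deriv_diff w weak_deriv_primitive v T)
  then have "weak_deriv T (\<lambda>t. z t - primitive T v t) (\<lambda>_. 0)" by simp
  moreover have "continuous_on {0..T} (\<lambda>t. z t - primitive T v t)"
    by (intro continuous_intros z continuous_on_subset[OF continuous_on_primitive[OF v]]) auto
  ultimately show ?thesis using weak_deriv_0_const[of T "\<lambda>t. z t - primitive T v t" t] t T by simp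
qed

lemma weak_deriv_cong:
  assumes w: "weak_deriv T x v" and eq: "AE t in interval_measure T. v t = w t" and m: "w \<in> borel_measurable (interval_measure T)"
  shows "weak_deriv T x w"
proof -
  have v: "integrable (interval_measure T) v" using w by (simp add: weak_deriv_def)
  have i: "integrable (interval_measure T) w"
    by (rule integrable_cong_AE_imp[OF v m]) (use eq in \<open>eventually_elim, simp\<close>)
  have "(\<integral>t. \<phi> t * v t \<partial>interval_measure T) = (\<integral>t. \<phi> t * w t \<partial>interval_measure T)" if \<phi>: "\<phi> \<in> test_functions T" for \<phi>
  proof (rule integral_cong_AE)
    show "(\<lambda>t. \<phi> t * v t) \<in> borel_measurable (interval_measure T)" "(\<lambda>t. \<phi> t * w t) \<in> borel_measurable (interval_measure T)"
      by (rule borel_measurable_integrable, rule integrable_continuous_mult[OF test_functionsD(3)[OF \<phi>]], rule v i)+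
    show "AE t in interval_measure T. \<phi> t * v t = \<phi> t * w t" using eq by eventually_elim simp
  qed
  then show ?thesis using w i by (simp add: weak_deriv_def)
qed

section \<open>Square-integrable functions\<close>

definition square_integrable :: "real \<Rightarrow> (real \<Rightarrow> real) \<Rightarrow> bool" where
  "square_integrable T h \<longleftrightarrow> h \<in> borel_measurable (interval_measure T) \<and> integrable (interval_measure T) (\<lambda>t. (h t)\<^sup>2)"

lemma square_integrable_imp_integrable:
  assumes "square_integrable T h" shows "integrable (interval_measure T) h"
proof (rule Bochner_Integration.integrable_bound[of _ "\<lambda>t. 1 + (h t)\<^sup>2"])
  show "integrable (interval_measure T) (\<lambda>t. 1 + (h t)\<^sup>2)"
    using assms finite_measure.integrable_const[OF finite_measure_interval, of T 1]
    by (auto simp: square_integrable_def)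
  have "\<bar>y\<bar> \<le> \<bar>1 + y\<^sup>2\<bar>" for y :: real
  proof -
    have "0 \<le> (\<bar>y\<bar> - 1)\<^sup>2" by simp
    then have "2 * \<bar>y\<bar> \<le> 1 + y\<^sup>2" by (simp add: power2_diff)
    then show ?thesis by simp
  qed
  then show "AE t in interval_measure T. norm (h t) \<le> norm (1 + (h t)\<^sup>2)" by simp
qed (use assms in \<open>simp add: square_integrable_def\<close>)

lemma square_integrable_add:
  assumes "square_integrable T f" "square_integrable T h"
  shows "square_integrable T (\<lambda>t. f t + h t)"
  unfolding square_integrable_def
proof
  have m: "f \<in> borel_measurable (interval_measure T)" "h \<in> borel_measurable (interval_measure T)"
    using assms by (auto simp: square_integrable_def)
  then show "(\<lambda>t. f t + h t) \<in> borel_measurable (interval_measure T)" by (rule borel_measurable_add)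
  show "integrable (interval_measure T) (\<lambda>t. (f t + h t)\<^sup>2)"
  proof (rule Bochner_Integration.integrable_bound[of _ "\<lambda>t. 2 * (f t)\<^sup>2 + 2 * (h t)\<^sup>2"])
    show "integrable (interval_measure T) (\<lambda>t. 2 * (f t)\<^sup>2 + 2 * (h t)\<^sup>2)"
      using assms by (auto simp: square_integrable_def)
    show "(\<lambda>t. (f t + h t)\<^sup>2) \<in> borel_measurable (interval_measure T)"
      using m by (intro borel_measurable_power borel_measurable_add)
    have "(a + b)\<^sup>2 \<le> 2 * a\<^sup>2 + 2 * b\<^sup>2" for a b :: real
      using sum_squares_ge_zero[of "a - b" 0] by (simp add: power2_eq_square algebra_simps)
    then show "AE t in interval_measure T. norm ((f t + h t)\<^sup>2) \<le> norm (2 * (f t)\<^sup>2 + 2 * (h t)\<^sup>2)"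
      by (intro AE_I2) (simp add: order_trans[OF _ abs_ge_self])
  qed
qed

lemma square_integrable_mult:
  assumes a: "continuous_on UNIV a" and h: "square_integrable T h"
  shows "square_integrable T (\<lambda>t. a t * h t)"
  using integrable_continuous_mult[of "\<lambda>t. (a t)\<^sup>2" T "\<lambda>t. (h t)\<^sup>2"] a h continuous_borel_measurable_interval[OF a, of T]
  by (auto simp: square_integrable_def power_mult_distrib intro!: continuous_intros)

lemma square_integrable_sum:
  assumes "finite I" "\<And>i. i \<in> I \<Longrightarrow> square_integrable T (f i)"
  shows "square_integrable T (\<lambda>t. \<Sum>i\<in>I. f i t)"
  using assms
  by (induction rule: finite_induct) (auto simp: square_integrable_def[of _ "\<lambda>_. 0"] intro: square_integrable_add)

lemma square_integrable_continuous:
  assumes h: "continuous_on {0..T} h" shows "square_integrable T h"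
  unfolding square_integrable_def
proof
  show m: "h \<in> borel_measurable (interval_measure T)"
    by (rule continuous_imp_measurable_on_sets_lebesgue) (auto intro: continuous_on_subset[OF h])
  obtain b where b: "0 \<le> b" "\<forall>t\<in>{0..T}. \<bar>h t\<bar> \<le> b" using continuous_bounded_interval[OF h] by blast
  show "integrable (interval_measure T) (\<lambda>t. (h t)\<^sup>2)"
  proof (rule finite_measure.integrable_const_bound[OF finite_measure_interval])
    show "AE t in interval_measure T. norm ((h t)\<^sup>2) \<le> b\<^sup>2"
    proof (rule AE_I2)
      fix t assume "t \<in> space (interval_measure T)"
      then have "\<bar>h t\<bar> \<le> b" using b(2) by simp
      then show "norm ((h t)\<^sup>2) \<le> b\<^sup>2" using power_mono[of "\<bar>h t\<bar>" b 2] by simp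
    qed
    show "(\<lambda>t. (h t)\<^sup>2) \<in> borel_measurable (interval_measure T)" using m by (rule borel_measurable_power)
  qed
qed

lemma borel_measurable_vec_iff:
  fixes x :: "'a \<Rightarrow> real^'n"
  shows "x \<in> borel_measurable M \<longleftrightarrow> (\<forall>i. (\<lambda>t. x t $ i) \<in> borel_measurable M)"
proof -
  have "x \<in> borel_measurable M \<longleftrightarrow> (\<forall>b\<in>Basis. (\<lambda>t. x t \<bullet> b) \<in> borel_measurable M)"
    by (rule borel_measurable_euclidean_space)
  also have "\<dots> \<longleftrightarrow> (\<forall>i. (\<lambda>t. x t $ i) \<in> borel_measurable M)"
    by (auto simp: Basis_vec_def inner_axis)
  finally show ?thesis .
qed

lemma norm_power2_vec: "(norm (x::real^'n))\<^sup>2 = (\<Sum>i\<in>UNIV. (x $ i)\<^sup>2)"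
  unfolding power2_norm_eq_inner inner_vec_def by (simp add: power2_eq_square)

lemma L2_iff: "x \<in> L2 T \<longleftrightarrow> (\<forall>i. square_integrable T (\<lambda>t. x t $ i))"
proof
  assume x: "x \<in> L2 T"
  then have m: "(\<lambda>t. x t $ i) \<in> borel_measurable (interval_measure T)" for i
    by (simp add: L2_def borel_measurable_vec_iff)
  have "integrable (interval_measure T) (\<lambda>t. (x t $ i)\<^sup>2)" for i
  proof (rule Bochner_Integration.integrable_bound)
    show "integrable (interval_measure T) (\<lambda>t. (norm (x t))\<^sup>2)" using x by (simp add: L2_def)
    have "norm ((x t $ i)\<^sup>2) \<le> norm ((norm (x t))\<^sup>2)" for t
      using power_mono[OF component_le_norm_cart[of "x t" i], of 2] by simp
    then show "AE t in interval_measure T. norm ((x t $ i)\<^sup>2) \<le> norm ((norm (x t))\<^sup>2)" by simp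
    show "(\<lambda>t. (x t $ i)\<^sup>2) \<in> borel_measurable (interval_measure T)" using m by (rule borel_measurable_power)
  qed
  then show "\<forall>i. square_integrable T (\<lambda>t. x t $ i)" using m by (simp add: square_integrable_def)
next
  assume "\<forall>i. square_integrable T (\<lambda>t. x t $ i)"
  then show "x \<in> L2 T"
    by (auto simp: L2_def borel_measurable_vec_iff square_integrable_def norm_power2_vec)
qed

lemma L2_add: "x \<in> L2 T \<Longrightarrow> y \<in> L2 T \<Longrightarrow> (\<lambda>t. x t + y t) \<in> L2 T"
  by (auto simp: L2_iff intro: square_integrable_add)

lemma L2_matrix_mult:
  fixes e :: "real \<Rightarrow> real^'n^'m"
  assumes "continuous_on UNIV e" and x: "x \<in> L2 T"
  shows "(\<lambda>t. e t *v x t) \<in> L2 T"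
  unfolding L2_iff matrix_vector_mult_def
  using assms(1) x by (auto intro!: square_integrable_sum square_integrable_mult continuous_intros simp: L2_iff)

lemma L2_scaleR: "x \<in> L2 T \<Longrightarrow> (\<lambda>t. c *\<^sub>R x t) \<in> L2 T"
  by (auto simp: L2_iff intro!: square_integrable_mult)

lemma L2_diff: "x \<in> L2 T \<Longrightarrow> y \<in> L2 T \<Longrightarrow> (\<lambda>t. x t - y t) \<in> L2 T"
  using L2_add[of x T "\<lambda>t. - 1 *\<^sub>R y t"] L2_scaleR[of y T "- 1"] by simp

lemma L2_continuous: "continuous_on {0..T} x \<Longrightarrow> x \<in> L2 T"
  unfolding L2_iff by (intro allI square_integrable_continuous continuous_intros)

lemma integrable_vec_nth: "integrable M x \<Longrightarrow> integrable M (\<lambda>t. x t $ i)" for x :: "'a \<Rightarrow> real^'n"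
  by (rule integrable_bounded_linear[OF bounded_linear_vec_nth])

lemma integral_vec_nth: "integrable M x \<Longrightarrow> (\<integral>t. x t \<partial>M) $ i = (\<integral>t. x t $ i \<partial>M)" for x :: "'a \<Rightarrow> real^'n"
  by (rule integral_bounded_linear[OF bounded_linear_vec_nth, symmetric])

lemma L2_integrable:
  fixes x :: "real \<Rightarrow> real^'n"
  assumes x: "x \<in> L2 T" shows "integrable (interval_measure T) x"
proof -
  have "integrable (interval_measure T) (\<lambda>t. \<Sum>i\<in>UNIV. \<bar>x t $ i\<bar>)"
    by (intro Bochner_Integration.integrable_sum integrable_abs square_integrable_imp_integrable)
      (use x in \<open>simp add: L2_iff\<close>)
  then show ?thesis
  proof (rule Bochner_Integration.integrable_bound)
    show "x \<in> borel_measurable (interval_measure T)" using x by (simp add: L2_def)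
    show "AE t in interval_measure T. norm (x t) \<le> norm (\<Sum>i\<in>UNIV. \<bar>x t $ i\<bar>)"
      by (intro AE_I2) (simp add: norm_le_l1_cart order_trans[OF _ abs_ge_self])
  qed
qed

lemma has_weak_derivative_iff:
  fixes x :: "real \<Rightarrow> real^'n"
  assumes x: "x \<in> L2 T"
  shows "has_weak_derivative T x v \<longleftrightarrow> v \<in> L2 T \<and> (\<forall>i. weak_deriv T (\<lambda>t. x t $ i) (\<lambda>t. v t $ i))"
proof (cases "v \<in> L2 T")
  case True
  have ix: "integrable (interval_measure T) x" and iv: "integrable (interval_measure T) v"
    using x True by (auto intro: L2_integrable)
  have "(\<integral>t. deriv \<phi> t *\<^sub>R x t \<partial>interval_measure T) = - (\<integral>t. \<phi> t *\<^sub>R v t \<partial>interval_measure T) \<longleftrightarrow>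
      (\<forall>i. (\<integral>t. deriv \<phi> t * x t $ i \<partial>interval_measure T) = - (\<integral>t. \<phi> t * v t $ i \<partial>interval_measure T))"
    if \<phi>: "\<phi> \<in> test_functions T" for \<phi>
    using integral_vec_nth[OF integrable_continuous_scaleR[OF test_functionsD(2)[OF \<phi>] ix]]
      integral_vec_nth[OF integrable_continuous_scaleR[OF test_functionsD(3)[OF \<phi>] iv]]
    by (simp add: vec_eq_iff)
  then show ?thesis
    using True integrable_vec_nth[OF ix] integrable_vec_nth[OF iv]
    unfolding has_weak_derivative_def weak_deriv_def by blast
qed (simp add: has_weak_derivative_def)

section \<open>The matrix exponential\<close>

lemma matrix_power_0 [simp]: "matrix_power X 0 = mat 1"
  by (simp add: matrix_power_def)

lemma matrix_power_Suc: "matrix_power X (Suc k) = X ** matrix_power X k"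
  by (simp add: matrix_power_def)

lemma matrix_power_Suc2: "matrix_power X (Suc k) = matrix_power X k ** X"
proof (induction k)
  case (Suc k)
  then show ?case by (metis matrix_mul_assoc matrix_power_Suc)
qed (simp add: matrix_power_Suc)

lemma matrix_mult_nth: "(A ** B) $ i $ j = (\<Sum>l\<in>UNIV. A $ i $ l * B $ l $ j)"
  by (simp add: matrix_matrix_mult_def)

text \<open>The sum of all absolute entries dominates every row sum, so each factor \<open>X\<close>
  costs at most this constant; a scalar exponential series then majorizes
  \<open>mexp\<close>.\<close>

lemma matrix_power_bound:
  fixes X :: "real^'n^'n"
  shows "\<bar>matrix_power X k $ i $ j\<bar> \<le> (\<Sum>a\<in>UNIV. \<Sum>b\<in>UNIV. \<bar>X $ a $ b\<bar>) ^ k"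
proof (induction k arbitrary: i j)
  case (Suc k)
  let ?c = "\<Sum>a\<in>UNIV. \<Sum>b\<in>UNIV. \<bar>X $ a $ b\<bar>"
  have "\<bar>matrix_power X (Suc k) $ i $ j\<bar> \<le> (\<Sum>l\<in>UNIV. \<bar>X $ i $ l * matrix_power X k $ l $ j\<bar>)"
    by (simp add: matrix_power_Suc matrix_matrix_mult_def sum_abs)
  also have "\<dots> \<le> (\<Sum>l\<in>UNIV. \<bar>X $ i $ l\<bar> * ?c ^ k)"
    using Suc by (intro sum_mono) (simp add: abs_mult mult_left_mono)
  also have "\<dots> = (\<Sum>l\<in>UNIV. \<bar>X $ i $ l\<bar>) * ?c ^ k" by (simp add: sum_distrib_right)
  also have "\<dots> \<le> ?c * ?c ^ k"
    by (intro mult_right_mono member_le_sum zero_le_power sum_nonneg) (auto intro: sum_nonneg)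
  finally show ?case by simp
qed (simp add: mat_def)

text \<open>Defined entry by entry, so that termwise differentiation of real power series
  applies.\<close>

definition mexp :: "real^'n^'n \<Rightarrow> real \<Rightarrow> real^'n^'n" where
  "mexp X t = (\<chi> i j. \<Sum>k. (matrix_power X k $ i $ j / fact k) * t ^ k)"

lemma summable_mexp: "summable (\<lambda>k. (matrix_power X k $ i $ j / fact k) * t ^ k)"
proof (rule summable_comparison_test)
  let ?c = "\<Sum>a\<in>UNIV. \<Sum>b\<in>UNIV. \<bar>X $ a $ b\<bar>"
  show "summable (\<lambda>k. (?c * \<bar>t\<bar>) ^ k /\<^sub>R fact k)" by (rule summable_exp_generic)
  have "norm ((matrix_power X k $ i $ j / fact k) * t ^ k) \<le> (?c * \<bar>t\<bar>) ^ k /\<^sub>R fact k" for k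
    using mult_right_mono[OF matrix_power_bound[of X k i j], of "\<bar>t\<bar> ^ k / fact k"]
    by (simp add: abs_mult power_mult_distrib power_abs divide_inverse mult_ac)
  then show "\<exists>N. \<forall>k\<ge>N. norm ((matrix_power X k $ i $ j / fact k) * t ^ k) \<le> (?c * \<bar>t\<bar>) ^ k /\<^sub>R fact k" by blast
qed

lemma DERIV_mexp_series:
  "((\<lambda>t. mexp X t $ i $ j) has_real_derivative (\<Sum>k. matrix_power X (Suc k) $ i $ j / fact k * t ^ k)) (at t)"
proof -
  have eq: "diffs (\<lambda>k. matrix_power X k $ i $ j / fact k) = (\<lambda>k. matrix_power X (Suc k) $ i $ j / fact k)"
    by (simp add: diffs_def fun_eq_iff del: of_nat_Suc)
  show ?thesis
    using termdiffs_strong_converges_everywhere[OF summable_mexp[of X i j], of t]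
    unfolding eq mexp_def by simp
qed

lemma mexp_left: "(X ** mexp X t) $ i $ j = (\<Sum>k. matrix_power X (Suc k) $ i $ j / fact k * t ^ k)"
proof -
  have "(X ** mexp X t) $ i $ j = (\<Sum>l\<in>UNIV. \<Sum>k. X $ i $ l * ((matrix_power X k $ l $ j / fact k) * t ^ k))"
    by (simp only: matrix_mult_nth mexp_def vec_lambda_beta suminf_mult[OF summable_mexp])
  also have "\<dots> = (\<Sum>k. \<Sum>l\<in>UNIV. X $ i $ l * ((matrix_power X k $ l $ j / fact k) * t ^ k))"
    by (rule suminf_sum[symmetric]) (intro summable_mult summable_mexp)
  also have "\<dots> = (\<Sum>k. matrix_power X (Suc k) $ i $ j / fact k * t ^ k)"
    by (simp add: matrix_power_Suc matrix_matrix_mult_def sum_distrib_right sum_divide_distrib mult.assoc)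
  finally show ?thesis .
qed

lemma mexp_right: "(mexp X t ** X) $ i $ j = (\<Sum>k. matrix_power X (Suc k) $ i $ j / fact k * t ^ k)"
proof -
  have "(mexp X t ** X) $ i $ j = (\<Sum>l\<in>UNIV. \<Sum>k. (matrix_power X k $ i $ l / fact k) * t ^ k * X $ l $ j)"
    by (simp only: matrix_mult_nth mexp_def vec_lambda_beta suminf_mult2[OF summable_mexp])
  also have "\<dots> = (\<Sum>k. \<Sum>l\<in>UNIV. (matrix_power X k $ i $ l / fact k) * t ^ k * X $ l $ j)"
    by (rule suminf_sum[symmetric]) (intro summable_mult2 summable_mexp)
  also have "\<dots> = (\<Sum>k. matrix_power X (Suc k) $ i $ j / fact k * t ^ k)"
    by (simp add: matrix_power_Suc2 matrix_mult_nth sum_distrib_left sum_distrib_right sum_divide_distrib mult_ac)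
  finally show ?thesis .
qed

lemma mexp_commute: "X ** mexp X t = mexp X t ** X"
  by (simp add: vec_eq_iff mexp_left mexp_right)

lemma DERIV_mexp: "((\<lambda>t. mexp X t $ i $ j) has_real_derivative (X ** mexp X t) $ i $ j) (at t)"
  unfolding mexp_left by (rule DERIV_mexp_series)

lemma mexp_0 [simp]: "mexp X 0 = mat 1"
proof -
  have "mexp X 0 $ i $ j = mat 1 $ i $ j" for i j
    unfolding mexp_def using powser_zero[of "\<lambda>k. matrix_power X k $ i $ j / fact k"] by simp
  then show ?thesis by (simp add: vec_eq_iff)
qed

lemma continuous_on_vec:
  fixes x :: "'a::topological_space \<Rightarrow> 'b::topological_space^'n"
  assumes "\<And>i. continuous_on S (\<lambda>t. x t $ i)"
  shows "continuous_on S x"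
proof -
  have "continuous_on S (\<lambda>t. \<chi> i. x t $ i)" by (rule continuous_on_vec_lambda) (rule assms)
  then show ?thesis by simp
qed

lemma continuous_on_mexp [continuous_intros]:
  assumes f: "continuous_on S f" shows "continuous_on S (\<lambda>t. mexp X (f t))"
proof -
  have "continuous_on UNIV (mexp X)"
    using DERIV_mexp by (intro continuous_on_vec DERIV_continuous_on) blast
  then show ?thesis using f by (rule continuous_on_compose2) auto
qed

lemma continuous_on_matrix_mult [continuous_intros]:
  fixes F :: "'a::topological_space \<Rightarrow> real^'n^'m" and G :: "'a \<Rightarrow> real^'k^'n"
  assumes "continuous_on S F" "continuous_on S G"
  shows "continuous_on S (\<lambda>t. F t ** G t)"
  unfolding matrix_matrix_mult_def using assms by (intro continuous_intros)

lemma continuous_on_matrix_vector_mult' [continuous_intros]: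
  fixes F :: "'a::topological_space \<Rightarrow> real^'n^'m" and x :: "'a \<Rightarrow> real^'n"
  assumes "continuous_on S F" "continuous_on S x"
  shows "continuous_on S (\<lambda>t. F t *v x t)"
  unfolding matrix_vector_mult_def using assms by (intro continuous_intros)

lemma DERIV_mexp_minus: "((\<lambda>t. mexp X (- t) $ i $ j) has_real_derivative - (X ** mexp X (- t)) $ i $ j) (at t)"
  using DERIV_chain2[OF DERIV_mexp[of X i j "- t"] DERIV_minus[OF DERIV_ident]] by simp

text \<open>The derivative of the product is 0 because \<open>X\<close> commutes with its
  exponential, so the product keeps its value at 0.\<close>

lemma mexp_mult_minus: "mexp X t ** mexp X (- t) = mat 1"
proof -
  have d: "((\<lambda>t. (mexp X t ** mexp X (- t)) $ i $ j) has_real_derivative 0) (at t)" for i j t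
  proof -
    have "((\<lambda>t. \<Sum>l\<in>UNIV. mexp X t $ i $ l * mexp X (- t) $ l $ j) has_real_derivative
       (\<Sum>l\<in>UNIV. (X ** mexp X t) $ i $ l * mexp X (- t) $ l $ j + - (X ** mexp X (- t)) $ l $ j * mexp X t $ i $ l)) (at t)"
      by (intro DERIV_sum DERIV_mult DERIV_mexp DERIV_mexp_minus)
    moreover have "(\<Sum>l\<in>UNIV. (X ** mexp X t) $ i $ l * mexp X (- t) $ l $ j + - (X ** mexp X (- t)) $ l $ j * mexp X t $ i $ l)
        = ((X ** mexp X t) ** mexp X (- t)) $ i $ j - (mexp X t ** (X ** mexp X (- t))) $ i $ j"
      by (simp add: matrix_mult_nth[of "X ** mexp X t" "mexp X (- t)"] matrix_mult_nth[of "mexp X t" "X ** mexp X (- t)"]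
          sum_subtractf sum_negf sum.distrib mult.commute)
    moreover have "(X ** mexp X t) ** mexp X (- t) = mexp X t ** (X ** mexp X (- t))"
      by (simp only: mexp_commute[of X t] matrix_mul_assoc)
    ultimately show ?thesis by (simp add: matrix_mult_nth[of "mexp X _" "mexp X _"])
  qed
  have "(mexp X t ** mexp X (- t)) $ i $ j = (mexp X 0 ** mexp X (- 0)) $ i $ j" for i j
    using DERIV_isconst_all[OF allI[OF d[of i j]]] by blast
  then show ?thesis by (simp add: vec_eq_iff)
qed

lemma mexp_mult_minus_vec [simp]: "mexp X t *v (mexp X (- t) *v v) = v" "mexp X (- t) *v (mexp X t *v v) = v"
  using mexp_mult_minus[of X t] mexp_mult_minus[of X "- t"] by (simp_all add: matrix_vector_mul_assoc)

section \<open>Trajectories of linear systems\<close>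

text \<open>The variation of constants formula for the equation with matrix \<open>X\<close>,
  inhomogeneity \<open>r\<close> and initial value \<open>a\<close>.\<close>

definition traj :: "real \<Rightarrow> real^'n^'n \<Rightarrow> real^'n \<Rightarrow> (real \<Rightarrow> real^'n) \<Rightarrow> real \<Rightarrow> real^'n" where
  "traj T X a r t = mexp X t *v (a + primitive T (\<lambda>s. mexp X (- s) *v r s) t)"

lemma L2_mexp: "r \<in> L2 T \<Longrightarrow> (\<lambda>s. mexp X (- s) *v r s) \<in> L2 T"
  by (rule L2_matrix_mult) (intro continuous_intros)

lemma primitive_nth:
  fixes v :: "real \<Rightarrow> real^'n"
  assumes "integrable (interval_measure T) v"
  shows "primitive T v t $ i = primitive T (\<lambda>s. v s $ i) t"
  unfolding primitive_def
  by (subst integral_vec_nth[OF integrable_cut[OF assms]]) (auto intro: Bochner_Integration.integral_cong)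

lemma continuous_on_traj: "r \<in> L2 T \<Longrightarrow> continuous_on UNIV (traj T X a r)"
  unfolding traj_def
  by (intro continuous_intros continuous_on_primitive L2_integrable L2_mexp) auto

lemma traj_0: "traj T X a r 0 = a"
  by (simp add: traj_def)

lemma L2_traj: "r \<in> L2 T \<Longrightarrow> traj T X a r \<in> L2 T"
  by (rule L2_continuous) (rule continuous_on_subset[OF continuous_on_traj], auto)

lemma has_weak_derivative_traj:
  assumes r: "r \<in> L2 T" and T: "0 < T"
  shows "has_weak_derivative T (traj T X a r) (\<lambda>t. X *v traj T X a r t + r t)"
  unfolding has_weak_derivative_iff[OF L2_traj[OF r]]
proof (intro conjI allI)
  show "(\<lambda>t. X *v traj T X a r t + r t) \<in> L2 T"
    by (intro L2_add r L2_matrix_mult L2_traj continuous_intros)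
  fix i
  let ?v = "\<lambda>s. mexp X (- s) *v r s"
  define z where "z = (\<lambda>t. a + primitive T ?v t)"
  have v: "integrable (interval_measure T) ?v" by (intro L2_integrable L2_mexp r)
  have z: "weak_deriv T (\<lambda>t. z t $ j) (\<lambda>t. ?v t $ j)" for j
    unfolding z_def using weak_deriv_primitive[OF integrable_vec_nth[OF v] T, of "a $ j" j]
    by (simp add: primitive_nth[OF v])
  have "weak_deriv T (\<lambda>t. \<Sum>j\<in>UNIV. mexp X t $ i $ j * z t $ j)
      (\<lambda>t. \<Sum>j\<in>UNIV. (X ** mexp X t) $ i $ j * z t $ j + mexp X t $ i $ j * ?v t $ j)"
    by (intro weak_deriv_sum weak_deriv_mult DERIV_mexp z continuous_intros) auto
  moreover have "(\<Sum>j\<in>UNIV. mexp X t $ i $ j * z t $ j) = traj T X a r t $ i" for t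
    by (simp add: traj_def z_def matrix_vector_mult_def)
  moreover have "(\<Sum>j\<in>UNIV. (X ** mexp X t) $ i $ j * z t $ j + mexp X t $ i $ j * ?v t $ j)
      = (X *v traj T X a r t + r t) $ i" for t
  proof -
    have "(\<Sum>j\<in>UNIV. (X ** mexp X t) $ i $ j * z t $ j + mexp X t $ i $ j * ?v t $ j)
       = ((X ** mexp X t) *v z t + mexp X t *v ?v t) $ i"
      by (simp add: matrix_vector_mult_def[of "X ** _"] matrix_vector_mult_def[of _ "mexp X (- t) *v r t"] sum.distrib)
    also have "(X ** mexp X t) *v z t + mexp X t *v ?v t = X *v traj T X a r t + r t"
      by (simp add: traj_def z_def matrix_vector_mul_assoc[symmetric])
    finally show ?thesis .
  qed
  ultimately show "weak_deriv T (\<lambda>t. traj T X a r t $ i) (\<lambda>t. (X *v traj T X a r t + r t) $ i)"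
    by simp
qed

lemma traj_in_H1: "r \<in> L2 T \<Longrightarrow> 0 < T \<Longrightarrow> traj T X a r \<in> H1 T"
  unfolding H1_def
  using L2_traj has_weak_derivative_traj continuous_on_subset[OF continuous_on_traj] by blast

text \<open>Integrating factor: \<open>mexp X (- t) *v x t\<close> has the weak derivative
  \<open>mexp X (- t) *v r t\<close>, so it is a primitive of the latter up to its initial
  value.\<close>

lemma solution_eq_traj:
  assumes x: "x \<in> L2 T" "continuous_on {0..T} x" and w: "has_weak_derivative T x v" and r: "r \<in> L2 T"
    and eq: "AE t in interval_measure T. v t = X *v x t + r t" and T: "0 < T" and t: "t \<in> {0..T}"
  shows "x t = traj T X (x 0) r t"
proof -
  let ?v = "\<lambda>s. mexp X (- s) *v r s"
  define y where "y = (\<lambda>t. mexp X (- t) *v x t)"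
  have v: "integrable (interval_measure T) ?v" by (intro L2_integrable L2_mexp r)
  have cy: "continuous_on {0..T} y" unfolding y_def by (intro continuous_intros x)
  have "weak_deriv T (\<lambda>t. y t $ i) (\<lambda>t. ?v t $ i)" for i
  proof (rule weak_deriv_cong)
    have "weak_deriv T (\<lambda>t. x t $ j) (\<lambda>t. v t $ j)" for j
      using w by (simp add: has_weak_derivative_iff[OF x(1)])
    then have "weak_deriv T (\<lambda>t. \<Sum>j\<in>UNIV. mexp X (- t) $ i $ j * x t $ j)
      (\<lambda>t. \<Sum>j\<in>UNIV. - (X ** mexp X (- t)) $ i $ j * x t $ j + mexp X (- t) $ i $ j * v t $ j)"
      by (intro weak_deriv_sum weak_deriv_mult DERIV_mexp_minus continuous_intros) auto
    then show "weak_deriv T (\<lambda>t. y t $ i) (\<lambda>t. \<Sum>j\<in>UNIV. - (X ** mexp X (- t)) $ i $ j * x t $ j + mexp X (- t) $ i $ j * v t $ j)"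
      by (simp add: y_def matrix_vector_mult_def)
    show "(\<lambda>t. ?v t $ i) \<in> borel_measurable (interval_measure T)"
      by (intro borel_measurable_integrable integrable_vec_nth v)
    show "AE t in interval_measure T. (\<Sum>j\<in>UNIV. - (X ** mexp X (- t)) $ i $ j * x t $ j + mexp X (- t) $ i $ j * v t $ j) = ?v t $ i"
      using eq
    proof eventually_elim
      case (elim t)
      have "(\<Sum>j\<in>UNIV. - (X ** mexp X (- t)) $ i $ j * x t $ j + mexp X (- t) $ i $ j * v t $ j)
          = (- ((X ** mexp X (- t)) *v x t) + mexp X (- t) *v v t) $ i"
        by (simp add: matrix_vector_mult_def[of "X ** _"] matrix_vector_mult_def[of _ "v t"] sum.distrib sum_negf sum_subtractf)
      also have "- ((X ** mexp X (- t)) *v x t) + mexp X (- t) *v v t = ?v t"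
        by (simp add: elim mexp_commute matrix_vector_right_distrib matrix_vector_mul_assoc)
      finally show ?case .
    qed
  qed
  then have "y t $ i = y 0 $ i + primitive T (\<lambda>t. ?v t $ i) t" for i
    by (intro weak_deriv_eq_primitive t T continuous_intros cy)
  then have "y t = x 0 + primitive T ?v t"
    by (simp add: vec_eq_iff primitive_nth[OF v] y_def)
  then have "mexp X t *v y t = traj T X (x 0) r t" by (simp add: traj_def)
  then show ?thesis by (simp add: y_def)
qed

lemma matrix_function_bound:
  fixes e :: "real \<Rightarrow> real^'m^'n"
  assumes e: "continuous_on {0..T} e"
  shows "\<exists>b\<ge>0. \<forall>t\<in>{0..T}. \<forall>v. norm (e t *v v) \<le> b * norm v"
proof -
  have "continuous_on {0..T} (\<lambda>t. \<Sum>i\<in>UNIV. \<Sum>j\<in>UNIV. \<bar>e t $ i $ j\<bar>)"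
    by (intro continuous_intros e)
  from continuous_bounded_interval[OF this]
  obtain b where b: "0 \<le> b" "\<forall>t\<in>{0..T}. \<bar>\<Sum>i\<in>UNIV. \<Sum>j\<in>UNIV. \<bar>e t $ i $ j\<bar>\<bar> \<le> b" by blast
  have "norm (e t *v v) \<le> b * norm v" if t: "t \<in> {0..T}" for t v
  proof -
    have "norm (e t *v v) \<le> (\<Sum>i\<in>UNIV. \<bar>(e t *v v) $ i\<bar>)" by (rule norm_le_l1_cart)
    also have "\<dots> \<le> (\<Sum>i\<in>UNIV. \<Sum>j\<in>UNIV. \<bar>e t $ i $ j\<bar> * norm v)"
    proof (rule sum_mono)
      fix i
      have "\<bar>(e t *v v) $ i\<bar> \<le> (\<Sum>j\<in>UNIV. \<bar>e t $ i $ j * v $ j\<bar>)"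
        by (simp add: matrix_vector_mult_def sum_abs)
      also have "\<dots> \<le> (\<Sum>j\<in>UNIV. \<bar>e t $ i $ j\<bar> * norm v)"
        by (intro sum_mono) (simp add: abs_mult mult_left_mono component_le_norm_cart)
      finally show "\<bar>(e t *v v) $ i\<bar> \<le> (\<Sum>j\<in>UNIV. \<bar>e t $ i $ j\<bar> * norm v)" .
    qed
    also have "\<dots> = (\<Sum>i\<in>UNIV. \<Sum>j\<in>UNIV. \<bar>e t $ i $ j\<bar>) * norm v" by (simp add: sum_distrib_right)
    also have "\<dots> \<le> b * norm v"
      using bspec[OF b(2) t] by (intro mult_right_mono) auto
    finally show ?thesis .
  qed
  then show ?thesis using b(1) by blast
qed

section \<open>Controllability\<close>

lemma transpose_mult_inner: "(transpose E *v c) \<bullet> w = c \<bullet> (E *v w)" for E :: "real^'m^'n"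
  by (metis dot_lmul_matrix transpose_matrix_vector)

text \<open>Each differentiation of the hypothesis in \<open>t\<close> brings down a factor
  \<open>- X\<close>. Up to sign, \<open>\<phi> k j\<close> is the k-th derivative of component
  \<open>j\<close>, so all blocks of the controllability matrix are reached.\<close>

lemma mexp_controllability_kernel:
  fixes X :: "real^'n^'n" and G :: "real^'k^'n"
  assumes rank: "rank (controllability_matrix X G) = CARD('n)" and T: "0 < T"
    and z: "\<And>t. t \<in> {0<..<T} \<Longrightarrow> transpose (mexp X (- t) ** G) *v c = 0"
  shows "c = 0"
proof -
  define \<phi> where "\<phi> = (\<lambda>k j t. \<Sum>i\<in>UNIV. \<Sum>l\<in>UNIV. c $ i * mexp X (- t) $ i $ l * (matrix_power X k ** G) $ l $ j)"
  have \<phi>: "\<phi> k j t = (transpose (mexp X (- t) ** (matrix_power X k ** G)) *v c) $ j" for k j t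
    by (simp add: \<phi>_def matrix_vector_mult_def transpose_def matrix_mult_nth[of "mexp X (- t)"] sum_distrib_right sum_distrib_left mult_ac)
  have d: "(\<phi> k j has_real_derivative - \<phi> (Suc k) j t) (at t)" for k j t
  proof -
    have "(\<phi> k j has_real_derivative
        (\<Sum>i\<in>UNIV. \<Sum>l\<in>UNIV. c $ i * - (X ** mexp X (- t)) $ i $ l * (matrix_power X k ** G) $ l $ j)) (at t)"
      unfolding \<phi>_def by (intro DERIV_sum DERIV_cmult_right DERIV_cmult DERIV_mexp_minus)
    moreover have "(\<Sum>i\<in>UNIV. \<Sum>l\<in>UNIV. c $ i * - (X ** mexp X (- t)) $ i $ l * (matrix_power X k ** G) $ l $ j)
        = - (transpose ((X ** mexp X (- t)) ** (matrix_power X k ** G)) *v c) $ j"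
      by (simp add: matrix_vector_mult_def transpose_def matrix_mult_nth[of "X ** mexp X (- t)"] sum_distrib_right sum_distrib_left mult_ac sum_negf)
    moreover have "(X ** mexp X (- t)) ** (matrix_power X k ** G) = mexp X (- t) ** (matrix_power X (Suc k) ** G)"
      by (simp add: mexp_commute matrix_power_Suc matrix_mul_assoc)
    ultimately show ?thesis by (simp add: \<phi>)
  qed
  have zero: "\<phi> k j t = 0" if "t \<in> {0<..<T}" for k j t
    using that
  proof (induction k arbitrary: t)
    case 0
    then show ?case using z[of t] by (simp add: \<phi>)
  next
    case (Suc k)
    have "(\<phi> k j has_real_derivative 0) (at t)"
      by (rule has_field_derivative_transform_within_open[of "\<lambda>_. 0" _ _ "{0<..<T}"]) (use Suc in auto)
    from DERIV_unique[OF this d[of k j t]] show ?case by simp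
  qed
  \<comment> \<open>An interior time, since the identities hold on the open interval only. The
    exponential is invertible, so \<open>a = 0\<close> gives \<open>c = 0\<close>.\<close>
  define a where "a = transpose (mexp X (- (T / 2))) *v c"
  have "(transpose (controllability_matrix X G) *v a) $ pc = 0" for pc
  proof -
    let ?k = "to_nat_on (UNIV :: 'n set) (fst pc)"
    have "(transpose (controllability_matrix X G) *v a) $ pc = (transpose (matrix_power X ?k ** G) *v a) $ snd pc"
      by (simp add: matrix_vector_mult_def transpose_def controllability_matrix_def)
    also have "\<dots> = \<phi> ?k (snd pc) (T / 2)"
      by (simp add: \<phi> a_def matrix_transpose_mul matrix_vector_mul_assoc matrix_mul_assoc del: transpose_matrix_vector)
    also have "\<dots> = 0" using T by (intro zero) auto
    finally show ?thesis .
  qed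
  then have "transpose (controllability_matrix X G) *v a = transpose (controllability_matrix X G) *v 0"
    by (simp add: vec_eq_iff)
  moreover have "inj ((*v) (transpose (controllability_matrix X G)))"
    using rank by (simp add: full_rank_injective[symmetric] rank_transpose)
  ultimately have a: "a = 0" by (rule injD[rotated])
  have "c = transpose (mexp X (T / 2)) *v a"
    using mexp_mult_minus[of X "- (T / 2)"]
    by (simp add: a_def matrix_vector_mul_assoc matrix_transpose_mul[symmetric] del: transpose_matrix_vector)
  then show ?thesis by (simp add: a)
qed

text \<open>The Gramian \<open>W\<close> is injective, hence onto.\<close>

lemma traj_reaches:
  fixes X :: "real^'n^'n" and G :: "real^'k^'n"
  assumes rank: "rank (controllability_matrix X G) = CARD('n)" and T: "0 < T" and h: "h \<in> L2 T"
  shows "\<exists>w. continuous_on UNIV w \<and> traj T X a (\<lambda>t. h t + G *v w t) T = v"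
proof -
  let ?L = "interval_measure T"
  define e where "e = (\<lambda>s. mexp X (- s) ** G)"
  define W where "W = (\<lambda>c. \<integral>s. e s *v (transpose (e s) *v c) \<partial>?L)"
  have ce: "continuous_on UNIV e" unfolding e_def by (intro continuous_intros)
  have cet: "continuous_on UNIV (\<lambda>s. transpose (e s))"
    unfolding transpose_def by (intro continuous_intros ce)
  have cont: "continuous_on UNIV (\<lambda>s. e s *v (transpose (e s) *v c))" for c
    by (intro continuous_intros ce cet)
  have int: "integrable ?L (\<lambda>s. e s *v (transpose (e s) *v c))" for c
    by (intro L2_integrable L2_continuous continuous_on_subset[OF cont]) auto
  have lin: "linear W"
  proof (rule linearI)
    show "W (x + y) = W x + W y" for x y
      unfolding W_def using int by (simp add: matrix_vector_right_distrib)
    show "W (r *\<^sub>R x) = r *\<^sub>R W x" for r x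
      unfolding W_def by (simp add: matrix_vector_mult_scaleR)
  qed
  have "c = 0" if "W c = 0" for c
  proof (rule mexp_controllability_kernel[OF rank T])
    have cn: "continuous_on UNIV (\<lambda>s. (norm (transpose (e s) *v c))\<^sup>2)" by (intro continuous_intros cet)
    \<comment> \<open>The quadratic form of the Gramian is the integral of a continuous square, so
      \<open>W c = 0\<close> makes the integrand vanish on the whole interval.\<close>
    have "(\<integral>s. (norm (transpose (e s) *v c))\<^sup>2 \<partial>?L) = (\<integral>s. c \<bullet> (e s *v (transpose (e s) *v c)) \<partial>?L)"
      by (simp only: power2_norm_eq_inner transpose_mult_inner)
    also have "\<dots> = c \<bullet> W c" unfolding W_def using int by simp
    finally have "(\<integral>s. (norm (transpose (e s) *v c))\<^sup>2 \<partial>?L) = 0" using that by simp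
    from continuous_nonneg_integral_0[OF cn _ this]
    show "transpose (mexp X (- t) ** G) *v c = 0" if "t \<in> {0<..<T}" for t
      using that by (simp add: e_def)
  qed
  then have "inj W" using lin by (simp add: linear_injective_0)
  then have "surj W" using lin linear_injective_imp_surjective by blast
  \<comment> \<open>The right-hand side is the variation of constants formula at \<open>T\<close>,
    solved for the contribution that \<open>w\<close> must make.\<close>
  then obtain c where c: "W c = mexp X (- T) *v v - a - (\<integral>s. mexp X (- s) *v h s \<partial>?L)" by (metis surjD)
  define w where "w = (\<lambda>s. transpose (e s) *v c)"
  have "(\<integral>s. mexp X (- s) *v (h s + G *v w s) \<partial>?L) = (\<integral>s. mexp X (- s) *v h s + e s *v w s \<partial>?L)"
    by (simp add: e_def matrix_vector_right_distrib matrix_vector_mul_assoc)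
  also have "\<dots> = (\<integral>s. mexp X (- s) *v h s \<partial>?L) + W c"
    unfolding W_def w_def by (intro Bochner_Integration.integral_add int L2_integrable L2_mexp h)
  finally have "traj T X a (\<lambda>t. h t + G *v w t) T = v"
    by (simp add: traj_def c)
  moreover have "continuous_on UNIV w" unfolding w_def by (intro continuous_intros cet)
  ultimately show ?thesis by blast
qed

lemma admissible_control_exists:
  fixes A :: "real^'n^'n" and B :: "real^'m^'n" and C :: "real^'n^'l" and D :: "real^'m^'l" and Y :: "real^'k^'m"
  assumes D: "rank D = CARD('l)" and DY: "D ** Y = 0"
    and rank: "rank (controllability_matrix (A - B ** pseudoinverse D ** C) (B ** Y)) = CARD('n)"
    and f: "f \<in> L2 T" and T: "0 < T"
  shows "\<exists>x u. x \<in> H1 T \<and> u \<in> L2 T \<and> has_weak_derivative T x (\<lambda>t. A *v x t + B *v u t) \<and>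
    (\<forall>t. C *v x t + D *v u t = f t) \<and> x 0 = x0 \<and> x T = v"
proof -
  let ?D = "pseudoinverse D" and ?X = "A - B ** pseudoinverse D ** C"
  have h: "(\<lambda>t. (B ** ?D) *v f t) \<in> L2 T" by (intro L2_matrix_mult f continuous_intros)
  from traj_reaches[OF rank T h] obtain w where w: "continuous_on UNIV w"
    "traj T ?X x0 (\<lambda>t. (B ** ?D) *v f t + (B ** Y) *v w t) T = v" by blast
  define r where "r = (\<lambda>t. (B ** ?D) *v f t + (B ** Y) *v w t)"
  define x where "x = traj T ?X x0 r"
  define u where "u = (\<lambda>t. ?D *v (f t - C *v x t) + Y *v w t)"
  have wL: "w \<in> L2 T" by (intro L2_continuous continuous_on_subset[OF w(1)]) auto
  have r: "r \<in> L2 T" unfolding r_def by (intro L2_add h L2_matrix_mult wL continuous_intros)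
  have u: "u \<in> L2 T" unfolding u_def x_def
    by (intro L2_add L2_diff L2_matrix_mult wL f L2_traj r continuous_intros)
  \<comment> \<open>Full row rank makes \<open>transpose D\<close> injective, so it can be cancelled
    from the transposed Penrose equation. As a right inverse, \<open>?D\<close> turns the path
    constraint into an equality.\<close>
  have DD: "D ** ?D = mat 1"
  proof -
    have inj: "inj ((*v) (transpose D))"
      using D by (simp add: full_rank_injective[symmetric] rank_transpose)
    have "D ** ?D ** D = D"
      using pseudoinverse_full_row_rank[OF D] by (simp add: is_pseudoinverse_def)
    then have "transpose D ** transpose (D ** ?D) = transpose D"
      by (metis matrix_transpose_mul)
    then have "transpose (D ** ?D) *v y = y" for y
      using inj by (metis injD matrix_vector_mul_assoc)
    then have "transpose (D ** ?D) = mat 1" by (simp add: matrix_eq)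
    then show ?thesis by (metis transpose_mat transpose_transpose)
  qed
  have "A *v x t + B *v u t = ?X *v x t + r t" for t
    by (simp add: u_def r_def matrix_vector_mult_diff_rdistrib matrix_vector_mult_diff_distrib
        matrix_vector_right_distrib matrix_vector_mul_assoc matrix_mul_assoc)
  then have "has_weak_derivative T x (\<lambda>t. A *v x t + B *v u t)"
    using has_weak_derivative_traj[OF r T, of ?X x0] by (simp add: x_def)
  moreover have "C *v x t + D *v u t = f t" for t
    by (simp add: u_def matrix_vector_right_distrib matrix_vector_mul_assoc DD DY)
  moreover have "x 0 = x0" "x T = v" using w(2) by (simp_all add: x_def r_def traj_0)
  moreover have "x \<in> H1 T" unfolding x_def by (rule traj_in_H1[OF r T])
  ultimately show ?thesis using u by blast
qed

section \<open>Existence of minimizers\<close>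

text \<open>A replacement for weak compactness: near-minimizers of \<open>J\<close> on the shrinking convex sets
  \<open>{u. norm (e u - z) \<le> 1 / (k + 1)}\<close> form a Cauchy sequence by the parallelogram inequality.\<close>

lemma lower_semicontinuous_by_midpoints:
  fixes J :: "'u \<Rightarrow> real" and e :: "'u \<Rightarrow> 'b::euclidean_space" and d :: "'u \<Rightarrow> 'u \<Rightarrow> real" and mid :: "'u \<Rightarrow> 'u \<Rightarrow> 'u"
  assumes J: "\<And>u. u \<in> U \<Longrightarrow> 0 \<le> J u"
    and mid: "\<And>u v. u \<in> U \<Longrightarrow> v \<in> U \<Longrightarrow> mid u v \<in> U"
      "\<And>u v. u \<in> U \<Longrightarrow> v \<in> U \<Longrightarrow> e (mid u v) = (1/2) *\<^sub>R (e u + e v)"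
      "\<And>u v. u \<in> U \<Longrightarrow> v \<in> U \<Longrightarrow> J (mid u v) \<le> J u / 2 + J v / 2 - \<gamma> * d u v"
    and \<gamma>: "0 < \<gamma>"
    and complete: "\<And>u z c. (\<And>k. u k \<in> U) \<Longrightarrow> (\<And>\<eta>. 0 < \<eta> \<Longrightarrow> \<exists>N. \<forall>j\<ge>N. \<forall>k\<ge>N. d (u j) (u k) < \<eta>) \<Longrightarrow>
      (\<lambda>k. e (u k)) \<longlonglongrightarrow> z \<Longrightarrow> (\<And>k. J (u k) \<le> c k) \<Longrightarrow> c \<longlonglongrightarrow> c0 \<Longrightarrow> \<exists>u\<in>U. e u = z \<and> J u \<le> c0"
    and u: "\<And>k. u k \<in> U" and z: "(\<lambda>k. e (u k)) \<longlonglongrightarrow> z" and c: "\<And>k. J (u k) \<le> c k" "c \<longlonglongrightarrow> c0"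
  shows "\<exists>u\<in>U. e u = z \<and> J u \<le> c0"
proof -
  define S where "S = (\<lambda>k::nat. {u \<in> U. norm (e u - z) \<le> 1 / real (Suc k)})"
  define \<mu> where "\<mu> = (\<lambda>k. Inf (J ` S k))"
  have bdd: "bdd_below (J ` S k)" for k by (rule bdd_belowI[of _ 0]) (auto simp: S_def J)
  have ev: "\<forall>\<^sub>F j in sequentially. u j \<in> S k" for k
  proof -
    have "\<forall>\<^sub>F j in sequentially. dist (e (u j)) z < 1 / real (Suc k)" by (rule tendstoD[OF z]) simp
    then show ?thesis by eventually_elim (auto simp: S_def u dist_norm)
  qed
  have \<mu>_le: "\<mu> k \<le> J v" if "v \<in> S k" for k v
    unfolding \<mu>_def using that bdd by (intro cInf_lower) auto
  \<comment> \<open>The given sequence eventually enters every \<open>S k\<close>, so the infima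
    stay below the limit of \<open>c\<close>; being increasing, they converge.\<close>
  have \<mu>c: "\<mu> k \<le> c0" for k
  proof (rule tendsto_lowerbound[OF c(2)])
    show "\<forall>\<^sub>F j in sequentially. \<mu> k \<le> c j"
      using ev[of k] by eventually_elim (rule order_trans[OF \<mu>_le c(1)])
  qed simp
  have ne: "J ` S k \<noteq> {}" for k using eventually_happens'[OF sequentially_bot ev[of k]] by blast
  have S_anti: "S j \<subseteq> S k" if "k \<le> j" for j k
  proof -
    have "1 / real (Suc j) \<le> 1 / real (Suc k)" using that by (simp add: frac_le)
    then show ?thesis by (auto simp: S_def)
  qed
  have \<mu>_mono: "\<mu> k \<le> \<mu> j" if "k \<le> j" for j k
    unfolding \<mu>_def using S_anti[OF that] by (intro cInf_superset_mono ne bdd) auto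
  have "\<exists>v. v \<in> S k \<and> J v < \<mu> k + 1 / real (Suc k)" for k
  proof -
    have "Inf (J ` S k) < \<mu> k + 1 / real (Suc k)" by (simp add: \<mu>_def)
    from cInf_lessD[OF ne this] show ?thesis by blast
  qed
  then obtain v where v: "\<And>k. v k \<in> S k" "\<And>k. J (v k) < \<mu> k + 1 / real (Suc k)" by metis
  have vU: "v k \<in> U" for k using v(1)[of k] by (simp add: S_def)
  have "incseq \<mu>" using \<mu>_mono by (simp add: incseq_def)
  then obtain l where l: "\<mu> \<longlonglongrightarrow> l" using incseq_convergent[of \<mu> c0] \<mu>c by blast
  have inv: "(\<lambda>k. 1 / real (Suc k)) \<longlonglongrightarrow> 0" by (rule LIMSEQ_Suc[OF lim_1_over_n])
  \<comment> \<open>\<open>S N\<close> is closed under midpoints, so \<open>\<mu> N\<close> bounds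
    the value at the midpoint from below. The values at both points are at most
    \<open>l + 1 / (N + 1)\<close>, and the rest of the midpoint inequality bounds
    \<open>d\<close>.\<close>
  have dle: "\<gamma> * d (v j) (v k) \<le> (l - \<mu> N) + 1 / real (Suc N)" if N: "N \<le> j" "N \<le> k" for j k N
  proof -
    have jk: "v j \<in> S N" "v k \<in> S N" using v(1)[of j] v(1)[of k] S_anti[OF N(1)] S_anti[OF N(2)] by blast+
    have "e (mid (v j) (v k)) - z = (1/2) *\<^sub>R (e (v j) - z) + (1/2) *\<^sub>R (e (v k) - z)"
      using scaleR_half_double[of z] by (simp add: mid vU algebra_simps scaleR_2)
    then have "norm (e (mid (v j) (v k)) - z) \<le> norm (e (v j) - z) / 2 + norm (e (v k) - z) / 2"
      using norm_triangle_ineq[of "(1/2) *\<^sub>R (e (v j) - z)" "(1/2) *\<^sub>R (e (v k) - z)"] by simp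
    also have "\<dots> \<le> 1 / real (Suc N)" using jk by (auto simp: S_def)
    finally have "mid (v j) (v k) \<in> S N" using mid(1) vU by (simp add: S_def)
    then have "\<mu> N \<le> J (v j) / 2 + J (v k) / 2 - \<gamma> * d (v j) (v k)"
      using \<mu>_le mid(3)[OF vU vU, of j k] by fastforce
    moreover have "\<mu> i \<le> l" for i by (rule incseq_le[OF \<open>incseq \<mu>\<close> l])
    moreover have "1 / real (Suc j) \<le> 1 / real (Suc N)" "1 / real (Suc k) \<le> 1 / real (Suc N)"
      using N by (simp_all add: frac_le)
    ultimately show ?thesis using v(2)[of j] v(2)[of k] by (smt (verit) field_sum_of_halves)
  qed
  have lim: "(\<lambda>N. (l - \<mu> N) + 1 / real (Suc N)) \<longlonglongrightarrow> 0"
    using tendsto_add[OF tendsto_diff[OF tendsto_const[of l] l] inv] by simp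
  show ?thesis
  proof (rule complete[OF vU])
    fix \<eta> :: real assume "0 < \<eta>"
    then have "\<forall>\<^sub>F N in sequentially. (l - \<mu> N) + 1 / real (Suc N) < \<gamma> * \<eta>"
      using \<gamma> by (intro order_tendstoD(2)[OF lim]) simp
    from eventually_happens'[OF sequentially_bot this]
    obtain N where N: "(l - \<mu> N) + 1 / real (Suc N) < \<gamma> * \<eta>" by blast
    have "d (v j) (v k) < \<eta>" if "N \<le> j" "N \<le> k" for j k
    proof -
      have "\<gamma> * d (v j) (v k) < \<gamma> * \<eta>" using dle[OF that] N by linarith
      then show ?thesis using \<gamma> by simp
    qed
    then show "\<exists>N. \<forall>j\<ge>N. \<forall>k\<ge>N. d (v j) (v k) < \<eta>" by blast
  next
    show "(\<lambda>k. e (v k)) \<longlonglongrightarrow> z"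
    proof (rule LIM_zero_cancel, rule tendsto_0_le[OF inv, of _ 1])
      show "\<forall>\<^sub>F k in sequentially. norm (e (v k) - z) \<le> norm (1 / real (Suc k)) * 1"
        using v(1) by (intro always_eventually) (simp add: S_def)
    qed
    show "J (v k) \<le> c0 + 1 / real (Suc k)" for k using v(2)[of k] \<mu>c[of k] by linarith
    show "(\<lambda>k. c0 + 1 / real (Suc k)) \<longlonglongrightarrow> c0" using tendsto_add[OF tendsto_const[of c0] inv] by simp
  qed
qed

text \<open>\<phi> falls at most linearly in \<open>norm (e u)\<close>, which grows at most like
  \<open>sqrt (J u)\<close>; so \<open>J\<close> dominates, and \<open>e\<close> is bounded along a
  minimizing sequence. From a limit point of these values, \<open>lsc\<close> returns an element of
  \<open>U\<close>.\<close>

lemma coercive_minimizer_exists: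
  fixes J :: "'u \<Rightarrow> real" and e :: "'u \<Rightarrow> 'b::euclidean_space" and \<phi> :: "'b \<Rightarrow> real"
  assumes J: "\<And>u. u \<in> U \<Longrightarrow> 0 \<le> J u"
    and lsc: "\<And>u z c c0. (\<And>k. u k \<in> U) \<Longrightarrow> (\<lambda>k. e (u k)) \<longlonglongrightarrow> z \<Longrightarrow> (\<And>k. J (u k) \<le> c k) \<Longrightarrow> c \<longlonglongrightarrow> c0
      \<Longrightarrow> \<exists>u\<in>U. e u = z \<and> J u \<le> c0"
    and growth: "\<And>u. u \<in> U \<Longrightarrow> norm (e u) \<le> p + r * sqrt (J u)" "0 \<le> r"
    and \<phi>: "continuous_on UNIV \<phi>" "\<And>z. - a - b * norm z \<le> \<phi> z" "0 \<le> b"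
    and Z: "closed Z" and ne: "u0 \<in> U" "e u0 \<in> Z"
  shows "\<exists>u\<in>U. e u \<in> Z \<and> (\<forall>v\<in>U. e v \<in> Z \<longrightarrow> \<phi> (e u) + J u \<le> \<phi> (e v) + J v)"
proof -
  define V where "V = {u \<in> U. e u \<in> Z}"
  define \<Phi> where "\<Phi> = (\<lambda>u. \<phi> (e u) + J u)"
  define m where "m = Inf (\<Phi> ` V)"
  have low: "(sqrt (J u))\<^sup>2 - b * r * sqrt (J u) - a - b * p \<le> \<Phi> u" if "u \<in> V" for u
  proof -
    have u: "u \<in> U" using that by (simp add: V_def)
    have "b * norm (e u) \<le> b * (p + r * sqrt (J u))" using growth(1)[OF u] \<phi>(3) by (rule mult_left_mono)
    then show ?thesis using \<phi>(2)[of "e u"] J[OF u] by (simp add: \<Phi>_def algebra_simps)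
  qed
  have "bdd_below (\<Phi> ` V)"
  proof (rule bdd_belowI2)
    fix u assume "u \<in> V"
    have "0 \<le> (sqrt (J u) - b * r / 2)\<^sup>2" by simp
    moreover have "(sqrt (J u) - b * r / 2)\<^sup>2 = (sqrt (J u))\<^sup>2 - b * r * sqrt (J u) + (b * r / 2)\<^sup>2"
      by (simp add: power2_diff)
    ultimately show "- (b * r / 2)\<^sup>2 - a - b * p \<le> \<Phi> u" using low[OF \<open>u \<in> V\<close>] by linarith
  qed
  then have m_le: "m \<le> \<Phi> u" if "u \<in> V" for u unfolding m_def using that by (intro cInf_lower) auto
  have "\<Phi> ` V \<noteq> {}" using ne by (auto simp: V_def)
  then have "\<exists>u. u \<in> V \<and> \<Phi> u < m + 1 / real (Suc k)" for k
    using cInf_lessD[of "\<Phi> ` V" "m + 1 / real (Suc k)"] by (auto simp: m_def)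
  then obtain u where u: "\<And>k. u k \<in> V" "\<And>k. \<Phi> (u k) < m + 1 / real (Suc k)" by metis
  have uU: "u k \<in> U" for k using u(1)[of k] by (simp add: V_def)
  \<comment> \<open>\<open>R\<close> bounds \<open>s * (s - b * r)\<close> along the sequence, where
    \<open>s = sqrt (J (u k))\<close>. For \<open>s\<close> above
    \<open>b * r + \<bar>R\<bar> + 1\<close> the first factor is at least 1 and the second at least
    \<open>\<bar>R\<bar> + 1\<close>, which is too much.\<close>
  define R where "R = m + 1 + a + b * p"
  have s_bound: "sqrt (J (u k)) \<le> b * r + \<bar>R\<bar> + 1" for k
  proof (rule ccontr)
    define s where "s = sqrt (J (u k))"
    assume "\<not> ?thesis"
    then have s: "b * r + \<bar>R\<bar> + 1 < s" by (simp add: s_def)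
    have "0 \<le> b * r" using \<phi>(3) growth(2) by simp
    then have "1 \<le> s" "\<bar>R\<bar> + 1 \<le> s - b * r" using s by linarith+
    then have "1 * (\<bar>R\<bar> + 1) \<le> s * (s - b * r)" by (intro mult_mono) auto
    also have "s * (s - b * r) = s\<^sup>2 - b * r * s" by (simp add: power2_eq_square algebra_simps)
    also have "\<dots> \<le> \<Phi> (u k) + (a + b * p)" using low[OF u(1)[of k]] by (simp add: s_def)
    also have "\<dots> < m + 1 / real (Suc k) + (a + b * p)" using u(2)[of k] by simp
    also have "\<dots> \<le> R" by (simp add: R_def)
    finally show False by simp
  qed
  have nE: "norm (e (u k)) \<le> p + r * (b * r + \<bar>R\<bar> + 1)" for k
    using growth(1)[OF uU[of k]] mult_left_mono[OF s_bound[of k] growth(2)] by linarith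
  define E where "E = (\<lambda>k. e (u k))"
  have "\<forall>k. E k \<in> cball 0 (p + r * (b * r + \<bar>R\<bar> + 1))" by (simp add: E_def nE)
  moreover have "compact (cball (0::'b) (p + r * (b * r + \<bar>R\<bar> + 1)))" by simp
  ultimately obtain z and q :: "nat \<Rightarrow> nat" where q: "strict_mono q" "(E \<circ> q) \<longlonglongrightarrow> z"
    unfolding compact_eq_seq_compact_metric seq_compact_def by blast
  have z: "(\<lambda>k. e (u (q k))) \<longlonglongrightarrow> z" using q(2) by (simp add: comp_def E_def)
  have "(\<lambda>k. \<phi> (e (u (q k)))) \<longlonglongrightarrow> \<phi> z"
    by (rule continuous_on_tendsto_compose[OF \<phi>(1) z]) auto
  moreover have "(\<lambda>k. 1 / real (Suc (q k))) \<longlonglongrightarrow> 0"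
    using LIMSEQ_subseq_LIMSEQ[OF LIMSEQ_Suc[OF lim_1_over_n] q(1)] by (simp add: comp_def)
  ultimately have lim: "(\<lambda>k. m + 1 / real (Suc (q k)) - \<phi> (e (u (q k)))) \<longlonglongrightarrow> m + 0 - \<phi> z"
    by (intro tendsto_intros)
  have "\<exists>w\<in>U. e w = z \<and> J w \<le> m + 0 - \<phi> z"
  proof (rule lsc[OF uU z _ lim])
    show "J (u (q k)) \<le> m + 1 / real (Suc (q k)) - \<phi> (e (u (q k)))" for k
      using u(2)[of "q k"] by (simp add: \<Phi>_def)
  qed
  then obtain w where w: "w \<in> U" "e w = z" "J w \<le> m - \<phi> z" by auto
  have "z \<in> Z" using closed_sequentially[OF Z _ z] u(1) by (simp add: V_def)
  moreover have "\<phi> (e w) + J w \<le> \<phi> (e v) + J v" if "v \<in> U" "e v \<in> Z" for v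
    using m_le[of v] that w by (simp add: V_def \<Phi>_def)
  ultimately show ?thesis using w by blast
qed

section \<open>Limits of square-integrable functions\<close>

lemma fatou_bound:
  fixes h :: "nat \<Rightarrow> 'a \<Rightarrow> real"
  assumes h: "\<And>k. integrable M (h k)" "\<And>k x. 0 \<le> h k x" "\<And>k. (\<integral>x. h k x \<partial>M) \<le> c k" "c \<longlonglongrightarrow> c0"
    and lim: "AE x in M. (\<lambda>k. h k x) \<longlonglongrightarrow> h' x" and m: "h' \<in> borel_measurable M"
    and nn: "\<And>x. 0 \<le> h' x"
  shows "integrable M h'" "(\<integral>x. h' x \<partial>M) \<le> c0"
proof -
  have I0: "0 \<le> (\<integral>x. h k x \<partial>M)" for k using h(2) by simp
  have c0: "0 \<le> c0" by (rule LIMSEQ_le_const[OF h(4)]) (use order_trans[OF I0 h(3)] in blast)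
  have "(\<integral>\<^sup>+x. ennreal (h' x) \<partial>M) = (\<integral>\<^sup>+x. liminf (\<lambda>k. ennreal (h k x)) \<partial>M)"
  proof (rule nn_integral_cong_AE, use lim in eventually_elim)
    fix x assume "(\<lambda>k. h k x) \<longlonglongrightarrow> h' x"
    then have "(\<lambda>k. ennreal (h k x)) \<longlonglongrightarrow> ennreal (h' x)" by (rule tendsto_ennrealI)
    then show "ennreal (h' x) = liminf (\<lambda>k. ennreal (h k x))"
      by (rule lim_imp_Liminf[OF trivial_limit_sequentially, symmetric])
  qed
  also have "\<dots> \<le> liminf (\<lambda>k. \<integral>\<^sup>+x. ennreal (h k x) \<partial>M)"
    by (rule nn_integral_liminf) (use h(1) in measurable)
  also have "\<dots> = liminf (\<lambda>k. ennreal (\<integral>x. h k x \<partial>M))"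
    using nn_integral_eq_integral[OF h(1)] h(2) by simp
  also have "\<dots> \<le> liminf (\<lambda>k. ennreal (c k))"
    by (rule Liminf_mono) (auto intro: always_eventually ennreal_leI h(3))
  also have "\<dots> = ennreal c0"
    by (rule lim_imp_Liminf[OF trivial_limit_sequentially tendsto_ennrealI[OF h(4)]])
  finally have le: "(\<integral>\<^sup>+x. ennreal (h' x) \<partial>M) \<le> ennreal c0" .
  have "(\<integral>\<^sup>+x. ennreal (h' x) \<partial>M) < \<infinity>"
    unfolding infinity_ennreal_def by (rule le_less_trans[OF le ennreal_less_top])
  then show i: "integrable M h'" using m nn by (intro integrableI_nonneg) auto
  show "(\<integral>x. h' x \<partial>M) \<le> c0"
    using le c0 nn_integral_eq_integral[OF i] nn by simp
qed

lemma L2_integrable_norm2: "x \<in> L2 T \<Longrightarrow> integrable (interval_measure T) (\<lambda>t. (norm (x t))\<^sup>2)"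
  by (simp add: L2_def)

lemma L2_norm_power2: "(L2_norm T x)\<^sup>2 = (\<integral>t. (norm (x t))\<^sup>2 \<partial>interval_measure T)"
  by (simp add: L2_norm_def)

text \<open>The variance of \<open>norm (w t)\<close> over the interval is nonnegative;
  \<open>I / T\<close> is the mean.\<close>

lemma L2_Cauchy_Schwarz:
  fixes w :: "real \<Rightarrow> real^'n"
  assumes w: "w \<in> L2 T" and T: "0 < T"
  shows "(\<integral>t. norm (w t) \<partial>interval_measure T) \<le> sqrt (T * (\<integral>t. (norm (w t))\<^sup>2 \<partial>interval_measure T))"
proof -
  let ?L = "interval_measure T"
  interpret L: finite_measure ?L by (rule finite_measure_interval)
  define I where "I = (\<integral>t. norm (w t) \<partial>?L)"
  have i: "integrable ?L (\<lambda>t. norm (w t))" "integrable ?L (\<lambda>t. (norm (w t))\<^sup>2)"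
    using L2_integrable[OF w] L2_integrable_norm2[OF w] by auto
  have m: "measure ?L {0<..<T} = T" using T by (simp add: measure_restrict_space)
  have "0 \<le> (\<integral>t. (norm (w t) - I / T)\<^sup>2 \<partial>?L)" by simp
  also have "\<dots> = (\<integral>t. (norm (w t))\<^sup>2 - 2 * (I / T) * norm (w t) + (I / T)\<^sup>2 \<partial>?L)"
    by (simp add: power2_diff algebra_simps)
  also have "\<dots> = (\<integral>t. (norm (w t))\<^sup>2 \<partial>?L) - 2 * (I / T) * I + (I / T)\<^sup>2 * T"
    using i m by (simp add: I_def)
  also have "\<dots> = (\<integral>t. (norm (w t))\<^sup>2 \<partial>?L) - I\<^sup>2 / T"
    using T by (simp add: power2_eq_square field_simps)
  finally have "I\<^sup>2 \<le> T * (\<integral>t. (norm (w t))\<^sup>2 \<partial>?L)" using T by (simp add: field_simps)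
  then show ?thesis unfolding I_def[symmetric] by (rule real_le_rsqrt)
qed

text \<open>Riesz-Fischer: along a fast subsequence the L1 norms of successive differences are
  summable. Convergence almost everywhere serves the path constraint and Fatou's lemma, convergence
  in L1 the trajectories.\<close>

lemma L2_complete:
  fixes u :: "nat \<Rightarrow> real \<Rightarrow> real^'n"
  assumes u: "\<And>k. u k \<in> L2 T" and T: "0 < T"
    and cauchy: "\<And>\<eta>. 0 < \<eta> \<Longrightarrow> \<exists>N. \<forall>j\<ge>N. \<forall>k\<ge>N. (\<integral>t. (norm (u j t - u k t))\<^sup>2 \<partial>interval_measure T) < \<eta>"
  shows "\<exists>w r. w \<in> L2 T \<and> strict_mono (r :: nat \<Rightarrow> nat) \<and> (AE t in interval_measure T. (\<lambda>k. u (r k) t) \<longlonglongrightarrow> w t) \<and>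
    (\<lambda>k. \<integral>t. norm (u (r k) t - w t) \<partial>interval_measure T) \<longlonglongrightarrow> 0"
proof -
  let ?L = "interval_measure T"
  have "\<exists>N. \<forall>j\<ge>N. \<forall>k\<ge>N. (\<integral>t. (norm (u j t - u k t))\<^sup>2 \<partial>?L) < (1/4)^n" for n :: nat
    by (rule cauchy) simp
  then obtain N where N: "\<And>n j k. N n \<le> j \<Longrightarrow> N n \<le> k \<Longrightarrow> (\<integral>t. (norm (u j t - u k t))\<^sup>2 \<partial>?L) < (1/4)^n"
    by metis
  \<comment> \<open>The summand \<open>n\<close> secures strict monotonicity, the sum dominates
    every \<open>N i\<close> with \<open>i \<le> n\<close>.\<close>
  define r where "r = (\<lambda>n. n + (\<Sum>i\<le>n. N i))"
  have r: "strict_mono r" by (rule strict_monoI_Suc) (simp add: r_def)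
  have rN: "N n \<le> r j" if "n \<le> j" for n j
  proof -
    have "N n \<le> (\<Sum>i\<le>j. N i)" using that by (intro member_le_sum) auto
    then show ?thesis by (simp add: r_def)
  qed
  define v where "v = (\<lambda>n. u (r n))"
  have vL: "v n \<in> L2 T" for n by (simp add: v_def u)
  have vd: "(\<lambda>t. v j t - v k t) \<in> L2 T" for j k by (intro L2_diff vL)
  have d: "(\<integral>t. (norm (v j t - v k t))\<^sup>2 \<partial>?L) \<le> (1/4)^n" if "n \<le> j" "n \<le> k" for n j k
    unfolding v_def using N[OF rN[OF that(1)] rN[OF that(2)]] by simp
  have sq: "sqrt (T * x) \<le> sqrt T * (1/2)^n" if "x \<le> (1/4)^n" for x and n :: nat
  proof -
    have "sqrt (T * x) \<le> sqrt (T * (1/4)^n)" using that T by simp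
    also have "\<dots> = sqrt T * (sqrt (1/4))^n" by (simp add: real_sqrt_mult real_sqrt_power)
    also have "sqrt (1/4) = 1/2" by (rule real_sqrt_unique) (simp_all add: power2_eq_square)
    finally show ?thesis .
  qed
  define a where "a = (\<lambda>n. \<integral>t. norm (v (Suc n) t - v n t) \<partial>?L)"
  have a: "a n \<le> sqrt T * (1/2)^n" "0 \<le> a n" for n
    unfolding a_def using L2_Cauchy_Schwarz[OF vd[of "Suc n" n] T] sq[OF d[of n "Suc n" n]] by auto
  have "summable (\<lambda>n. sqrt T * (1/2)^n)" by (intro summable_mult summable_geometric) simp
  then have suma: "summable a" by (rule summable_comparison_test') (use a in auto)
  have [measurable]: "v n \<in> borel_measurable ?L" for n using vL[of n] by (simp add: L2_def)
  have "(\<integral>\<^sup>+t. (\<Sum>n. ennreal (norm (v (Suc n) t - v n t))) \<partial>?L) = (\<Sum>n. \<integral>\<^sup>+t. ennreal (norm (v (Suc n) t - v n t)) \<partial>?L)"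
    by (rule nn_integral_suminf) measurable
  also have "\<dots> = (\<Sum>n. ennreal (a n))"
    unfolding a_def using L2_integrable[OF vd] by (intro suminf_cong nn_integral_eq_integral) auto
  also have "\<dots> \<noteq> \<infinity>" using ennreal_suminf_neq_top[OF suma a(2)] by simp
  finally have "AE t in ?L. (\<Sum>n. ennreal (norm (v (Suc n) t - v n t))) \<noteq> \<infinity>"
    by (intro nn_integral_PInf_AE) measurable
  then have conv: "AE t in ?L. convergent (\<lambda>n. v n t)"
  proof eventually_elim
    case (elim t)
    have "summable (\<lambda>n. norm (v (Suc n) t - v n t))"
      using elim by (intro summable_suminf_not_top) auto
    then have "summable (\<lambda>n. v (Suc n) t - v n t)" by (rule summable_norm_cancel)
    moreover have "(\<Sum>i<n. v (Suc i) t - v i t) = v n t - v 0 t" for n by (induction n) auto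
    ultimately have "(\<lambda>n. v n t - v 0 t) \<longlonglongrightarrow> (\<Sum>n. v (Suc n) t - v n t)"
      using summable_LIMSEQ[of "\<lambda>n. v (Suc n) t - v n t"] by simp
    from tendsto_add[OF this tendsto_const[of "v 0 t"]] show ?case by (auto simp: convergent_def)
  qed
  define w where "w = (\<lambda>t. lim (\<lambda>n. v n t))"
  have w[measurable]: "w \<in> borel_measurable ?L" unfolding w_def by measurable
  have lim: "AE t in ?L. (\<lambda>n. v n t) \<longlonglongrightarrow> w t"
    using conv by eventually_elim (simp add: w_def convergent_LIMSEQ_iff)
  \<comment> \<open>With the second index tending to infinity, Fatou's lemma turns the Cauchy
    estimate into one for the distance to \<open>w\<close>; this also makes \<open>w\<close>
    square-integrable.\<close>
  have vw: "integrable ?L (\<lambda>t. (norm (v n t - w t))\<^sup>2) \<and> (\<integral>t. (norm (v n t - w t))\<^sup>2 \<partial>?L) \<le> (1/4)^n" for n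
  proof -
    have "AE t in ?L. (\<lambda>j. (norm (v n t - v (n + j) t))\<^sup>2) \<longlonglongrightarrow> (norm (v n t - w t))\<^sup>2"
      using lim
    proof eventually_elim
      case (elim t)
      from LIMSEQ_ignore_initial_segment[OF this, of n]
      have "(\<lambda>j. v (n + j) t) \<longlonglongrightarrow> w t" by (simp add: add.commute)
      then show ?case by (intro tendsto_intros)
    qed
    moreover have "integrable ?L (\<lambda>t. (norm (v n t - v (n + j) t))\<^sup>2)" for j
      by (rule L2_integrable_norm2[OF vd])
    moreover have "(\<integral>t. (norm (v n t - v (n + j) t))\<^sup>2 \<partial>?L) \<le> (1/4)^n" for j by (rule d) auto
    ultimately show ?thesis
      using fatou_bound[of ?L "\<lambda>j t. (norm (v n t - v (n + j) t))\<^sup>2" "\<lambda>_. (1/4)^n" "(1/4)^n" "\<lambda>t. (norm (v n t - w t))\<^sup>2"]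
      by simp
  qed
  have vwL: "(\<lambda>t. v n t - w t) \<in> L2 T" for n using vw by (simp add: L2_def)
  have "w \<in> L2 T" using L2_diff[OF vL[of 0] vwL[of 0]] by simp
  moreover have "(\<lambda>k. \<integral>t. norm (v k t - w t) \<partial>?L) \<longlonglongrightarrow> 0"
  proof (rule tendsto_0_le[where K = "sqrt T"])
    show "(\<lambda>n. (1/2::real)^n) \<longlonglongrightarrow> 0" by (rule LIMSEQ_power_zero) simp
    show "\<forall>\<^sub>F n in sequentially. norm (\<integral>t. norm (v n t - w t) \<partial>?L) \<le> norm ((1/2::real)^n) * sqrt T"
    proof (rule always_eventually, rule allI)
      fix n
      have "(\<integral>t. norm (v n t - w t) \<partial>?L) \<le> sqrt T * (1/2)^n"
        using L2_Cauchy_Schwarz[OF vwL T] sq vw order_trans by blast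
      then show "norm (\<integral>t. norm (v n t - w t) \<partial>?L) \<le> norm ((1/2::real)^n) * sqrt T"
        by (simp add: mult.commute)
    qed
  qed
  ultimately show ?thesis using r lim unfolding v_def by blast
qed

section \<open>Trajectories as functions of the control, and the optimal control problem\<close>

lemma primitive_diff:
  fixes v w :: "real \<Rightarrow> 'a::{banach,second_countable_topology}"
  assumes "integrable (interval_measure T) v" "integrable (interval_measure T) w"
  shows "primitive T v t - primitive T w t = primitive T (\<lambda>s. v s - w s) t"
  unfolding primitive_def Bochner_Integration.integral_diff[OF integrable_cut[OF assms(1)] integrable_cut[OF assms(2)], symmetric]
  by (rule Bochner_Integration.integral_cong) auto

lemma norm_primitive_le:
  assumes "integrable (interval_measure T) v"
  shows "norm (primitive T v t) \<le> (\<integral>s. norm (v s) \<partial>interval_measure T)"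
proof -
  have "norm (primitive T v t) \<le> (\<integral>s. norm (if s \<le> t then v s else 0) \<partial>interval_measure T)"
    unfolding primitive_def by (rule integral_norm_bound)
  also have "\<dots> \<le> (\<integral>s. norm (v s) \<partial>interval_measure T)"
    by (intro integral_mono integrable_norm integrable_cut assms) auto
  finally show ?thesis .
qed

text \<open>The control enters only under the integral of the variation of constants formula, so the
  L1 distance of controls bounds that of states uniformly in time.\<close>

lemma traj_diff_bound:
  fixes X :: "real^'n^'n" and B :: "real^'m^'n"
  shows "\<exists>b\<ge>0. \<forall>u\<in>L2 T. \<forall>u'\<in>L2 T. \<forall>t\<in>{0..T}.
    norm (traj T X a (\<lambda>s. B *v u s) t - traj T X a (\<lambda>s. B *v u' s) t) \<le> b * (\<integral>s. norm (u s - u' s) \<partial>interval_measure T)"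
proof -
  let ?L = "interval_measure T"
  have "continuous_on {0..T} (mexp X)" by (intro continuous_intros)
  from matrix_function_bound[OF this]
  obtain b1 where b1: "0 \<le> b1" "\<forall>t\<in>{0..T}. \<forall>v. norm (mexp X t *v v) \<le> b1 * norm v" by blast
  have "continuous_on {0..T} (\<lambda>t. mexp X (- t) ** B)" by (intro continuous_intros)
  from matrix_function_bound[OF this]
  obtain b2 where b2: "0 \<le> b2" "\<forall>t\<in>{0..T}. \<forall>v. norm ((mexp X (- t) ** B) *v v) \<le> b2 * norm v" by blast
  have "norm (traj T X a (\<lambda>s. B *v u s) t - traj T X a (\<lambda>s. B *v u' s) t) \<le> (b1 * b2) * (\<integral>s. norm (u s - u' s) \<partial>?L)"
    if u: "u \<in> L2 T" "u' \<in> L2 T" and t: "t \<in> {0..T}" for u u' t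
  proof -
    have BL: "(\<lambda>s. mexp X (- s) *v (B *v u s)) \<in> L2 T" if "u \<in> L2 T" for u
      by (intro L2_mexp L2_matrix_mult that continuous_intros)
    have i: "integrable ?L (\<lambda>s. mexp X (- s) *v (B *v u s))" if "u \<in> L2 T" for u
      by (rule L2_integrable[OF BL[OF that]])
    have du: "(\<lambda>s. u s - u' s) \<in> L2 T" by (intro L2_diff u)
    have "traj T X a (\<lambda>s. B *v u s) t - traj T X a (\<lambda>s. B *v u' s) t
        = mexp X t *v primitive T (\<lambda>s. mexp X (- s) *v (B *v (u s - u' s))) t"
      unfolding traj_def matrix_vector_mult_diff_distrib[symmetric]
      using primitive_diff[OF i[OF u(1)] i[OF u(2)], of t] by (simp add: matrix_vector_mult_diff_distrib)
    also have "norm \<dots> \<le> b1 * norm (primitive T (\<lambda>s. mexp X (- s) *v (B *v (u s - u' s))) t)" using b1(2) t by blast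
    also have "\<dots> \<le> b1 * (\<integral>s. norm (mexp X (- s) *v (B *v (u s - u' s))) \<partial>?L)"
      by (intro mult_left_mono norm_primitive_le i du b1)
    also have "\<dots> \<le> b1 * (\<integral>s. b2 * norm (u s - u' s) \<partial>?L)"
    proof (intro mult_left_mono integral_mono b1(1))
      show "integrable ?L (\<lambda>s. norm (mexp X (- s) *v (B *v (u s - u' s))))" by (intro integrable_norm i du)
      show "integrable ?L (\<lambda>s. b2 * norm (u s - u' s))" using L2_integrable[OF du] by simp
      show "norm (mexp X (- s) *v (B *v (u s - u' s))) \<le> b2 * norm (u s - u' s)" if "s \<in> space ?L" for s
      proof -
        have "s \<in> {0..T}" using that by auto
        then show ?thesis using b2(2) unfolding matrix_vector_mul_assoc by blast
      qed
    qed
    finally show ?thesis by simp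
  qed
  then show ?thesis using b1(1) b2(1) by (intro exI[of _ "b1 * b2"]) simp
qed

lemma traj_mid:
  fixes X :: "real^'n^'n" and B :: "real^'m^'n"
  assumes u: "u \<in> L2 T" "v \<in> L2 T"
  shows "traj T X a (\<lambda>s. B *v ((1/2) *\<^sub>R (u s + v s))) t
    = (1/2) *\<^sub>R (traj T X a (\<lambda>s. B *v u s) t + traj T X a (\<lambda>s. B *v v s) t)"
proof -
  let ?p = "\<lambda>u. primitive T (\<lambda>s. mexp X (- s) *v (B *v u s)) t"
  have i: "integrable (interval_measure T) (\<lambda>s. mexp X (- s) *v (B *v u s))" if "u \<in> L2 T" for u
    by (intro L2_integrable L2_mexp L2_matrix_mult that continuous_intros)
  have "?p (\<lambda>s. (1/2) *\<^sub>R (u s + v s)) = (1/2) *\<^sub>R (?p u + ?p v)"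
    unfolding primitive_def Bochner_Integration.integral_add[OF integrable_cut[OF i[OF u(1)]] integrable_cut[OF i[OF u(2)]], symmetric]
      integral_scaleR_right[symmetric]
    by (rule Bochner_Integration.integral_cong) (auto simp: matrix_vector_mult_scaleR matrix_vector_right_distrib)
  moreover have "a = (1/2) *\<^sub>R (a + a)" by (simp add: scaleR_2[symmetric])
  ultimately have eq: "a + ?p (\<lambda>s. (1/2) *\<^sub>R (u s + v s)) = (1/2) *\<^sub>R ((a + ?p u) + (a + ?p v))"
    by (metis (no_types, lifting) add.assoc add.left_commute scaleR_add_right)
  show ?thesis
    unfolding traj_def eq
    by (simp only: matrix_vector_mult_scaleR matrix_vector_right_distrib[of "mexp X t" "a + ?p u" "a + ?p v"])
qed

text \<open>The parallelogram identity at half scale; the subtracted term is the gain that makes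
  near-minimizers cluster.\<close>

lemma norm_half_add_power2:
  "(norm ((1/2) *\<^sub>R (a + b)))\<^sup>2 = (norm a)\<^sup>2 / 2 + (norm b)\<^sup>2 / 2 - (norm (a - b))\<^sup>2 / 4"
  for a b :: "'a::real_inner"
proof -
  have "(norm ((1/2) *\<^sub>R (a + b)))\<^sup>2 = (norm (a + b))\<^sup>2 / 4"
    by (simp add: power_divide)
  also have "(norm (a + b))\<^sup>2 = 2 * (norm a)\<^sup>2 + 2 * (norm b)\<^sup>2 - (norm (a - b))\<^sup>2"
    by (simp add: power2_norm_eq_inner inner_add_left inner_add_right inner_diff_left inner_diff_right inner_commute)
  finally show ?thesis by simp
qed

text \<open>\<open>S u\<close> is affine in \<open>u\<close>, so \<open>U\<close> is closed under
  midpoints and \<open>J\<close> is strongly convex, whereas \<phi> and \<open>Z\<close> may be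
  nonconvex because they see only the terminal state.\<close>

lemma linear_quadratic_minimizer_exists:
  fixes A :: "real^'n^'n" and B :: "real^'m^'n" and C :: "real^'n^'l" and D :: "real^'m^'l"
    and f :: "real \<Rightarrow> real^'l" and \<phi> :: "real^'n \<Rightarrow> real" and x0 :: "real^'n" and T \<delta> :: real
    and xd :: "real \<Rightarrow> real^'n" and ud :: "real \<Rightarrow> real^'m"
  defines "S \<equiv> \<lambda>u. traj T A x0 (\<lambda>t. B *v u t)"
  defines "U \<equiv> {u \<in> L2 T. AE t in interval_measure T. C *v S u t + D *v u t - f t \<le> 0}"
  defines "J \<equiv> \<lambda>u. 1 / 2 * (L2_norm T (\<lambda>t. S u t - xd t))\<^sup>2 + \<delta> / 2 * (L2_norm T (\<lambda>t. u t - ud t))\<^sup>2"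
  assumes T: "0 < T" and \<delta>: "0 < \<delta>" and xd: "xd \<in> L2 T" and ud: "ud \<in> L2 T"
    and \<phi>: "continuous_on UNIV \<phi>" "\<And>z. - a - b * norm z \<le> \<phi> z" "0 \<le> b"
    and Z: "closed Z" and ne: "u0 \<in> U" "S u0 T \<in> Z"
  shows "\<exists>u\<in>U. S u T \<in> Z \<and> (\<forall>v\<in>U. S v T \<in> Z \<longrightarrow> \<phi> (S u T) + J u \<le> \<phi> (S v T) + J v)"
proof -
  let ?L = "interval_measure T"
  have UL: "u \<in> L2 T" if "u \<in> U" for u using that by (simp add: U_def)
  have BL: "(\<lambda>t. B *v u t) \<in> L2 T" if "u \<in> L2 T" for u by (intro L2_matrix_mult that continuous_intros)
  have SL: "S u \<in> L2 T" if "u \<in> L2 T" for u unfolding S_def by (intro L2_traj BL that)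
  have J_eq: "J u = (\<integral>t. 1 / 2 * (norm (S u t - xd t))\<^sup>2 + \<delta> / 2 * (norm (u t - ud t))\<^sup>2 \<partial>?L)"
    and J_int: "integrable ?L (\<lambda>t. 1 / 2 * (norm (S u t - xd t))\<^sup>2 + \<delta> / 2 * (norm (u t - ud t))\<^sup>2)" if "u \<in> L2 T" for u
    using L2_integrable_norm2[OF L2_diff[OF SL[OF that] xd]] L2_integrable_norm2[OF L2_diff[OF that ud]]
    by (simp_all add: J_def L2_norm_power2)
  define d where "d = (\<lambda>u v :: real \<Rightarrow> real^'m. \<integral>t. (norm (u t - v t))\<^sup>2 \<partial>?L)"
  define mid where "mid = (\<lambda>(u :: real \<Rightarrow> real^'m) v t. (1/2) *\<^sub>R (u t + v t))"
  have Smid: "S (mid u v) t = (1/2) *\<^sub>R (S u t + S v t)" if "u \<in> L2 T" "v \<in> L2 T" for u v t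
    unfolding S_def mid_def by (rule traj_mid[OF that])
  have midL: "mid u v \<in> L2 T" if "u \<in> L2 T" "v \<in> L2 T" for u v
    unfolding mid_def by (intro L2_scaleR L2_add that)
  obtain K where K: "0 \<le> K" "\<forall>u\<in>L2 T. \<forall>u'\<in>L2 T. \<forall>t\<in>{0..T}. norm (S u t - S u' t) \<le> K * (\<integral>s. norm (u s - u' s) \<partial>?L)"
    using traj_diff_bound[of T A x0 B] unfolding S_def by blast
  have J0: "0 \<le> J u" for u using \<delta> by (simp add: J_def)
  show ?thesis
  proof (rule coercive_minimizer_exists[of U J "\<lambda>u. S u T" "norm (S ud T)" "K * sqrt (2 * T / \<delta>)" \<phi> a b Z u0])
    \<comment> \<open>The terminal state moves by at most \<open>K\<close> times the L1 distance of
      the controls, which is at most \<open>sqrt (T * d u ud)\<close>, and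
      \<open>d u ud \<le> 2 / \<delta> * J u\<close>.\<close>
    show "norm (S u T) \<le> norm (S ud T) + K * sqrt (2 * T / \<delta>) * sqrt (J u)" if "u \<in> U" for u
    proof -
      have u: "u \<in> L2 T" using that by (rule UL)
      have "norm (S u T) \<le> norm (S ud T) + norm (S u T - S ud T)" by (metis add.commute diff_add_cancel norm_triangle_ineq)
      also have "norm (S u T - S ud T) \<le> K * (\<integral>s. norm (u s - ud s) \<partial>?L)" using K(2) u ud T by simp
      also have "\<dots> \<le> K * sqrt (T * d u ud)"
        unfolding d_def by (intro mult_left_mono L2_Cauchy_Schwarz L2_diff u ud T K)
      also have "\<dots> \<le> K * sqrt (2 * T / \<delta> * J u)"
      proof (intro mult_left_mono K real_sqrt_le_mono)
        have "\<delta> / 2 * d u ud \<le> J u" by (simp add: J_def L2_norm_power2 d_def)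
        then have "2 * T / \<delta> * (\<delta> / 2 * d u ud) \<le> 2 * T / \<delta> * J u" using T \<delta> by (intro mult_left_mono) auto
        then show "T * d u ud \<le> 2 * T / \<delta> * J u" using \<delta> by simp
      qed
      also have "sqrt (2 * T / \<delta> * J u) = sqrt (2 * T / \<delta>) * sqrt (J u)" by (rule real_sqrt_mult)
      finally show ?thesis by (simp only: mult.assoc)
    qed
    fix us z c c0 assume usU: "\<And>k. us k \<in> U" and usz: "(\<lambda>k. S (us k) T) \<longlonglongrightarrow> z"
      and usc: "\<And>k. J (us k) \<le> c k" "c \<longlonglongrightarrow> c0"
    show "\<exists>u\<in>U. S u T = z \<and> J u \<le> c0"
    proof (rule lower_semicontinuous_by_midpoints[of U J mid "\<lambda>u. S u T" "\<delta> / 8" d c0 us z c])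
      fix u v assume uv: "u \<in> U" "v \<in> U"
      note l = UL[OF uv(1)] UL[OF uv(2)]
      show "S (mid u v) T = (1/2) *\<^sub>R (S u T + S v T)" by (rule Smid[OF l])
      have "AE t in ?L. C *v S (mid u v) t + D *v mid u v t - f t \<le> 0"
      proof -
        have "AE t in ?L. C *v S u t + D *v u t - f t \<le> 0" "AE t in ?L. C *v S v t + D *v v t - f t \<le> 0"
          using uv by (auto simp: U_def)
        then show ?thesis
        proof eventually_elim
          case (elim t)
          have "C *v S (mid u v) t + D *v mid u v t - f t
              = (1/2) *\<^sub>R ((C *v S u t + D *v u t - f t) + (C *v S v t + D *v v t - f t))"
            unfolding Smid[OF l] mid_def[THEN fun_cong, THEN fun_cong, THEN fun_cong, of u v t]
            by (simp add: vec_eq_iff matrix_vector_mult_scaleR matrix_vector_right_distrib field_simps)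
          also have "\<dots> \<le> 0" by (intro scaleR_nonneg_nonpos add_nonpos_nonpos elim) simp
          finally show ?case .
        qed
      qed
      then show "mid u v \<in> U" using midL[OF l] by (simp add: U_def)
      \<comment> \<open>The tracking term is used only through its convexity. The control term has
        weight \<delta>/2 and gains a quarter of the squared distance, which gives
        \<delta>/8.\<close>
      show "J (mid u v) \<le> J u / 2 + J v / 2 - \<delta> / 8 * d u v"
      proof -
        let ?j = "\<lambda>u t. 1 / 2 * (norm (S u t - xd t))\<^sup>2 + \<delta> / 2 * (norm (u t - ud t))\<^sup>2"
        have i: "integrable ?L (\<lambda>t. (norm (u t - v t))\<^sup>2)" by (intro L2_integrable_norm2 L2_diff l)
        have "J (mid u v) \<le> (\<integral>t. ?j u t / 2 + ?j v t / 2 - \<delta> / 8 * (norm (u t - v t))\<^sup>2 \<partial>?L)"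
          unfolding J_eq[OF midL[OF l]]
        proof (rule integral_mono[OF J_int[OF midL[OF l]]])
          show "integrable ?L (\<lambda>t. ?j u t / 2 + ?j v t / 2 - \<delta> / 8 * (norm (u t - v t))\<^sup>2)"
            using J_int[OF l(1)] J_int[OF l(2)] i by simp
          fix t
          have "S (mid u v) t - xd t = (1/2) *\<^sub>R ((S u t - xd t) + (S v t - xd t))"
            by (simp add: Smid[OF l] vec_eq_iff field_simps)
          then have 1: "(norm (S (mid u v) t - xd t))\<^sup>2 \<le> (norm (S u t - xd t))\<^sup>2 / 2 + (norm (S v t - xd t))\<^sup>2 / 2"
            by (simp only: norm_half_add_power2) simp
          have "mid u v t - ud t = (1/2) *\<^sub>R ((u t - ud t) + (v t - ud t))"
            by (simp add: mid_def vec_eq_iff field_simps)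
          then have 2: "(norm (mid u v t - ud t))\<^sup>2 = (norm (u t - ud t))\<^sup>2 / 2 + (norm (v t - ud t))\<^sup>2 / 2 - (norm (u t - v t))\<^sup>2 / 4"
            by (simp only: norm_half_add_power2) simp
          show "?j (mid u v) t \<le> ?j u t / 2 + ?j v t / 2 - \<delta> / 8 * (norm (u t - v t))\<^sup>2"
            unfolding 2 using 1 by (simp add: field_simps)
        qed
        also have "\<dots> = J u / 2 + J v / 2 - \<delta> / 8 * d u v"
          using J_int[OF l(1)] J_int[OF l(2)] i by (simp add: J_eq[OF l(1)] J_eq[OF l(2)] d_def)
        finally show ?thesis .
      qed
    next
      fix u z c assume uU: "\<And>k. u k \<in> U" and cauchy: "\<And>\<eta>. 0 < \<eta> \<Longrightarrow> \<exists>N. \<forall>j\<ge>N. \<forall>k\<ge>N. d (u j) (u k) < \<eta>"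
        and z: "(\<lambda>k. S (u k) T) \<longlonglongrightarrow> z" and c: "\<And>k. J (u k) \<le> c k" "c \<longlonglongrightarrow> c0"
      note ul = UL[OF uU]
      from L2_complete[OF ul T cauchy[unfolded d_def]] obtain w r where w: "w \<in> L2 T" and r: "strict_mono (r :: nat \<Rightarrow> nat)"
        and wlim: "AE t in ?L. (\<lambda>k. u (r k) t) \<longlonglongrightarrow> w t"
        and w1: "(\<lambda>k. \<integral>t. norm (u (r k) t - w t) \<partial>?L) \<longlonglongrightarrow> 0" by blast
      have Slim: "(\<lambda>k. S (u (r k)) t) \<longlonglongrightarrow> S w t" if t: "t \<in> {0..T}" for t
      proof (rule LIM_zero_cancel, rule tendsto_0_le[OF w1, of _ K])
        have "norm (S (u (r k)) t - S w t) \<le> norm (\<integral>t. norm (u (r k) t - w t) \<partial>?L) * K" for k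
        proof -
          have "norm (S (u (r k)) t - S w t) \<le> K * (\<integral>t. norm (u (r k) t - w t) \<partial>?L)" using K(2) ul w t by blast
          then show ?thesis by (simp add: mult.commute)
        qed
        then show "\<forall>\<^sub>F k in sequentially. norm (S (u (r k)) t - S w t) \<le> norm (\<integral>t. norm (u (r k) t - w t) \<partial>?L) * K"
          by simp
      qed
      have tI: "AE t in ?L. t \<in> {0..T}" by (intro AE_I2) auto
      have "AE t in ?L. \<forall>k. C *v S (u (r k)) t + D *v u (r k) t - f t \<le> 0"
        using uU by (subst AE_all_countable) (simp add: U_def)
      then have "AE t in ?L. C *v S w t + D *v w t - f t \<le> 0"
        using wlim tI
      proof eventually_elim
        case (elim t)
        have "(\<lambda>k. C *v S (u (r k)) t + D *v u (r k) t - f t) \<longlonglongrightarrow> C *v S w t + D *v w t - f t"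
          by (intro tendsto_intros bounded_linear.tendsto[OF matrix_vector_mul_bounded_linear] Slim elim)
        then have "(\<lambda>k. (C *v S (u (r k)) t + D *v u (r k) t - f t) $ i) \<longlonglongrightarrow> (C *v S w t + D *v w t - f t) $ i" for i
          by (rule tendsto_vec_nth)
        then have "(C *v S w t + D *v w t - f t) $ i \<le> 0" for i
          by (rule LIMSEQ_le_const2) (use elim(1) in \<open>auto simp: less_eq_vec_def\<close>)
        then show ?case by (simp add: less_eq_vec_def)
      qed
      then have wU: "w \<in> U" using w by (simp add: U_def)
      have "(\<lambda>k. S (u (r k)) T) \<longlonglongrightarrow> z" using LIMSEQ_subseq_LIMSEQ[OF z r] by (simp add: comp_def)
      then have Sz: "S w T = z" using LIMSEQ_unique Slim[of T] T by fastforce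
      have "(\<integral>t. 1 / 2 * (norm (S w t - xd t))\<^sup>2 + \<delta> / 2 * (norm (w t - ud t))\<^sup>2 \<partial>?L) \<le> c0"
      proof (rule fatou_bound(2))
        let ?h = "\<lambda>k t. 1 / 2 * (norm (S (u (r k)) t - xd t))\<^sup>2 + \<delta> / 2 * (norm (u (r k) t - ud t))\<^sup>2"
        show "integrable ?L (?h k)" for k by (rule J_int[OF ul])
        show "(\<integral>t. ?h k t \<partial>?L) \<le> (c \<circ> r) k" for k unfolding J_eq[OF ul, symmetric] using c(1) by simp
        show "(c \<circ> r) \<longlonglongrightarrow> c0" by (rule LIMSEQ_subseq_LIMSEQ[OF c(2) r])
        show "AE t in ?L. (\<lambda>k. ?h k t) \<longlonglongrightarrow> 1 / 2 * (norm (S w t - xd t))\<^sup>2 + \<delta> / 2 * (norm (w t - ud t))\<^sup>2"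
          using wlim tI by eventually_elim (intro tendsto_intros Slim, auto)
        show "(\<lambda>t. 1 / 2 * (norm (S w t - xd t))\<^sup>2 + \<delta> / 2 * (norm (w t - ud t))\<^sup>2) \<in> borel_measurable ?L"
          by (rule borel_measurable_integrable[OF J_int[OF w]])
      qed (use \<delta> in auto)
      then have "J w \<le> c0" by (simp only: J_eq[OF w])
      then show "\<exists>u\<in>U. S u T = z \<and> J u \<le> c0" using wU Sz by blast
    qed (use J0 \<delta> usU usz usc in auto)
  qed (use J0 K T \<delta> \<phi> Z ne in auto)
qed

section \<open>The sampled problem\<close>

text \<open>Uniqueness for the linear system: the control determines the state, at every point of
  [0,T] because \<open>H1\<close> fixes the continuous representative.\<close>

lemma admissible_eq_traj:
  fixes A :: "real^'n^'n" and B :: "real^'m^'n" and C :: "real^'n^'l" and D :: "real^'m^'l"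
  assumes T: "0 < T" and x: "x \<in> H1 T" and u: "u \<in> L2 T"
    and w: "\<exists>x'. has_weak_derivative T x x' \<and> (AE t in interval_measure T. x' t = A *v x t + B *v u t)"
    and c: "AE t in interval_measure T. C *v x t + D *v u t - f t \<le> 0"
  shows "\<forall>t\<in>{0..T}. x t = traj T A (x 0) (\<lambda>t. B *v u t) t"
    and "AE t in interval_measure T. C *v traj T A (x 0) (\<lambda>t. B *v u t) t + D *v u t - f t \<le> 0"
proof -
  have B: "(\<lambda>t. B *v u t) \<in> L2 T" by (intro L2_matrix_mult u continuous_intros)
  obtain x' where x': "has_weak_derivative T x x'" "AE t in interval_measure T. x' t = A *v x t + B *v u t"
    using w by blast
  have "x \<in> L2 T" "continuous_on {0..T} x" using x by (simp_all add: H1_def)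
  from solution_eq_traj[OF this x'(1) B x'(2) T]
  show xt: "\<forall>t\<in>{0..T}. x t = traj T A (x 0) (\<lambda>t. B *v u t) t" by blast
  have "AE t in interval_measure T. t \<in> {0..T}" by (intro AE_I2) auto
  then show "AE t in interval_measure T. C *v traj T A (x 0) (\<lambda>t. B *v u t) t + D *v u t - f t \<le> 0"
    using c
  proof eventually_elim
    case (elim t)
    have "x t = traj T A (x 0) (\<lambda>t. B *v u t) t" using xt elim(1) by blast
    from elim(2)[unfolded this] show ?case .
  qed
qed

lemma continuous_on_inf_vec:
  fixes F G :: "'a::topological_space \<Rightarrow> real^'n"
  assumes "continuous_on S F" "continuous_on S G"
  shows "continuous_on S (\<lambda>z. inf (F z) (G z))"
  using assms by (auto simp: continuous_on_def intro!: tendsto_inf)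

text \<open>Here \<open>s\<close> is one fixed sample and \<open>\<kappa> j\<close> a growth
  constant at its j-th point. Feasible pairs correspond to controls in \<open>U\<close> with
  terminal state in \<open>Z\<close>, with equal objectives.\<close>

lemma saa_minimizer_exists:
  fixes A :: "real^'n^'n" and B :: "real^'m^'n" and C :: "real^'n^'l" and D :: "real^'m^'l"
    and g :: "real^'n \<Rightarrow> 's \<Rightarrow> real^'e" and x0 :: "real^'n"
  assumes T: "0 < T" and \<delta>: "0 < \<delta>" and xd: "xd \<in> L2 T" and ud: "ud \<in> L2 T"
    and F: "\<And>j. continuous_on UNIV (\<lambda>z. F z (s j))" "\<And>j z. \<bar>F z (s j) - F 0 (s j)\<bar> \<le> \<kappa> j * norm z"
      "\<And>j. 0 \<le> \<kappa> j"
    and g: "\<And>j. continuous_on UNIV (\<lambda>z. g z (s j))"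
    and feas: "saa_feasible T A B C D f x0 M q g K \<epsilon> \<nu> s y0 w0"
  shows "\<exists>x u. saa_feasible T A B C D f x0 M q g K \<epsilon> \<nu> s x u \<and>
    (\<forall>y v. saa_feasible T A B C D f x0 M q g K \<epsilon> \<nu> s y v \<longrightarrow>
      saa_objective T \<delta> xd ud F \<nu> s x u \<le> saa_objective T \<delta> xd ud F \<nu> s y v)"
proof -
  let ?S = "\<lambda>u. traj T A x0 (\<lambda>t. B *v u t)"
  define U where "U = {u \<in> L2 T. AE t in interval_measure T. C *v ?S u t + D *v u t - f t \<le> 0}"
  define \<phi> where "\<phi> = (\<lambda>z. sample_average \<nu> s (F z))"
  \<comment> \<open>Both terminal constraints in one set, closed because the defining functions are
    continuous, but in general not convex.\<close>
  define Z where "Z = {z. norm (inf z (sample_average \<nu> s (\<lambda>y. M y *v z + q y))) \<le> \<epsilon> \<and>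
      infdist (sample_average \<nu> s (g z)) K \<le> \<epsilon>}"
  define J where "J = (\<lambda>x u. 1 / 2 * (L2_norm T (\<lambda>t. x t - xd t))\<^sup>2 + \<delta> / 2 * (L2_norm T (\<lambda>t. u t - ud t))\<^sup>2)"
  have feasD: "v \<in> U" "\<And>t. t \<in> {0..T} \<Longrightarrow> y t = ?S v t" "?S v T \<in> Z"
    if "saa_feasible T A B C D f x0 M q g K \<epsilon> \<nu> s y v" for y v
  proof -
    have saa: "y \<in> H1 T" "v \<in> L2 T"
      "\<exists>x'. has_weak_derivative T y x' \<and> (AE t in interval_measure T. x' t = A *v y t + B *v v t)"
      "AE t in interval_measure T. C *v y t + D *v v t - f t \<le> 0" "y 0 = x0" "y T \<in> Z"
      using that unfolding saa_feasible_def Z_def by simp_all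
    note 1 = admissible_eq_traj[OF T saa(1-4), unfolded saa(5)]
    show "v \<in> U" using saa(2) 1(2) by (simp add: U_def)
    show "\<And>t. t \<in> {0..T} \<Longrightarrow> y t = ?S v t" using 1(1) by blast
    then have "y T = ?S v T" using T by simp
    then show "?S v T \<in> Z" using saa(6) by simp
  qed
  have feasI: "saa_feasible T A B C D f x0 M q g K \<epsilon> \<nu> s (?S v) v" if "v \<in> U" "?S v T \<in> Z" for v
  proof -
    have v: "v \<in> L2 T" using that by (simp add: U_def)
    have Bv: "(\<lambda>t. B *v v t) \<in> L2 T" by (intro L2_matrix_mult v continuous_intros)
    show ?thesis
      unfolding saa_feasible_def
    proof (intro conjI exI)
      show "has_weak_derivative T (?S v) (\<lambda>t. A *v ?S v t + B *v v t)" by (rule has_weak_derivative_traj[OF Bv T])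
    qed (use that v traj_in_H1[OF Bv T] in \<open>simp_all add: U_def Z_def traj_0\<close>)
  qed
  have obj: "saa_objective T \<delta> xd ud F \<nu> s y v = \<phi> (?S v T) + J (?S v) v"
    if "\<And>t. t \<in> {0..T} \<Longrightarrow> y t = ?S v t" for y v
  proof -
    have "L2_norm T (\<lambda>t. y t - xd t) = L2_norm T (\<lambda>t. ?S v t - xd t)"
      unfolding L2_norm_def using that
      by (intro arg_cong[where f=sqrt] Bochner_Integration.integral_cong) auto
    then show ?thesis using that[of T] T by (simp add: saa_objective_def \<phi>_def J_def)
  qed
  have \<phi>c: "continuous_on UNIV \<phi>"
    unfolding \<phi>_def sample_average_def by (intro continuous_intros F)
  \<comment> \<open>In \<open>sample_average \<nu> \<kappa> id\<close> the constants themselves form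
    the sample, so this is their mean. For \<open>\<nu> = 0\<close> all averages are 0 and the bound
    still holds.\<close>
  have \<phi>b: "- \<bar>\<phi> 0\<bar> - sample_average \<nu> \<kappa> id * norm z \<le> \<phi> z" for z
  proof -
    have "\<phi> 0 - \<phi> z = (1 / real \<nu>) * (\<Sum>j<\<nu>. F 0 (s j) - F z (s j))"
      by (simp add: \<phi>_def sample_average_def sum_subtractf right_diff_distrib)
    also have "\<dots> \<le> (1 / real \<nu>) * (\<Sum>j<\<nu>. \<kappa> j * norm z)"
    proof (intro mult_left_mono sum_mono)
      fix j show "F 0 (s j) - F z (s j) \<le> \<kappa> j * norm z" using F(2)[of z j] by linarith
    qed simp
    also have "\<dots> = sample_average \<nu> \<kappa> id * norm z"
      by (simp add: sample_average_def sum_distrib_right)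
    finally show ?thesis by linarith
  qed
  have "closed Z"
  proof -
    have 1: "continuous_on UNIV (\<lambda>z. norm (inf z (sample_average \<nu> s (\<lambda>y. M y *v z + q y))))"
      unfolding sample_average_def
      by (intro continuous_on_norm continuous_on_inf_vec continuous_intros)
    have 2: "continuous_on UNIV (\<lambda>z. infdist (sample_average \<nu> s (g z)) K)"
      unfolding sample_average_def by (intro continuous_intros g)
    show ?thesis unfolding Z_def by (intro closed_Collect_conj closed_Collect_le 1 2 continuous_intros)
  qed
  moreover have "0 \<le> sample_average \<nu> \<kappa> id" by (simp add: sample_average_def F(3) sum_nonneg)
  ultimately have "\<exists>u\<in>U. ?S u T \<in> Z \<and> (\<forall>v\<in>U. ?S v T \<in> Z \<longrightarrow> \<phi> (?S u T) + J (?S u) u \<le> \<phi> (?S v T) + J (?S v) v)"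
    unfolding J_def
    using linear_quadratic_minimizer_exists[OF T \<delta> xd ud \<phi>c \<phi>b _ _ feasD(1)[OF feas, unfolded U_def] feasD(3)[OF feas]]
    unfolding U_def by blast
  then obtain u where u: "u \<in> U" "?S u T \<in> Z"
    and min: "\<And>v. v \<in> U \<Longrightarrow> ?S v T \<in> Z \<Longrightarrow> \<phi> (?S u T) + J (?S u) u \<le> \<phi> (?S v T) + J (?S v) v" by blast
  have "saa_objective T \<delta> xd ud F \<nu> s (?S u) u \<le> saa_objective T \<delta> xd ud F \<nu> s y v"
    if "saa_feasible T A B C D f x0 M q g K \<epsilon> \<nu> s y v" for y v
    using min[OF feasD(1,3)[OF that]] obj[OF feasD(2)[OF that]] obj[of "?S u" u] by simp
  then show ?thesis using feasI[OF u] by blast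
qed

section \<open>From the law of the parameter to its samples\<close>

lemma measurable_support_space:
  "\<xi> \<in> borel_measurable P \<Longrightarrow> \<xi> \<in> P \<rightarrow>\<^sub>M support_space P \<xi>"
  unfolding support_space_def by (rule measurable_restrict_space2) auto

lemma space_law [simp]: "space (law P \<xi>) = \<xi> ` space P"
  by (simp add: law_def support_space_def space_restrict_space)

lemma sets_law [measurable_cong]: "sets (law P \<xi>) = sets (support_space P \<xi>)"
  by (simp add: law_def)

lemma
  fixes h :: "'a::topological_space \<Rightarrow> 'b::{banach,second_countable_topology}"
  assumes "\<xi> \<in> borel_measurable P" "h \<in> borel_measurable (support_space P \<xi>)"
  shows integral_law: "(\<integral>y. h y \<partial>law P \<xi>) = (\<integral>\<omega>. h (\<xi> \<omega>) \<partial>P)"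
    and integrable_law: "integrable (law P \<xi>) h \<longleftrightarrow> integrable P (\<lambda>\<omega>. h (\<xi> \<omega>))"
proof -
  have \<xi>: "\<xi> \<in> P \<rightarrow>\<^sub>M support_space P \<xi>" by (rule measurable_support_space[OF assms(1)])
  show "(\<integral>y. h y \<partial>law P \<xi>) = (\<integral>\<omega>. h (\<xi> \<omega>) \<partial>P)"
    unfolding law_def by (rule integral_distr[OF \<xi> assms(2)])
  show "integrable (law P \<xi>) h \<longleftrightarrow> integrable P (\<lambda>\<omega>. h (\<xi> \<omega>))"
    unfolding law_def by (rule integrable_distr_eq[OF \<xi> assms(2)])
qed

lemma bounded_linear_matrix_vector_left: "bounded_linear (\<lambda>N. N *v v)" for v :: "real^'n"
  unfolding linear_conv_bounded_linear[symmetric]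
  by (rule linearI) (simp_all add: matrix_vector_mult_add_rdistrib scaleR_matrix_vector_assoc)

text \<open>All sample variables have the distribution of \<xi>, and countably many exceptional null
  sets merge into one.\<close>

lemma AE_iid_sample:
  assumes Q: "prob_space Q" and iid: "iid_sample Q \<xi>s P \<xi>" and ae: "AE y in law P \<xi>. R y"
  shows "AE \<omega> in Q. \<forall>j. R (\<xi>s j \<omega>)"
  unfolding AE_all_countable
proof
  fix j
  interpret prob_space Q by fact
  have m: "\<xi>s j \<in> Q \<rightarrow>\<^sub>M support_space P \<xi>" and d: "distr Q (support_space P \<xi>) (\<xi>s j) = law P \<xi>"
    using iid by (auto simp: iid_sample_def indep_vars_def)
  show "AE \<omega> in Q. R (\<xi>s j \<omega>)" by (rule AE_distrD[OF m]) (unfold d, rule ae)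
qed

lemma sample_average_tendsto:
  fixes h :: "'a::topological_space \<Rightarrow> 'b::euclidean_space"
  assumes Q: "prob_space Q" and iid: "iid_sample Q \<xi>s P \<xi>" and h: "integrable (law P \<xi>) h"
  shows "AE \<omega> in Q. (\<lambda>\<nu>. sample_average \<nu> (\<lambda>j. \<xi>s j \<omega>) h) \<longlonglongrightarrow> (\<integral>y. h y \<partial>law P \<xi>)"
  unfolding sample_average_def
  by (rule strong_law_of_large_numbers[OF Q _ _ h]) (use iid in \<open>auto simp: iid_sample_def\<close>)

text \<open>The exceptional null set may depend on \<open>z\<close>. A countable dense set of states
  leaves a single null set, and off it continuity makes the set of violations open, hence
  empty.\<close>

lemma AE_Lipschitz_at_0:
  fixes F :: "'a::euclidean_space \<Rightarrow> 's \<Rightarrow> real"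
  assumes c: "AE y in M. continuous_on UNIV (\<lambda>z. F z y)"
    and lip: "\<And>z. AE y in M. \<bar>F z y - F 0 y\<bar> \<le> \<kappa> y * norm z"
  shows "AE y in M. \<forall>z. \<bar>F z y - F 0 y\<bar> \<le> \<kappa> y * norm z"
proof -
  obtain E :: "'a set" where E: "countable E" "\<And>X. open X \<Longrightarrow> X \<noteq> {} \<Longrightarrow> \<exists>d\<in>E. d \<in> X"
    using countable_dense_exists by blast
  have "AE y in M. \<forall>z\<in>E. \<bar>F z y - F 0 y\<bar> \<le> \<kappa> y * norm z"
    using lip by (simp add: AE_ball_countable[OF E(1)])
  then show ?thesis using c
  proof eventually_elim
    case (elim y)
    let ?X = "{z. \<kappa> y * norm z < \<bar>F z y - F 0 y\<bar>}"
    have "open ?X" using elim(2) by (intro open_Collect_less continuous_intros)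
    moreover have "\<not> (\<exists>d\<in>E. d \<in> ?X)" using elim(1) by (auto simp: not_less)
    ultimately have "?X = {}" using E(2) by blast
    then have "\<not> \<kappa> y * norm z < \<bar>F z y - F 0 y\<bar>" for z by blast
    then show ?case by (simp add: not_less)
  qed
qed

lemma C1_map_continuous: "C1_map h \<Longrightarrow> continuous_on UNIV h"
  unfolding C1_map_def continuous_on_eq_continuous_at[OF open_UNIV] by (blast intro: has_derivative_continuous)

lemma inf_eq_0_lcp_solution:
  assumes "lcp_solution N p v" shows "inf v (N *v v + p) = 0"
proof -
  have "min (v $ i) ((N *v v + p) $ i) = 0" for i
  proof -
    have "0 \<le> v $ i" "0 \<le> (N *v v + p) $ i" "v $ i = 0 \<or> (N *v v + p) $ i = 0"
      using assms unfolding lcp_solution_def lcp_feasible_def by blast+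
    then show ?thesis unfolding min_def by auto
  qed
  then show ?thesis by (simp add: vec_eq_iff inf_vec_def inf_min)
qed

theorem theorem3p1:
  fixes P :: "'w measure" and \<xi> :: "'w \<Rightarrow> real^'d"
    and Q :: "'v measure" and \<xi>s :: "nat \<Rightarrow> 'v \<Rightarrow> real^'d"
    and T \<delta> :: real
    and A :: "real^'n^'n" and B :: "real^'m^'n" and C :: "real^'n^'l" and D :: "real^'m^'l"
    and Y :: "real^'k^'m"
    and x0 :: "real^'n" and f :: "real \<Rightarrow> real^'l"
    and xd :: "real \<Rightarrow> real^'n" and ud :: "real \<Rightarrow> real^'m"
    and K :: "(real^'e) set"
    and F :: "real^'n \<Rightarrow> real^'d \<Rightarrow> real" and g :: "real^'n \<Rightarrow> real^'d \<Rightarrow> real^'e"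
    and M :: "real^'d \<Rightarrow> real^'n^'n" and q :: "real^'d \<Rightarrow> real^'n"
    and \<kappa>1 \<kappa>2 \<kappa>3 \<kappa>4 :: "real^'d \<Rightarrow> real"
    and \<epsilon> :: real
  assumes "prob_space P" and "\<xi> \<in> borel_measurable P"
    and "prob_space Q" and "iid_sample Q \<xi>s P \<xi>"
    (* data *)
    and "T > 0" and "\<delta> > 0" and "f \<in> L2 T" and "xd \<in> L2 T" and "ud \<in> L2 T"
    and "K \<noteq> {}" and "closed K" and "convex K"
    and "AE y in law P \<xi>. C1_map (\<lambda>z. F z y)"
    and "AE y in law P \<xi>. C1_map (\<lambda>z. g z y)"
    and "\<And>z. F z \<in> borel_measurable (support_space P \<xi>)" and "\<And>z. g z \<in> borel_measurable (support_space P \<xi>)"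
    and "M \<in> borel_measurable (support_space P \<xi>)" and "q \<in> borel_measurable (support_space P \<xi>)"
    (* (a) *)
    and "\<kappa>1 \<in> borel_measurable (support_space P \<xi>)" and "\<kappa>2 \<in> borel_measurable (support_space P \<xi>)"
    and "\<kappa>3 \<in> borel_measurable (support_space P \<xi>)" and "\<kappa>4 \<in> borel_measurable (support_space P \<xi>)"
    and "\<And>y. y \<in> \<xi> ` space P \<Longrightarrow> 0 \<le> \<kappa>1 y \<and> 0 \<le> \<kappa>2 y \<and> 0 \<le> \<kappa>3 y \<and> 0 \<le> \<kappa>4 y"
    and "integrable P (\<lambda>\<omega>. \<kappa>1 (\<xi> \<omega>))" and "integrable P (\<lambda>\<omega>. \<kappa>2 (\<xi> \<omega>))"
    and "integrable P (\<lambda>\<omega>. \<kappa>3 (\<xi> \<omega>))" and "integrable P (\<lambda>\<omega>. \<kappa>4 (\<xi> \<omega>))"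
    and "\<And>z1 z2. AE y in law P \<xi>.
           \<bar>F z1 y - F z2 y\<bar> \<le> \<kappa>1 y * norm (z1 - z2) \<and> norm (g z1 y) \<le> \<kappa>2 y * norm z1"
    and "\<And>y. y \<in> \<xi> ` space P \<Longrightarrow> norm (M y) \<le> \<kappa>3 y \<and> norm (q y) \<le> \<kappa>4 y"
    (* (b) *)
    and "rank D = CARD('l)" and "CARD('l) < CARD('m)"
    and "CARD('k) = CARD('m) - CARD('l)" and "rank Y = CARD('k)" and "D ** Y = 0"
    and "rank (controllability_matrix (A - B ** pseudoinverse D ** C) (B ** Y)) = CARD('n)"
    (* (c) *)
    and "cball 0 (lcp_beta (\<integral>\<omega>. M (\<xi> \<omega>) \<partial>P) * (\<integral>\<omega>. \<kappa>2 (\<xi> \<omega>) \<partial>P)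
                  * vec_norm1 (\<integral>\<omega>. q (\<xi> \<omega>) \<partial>P)) \<subseteq> K"
    (* (d) *)
    and "{v. (\<integral>\<omega>. M (\<xi> \<omega>) *v v + q (\<xi> \<omega>) \<partial>P) \<ge> 0 \<and> v \<ge> 0} \<noteq> {}"
    (* (e) *)
    and "adequate (\<integral>\<omega>. M (\<xi> \<omega>) \<partial>P) \<or> Z_matrix (\<integral>\<omega>. M (\<xi> \<omega>) \<partial>P)"
    (* (f) *)
    and "\<exists>c. \<forall>z. c \<le> (\<integral>\<omega>. F z (\<xi> \<omega>) \<partial>P)"
    and "\<epsilon> > 0"
  shows "AE \<omega> in Q. \<exists>\<nu>0. \<forall>\<nu>\<ge>\<nu>0. \<exists>x u.
           saa_feasible T A B C D f x0 M q g K \<epsilon> \<nu> (\<lambda>j. \<xi>s j \<omega>) x u \<and>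
           (\<forall>y v. saa_feasible T A B C D f x0 M q g K \<epsilon> \<nu> (\<lambda>j. \<xi>s j \<omega>) y v \<longrightarrow>
              saa_objective T \<delta> xd ud F \<nu> (\<lambda>j. \<xi>s j \<omega>) x u
              \<le> saa_objective T \<delta> xd ud F \<nu> (\<lambda>j. \<xi>s j \<omega>) y v)"
proof -
  note prob_P = assms(1) and \<xi> = assms(2) and prob_Q = assms(3) and iid = assms(4)
  interpret P: prob_space P by fact
  let ?\<mu> = "law P \<xi>"
  define N where "N = (\<integral>\<omega>. M (\<xi> \<omega>) \<partial>P)"
  define p where "p = (\<integral>\<omega>. q (\<xi> \<omega>) \<partial>P)"
  have meas: "h \<in> borel_measurable ?\<mu>" if "h \<in> borel_measurable (support_space P \<xi>)" for h :: "real^'d \<Rightarrow> 'z::topological_space"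
    using that measurable_cong_sets[OF sets_law refl] by blast
  have int_\<kappa>: "integrable ?\<mu> \<kappa>2" "integrable ?\<mu> \<kappa>3" "integrable ?\<mu> \<kappa>4"
    using integrable_law[OF \<xi>] assms by auto
  have int_M: "integrable ?\<mu> M"
    by (rule Bochner_Integration.integrable_bound[OF int_\<kappa>(2) meas[OF assms(17)]])
      (rule AE_I2, use assms(29) in force)
  have int_q: "integrable ?\<mu> q"
    by (rule Bochner_Integration.integrable_bound[OF int_\<kappa>(3) meas[OF assms(18)]])
      (rule AE_I2, use assms(29) in force)
  have N_law: "(\<integral>y. M y \<partial>?\<mu>) = N" and p_law: "(\<integral>y. q y \<partial>?\<mu>) = p"
    unfolding N_def p_def by (rule integral_law[OF \<xi> assms(17)], rule integral_law[OF \<xi> assms(18)])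
  have int_Mq: "integrable ?\<mu> (\<lambda>y. M y *v z + q y)" and Mq: "(\<integral>y. M y *v z + q y \<partial>?\<mu>) = N *v z + p" for z
  proof -
    have i: "integrable ?\<mu> (\<lambda>y. M y *v z)"
      by (rule integrable_bounded_linear[OF bounded_linear_matrix_vector_left int_M])
    then show "integrable ?\<mu> (\<lambda>y. M y *v z + q y)" using int_q by (rule Bochner_Integration.integrable_add)
    show "(\<integral>y. M y *v z + q y \<partial>?\<mu>) = N *v z + p"
      using integral_bounded_linear[OF bounded_linear_matrix_vector_left int_M, of z]
      by (simp add: Bochner_Integration.integral_add[OF i int_q] N_law p_law)
  qed
  have Mq_P: "(\<integral>\<omega>. M (\<xi> \<omega>) *v z + q (\<xi> \<omega>) \<partial>P) = N *v z + p" for z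
    using integral_law[OF \<xi>, of "\<lambda>y. M y *v z + q y"] borel_measurable_integrable[OF int_Mq[of z]]
    by (simp add: Mq measurable_cong_sets[OF sets_law refl])
  obtain z0 where "0 \<le> N *v z0 + p" "0 \<le> z0" using assms(37) unfolding Mq_P by blast
  then have "lcp_feasible N p z0" by (simp add: lcp_feasible_def less_eq_vec_def)
  from lcp_solution_bound[OF assms(38)[folded N_def] this]
  obtain v where v: "lcp_solution N p v" "norm v \<le> lcp_beta N * vec_norm1 p" by blast
  have int_g: "integrable ?\<mu> (g v)"
  proof (rule Bochner_Integration.integrable_bound)
    show "integrable ?\<mu> (\<lambda>y. \<kappa>2 y * norm v)" using int_\<kappa>(1) by simp
    \<comment> \<open>Only the growth bound for \<open>g\<close> is wanted here, so both states in
      (a) are set to \<open>v\<close>.\<close>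
    show "AE y in ?\<mu>. norm (g v y) \<le> norm (\<kappa>2 y * norm v)" using assms(28)[of v v] by eventually_elim auto
  qed (rule meas[OF assms(16)])
  have gK: "(\<integral>y. g v y \<partial>?\<mu>) \<in> K"
  proof -
    have "norm (\<integral>y. g v y \<partial>?\<mu>) \<le> (\<integral>y. norm (g v y) \<partial>?\<mu>)" by (rule integral_norm_bound)
    also have "\<dots> \<le> (\<integral>y. \<kappa>2 y * norm v \<partial>?\<mu>)"
      using assms(28)[of v v] int_g int_\<kappa>(1) by (intro integral_mono_AE) (auto elim: eventually_mono)
    also have "\<dots> = (\<integral>y. \<kappa>2 y \<partial>?\<mu>) * norm v" by simp
    also have "\<dots> \<le> (\<integral>y. \<kappa>2 y \<partial>?\<mu>) * (lcp_beta N * vec_norm1 p)"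
      by (intro mult_left_mono v integral_nonneg_AE AE_I2) (use assms(23) in auto)
    also have "(\<integral>y. \<kappa>2 y \<partial>?\<mu>) = (\<integral>\<omega>. \<kappa>2 (\<xi> \<omega>) \<partial>P)" by (rule integral_law[OF \<xi> assms(20)])
    finally show ?thesis using assms(36) unfolding N_def[symmetric] p_def[symmetric]
      by (intro subsetD[OF assms(36)[folded N_def p_def]]) (simp add: mult_ac)
  qed
  have cont_F: "AE y in ?\<mu>. continuous_on UNIV (\<lambda>z. F z y)"
    using assms(13) by eventually_elim (rule C1_map_continuous)
  have cont_g: "AE y in ?\<mu>. continuous_on UNIV (\<lambda>z. g z y)"
    using assms(14) by eventually_elim (rule C1_map_continuous)
  have "AE y in ?\<mu>. \<bar>F z y - F 0 y\<bar> \<le> \<kappa>1 y * norm z" for z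
    using assms(28)[of z 0] by eventually_elim simp
  note lip_F = AE_Lipschitz_at_0[OF cont_F this]
  have \<kappa>1: "AE y in ?\<mu>. 0 \<le> \<kappa>1 y" by (rule AE_I2) (use assms(23) in auto)
  note AE_iid = AE_iid_sample[OF prob_Q iid]
  from AE_iid[OF cont_F] AE_iid[OF cont_g] AE_iid[OF lip_F] AE_iid[OF \<kappa>1]
    sample_average_tendsto[OF prob_Q iid int_Mq[of v]] sample_average_tendsto[OF prob_Q iid int_g]
  show ?thesis
  proof eventually_elim
    case (elim \<omega>)
    let ?s = "\<lambda>j. \<xi>s j \<omega>"
    have "(\<lambda>\<nu>. norm (inf v (sample_average \<nu> ?s (\<lambda>y. M y *v v + q y)))) \<longlonglongrightarrow> norm (inf v (N *v v + p))"
      using elim(5) unfolding Mq by (intro tendsto_norm tendsto_inf tendsto_const)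
    then have "\<forall>\<^sub>F \<nu> in sequentially. norm (inf v (sample_average \<nu> ?s (\<lambda>y. M y *v v + q y))) < \<epsilon>"
      by (rule order_tendstoD(2)) (use inf_eq_0_lcp_solution[OF v(1)] assms(40) in simp)
    moreover have "(\<lambda>\<nu>. infdist (sample_average \<nu> ?s (g v)) K) \<longlonglongrightarrow> infdist (\<integral>y. g v y \<partial>?\<mu>) K"
      by (intro tendsto_infdist elim)
    then have "\<forall>\<^sub>F \<nu> in sequentially. infdist (sample_average \<nu> ?s (g v)) K < \<epsilon>"
      by (rule order_tendstoD(2)) (use gK assms(40) in simp)
    ultimately have "\<forall>\<^sub>F \<nu> in sequentially. \<exists>x u. saa_feasible T A B C D f x0 M q g K \<epsilon> \<nu> ?s x u"
    proof eventually_elim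
      case (elim \<nu>)
      \<comment> \<open>The control problem solved here involves neither the sample nor \<nu>: these
        occur only in the two terminal constraints, which have just been checked at
        \<open>v\<close>.\<close>
      from admissible_control_exists[OF assms(30,34,35,7,5), of x0 v]
      obtain x u where xu: "x \<in> H1 T" "u \<in> L2 T" "has_weak_derivative T x (\<lambda>t. A *v x t + B *v u t)"
        "\<And>t. C *v x t + D *v u t = f t" "x 0 = x0" "x T = v" by blast
      have "saa_feasible T A B C D f x0 M q g K \<epsilon> \<nu> ?s x u"
        unfolding saa_feasible_def using xu elim by (auto intro!: exI[of _ "\<lambda>t. A *v x t + B *v u t"])
      then show ?case by blast
    qed
    then obtain \<nu>0 where \<nu>0: "\<And>\<nu>. \<nu>0 \<le> \<nu> \<Longrightarrow> \<exists>x u. saa_feasible T A B C D f x0 M q g K \<epsilon> \<nu> ?s x u"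
      unfolding eventually_sequentially by blast
    show ?case
    proof (intro exI[of _ \<nu>0] allI impI)
      fix \<nu> assume "\<nu>0 \<le> \<nu>"
      then obtain y w where yw: "saa_feasible T A B C D f x0 M q g K \<epsilon> \<nu> ?s y w" using \<nu>0 by blast
      show "\<exists>x u. saa_feasible T A B C D f x0 M q g K \<epsilon> \<nu> ?s x u \<and>
           (\<forall>y v. saa_feasible T A B C D f x0 M q g K \<epsilon> \<nu> ?s y v \<longrightarrow>
              saa_objective T \<delta> xd ud F \<nu> ?s x u \<le> saa_objective T \<delta> xd ud F \<nu> ?s y v)"
        by (rule saa_minimizer_exists[OF assms(5,6,8,9) _ _ _ _ yw, of F "\<lambda>j. \<kappa>1 (?s j)"])
          (use elim(1-4) in blast)+
    qed
  qed
qed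

end
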